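(* Let $\Sigma^n \subset \mathbf{R}^{n+1}$ be a complete properly immersed translator. Then for any $x\in \Sigma$ there exists a constant $C>0$ such that $$\mathrm{Vol}(\Sigma\cap B_r(x))=\int_{\Sigma\cap B_r(x)} d\mu \geq C r \quad \text{for all } r\geq 1.$$
   Context: A translator is a smooth hypersurface $\Sigma^n\subset\mathbf{R}^{n+1}$ satisfying $H=-\langle \mathbf{E}_{n+1},\mathbf{n}\rangle$, where $\mathbf{E}_{n+1}$ is the $(n+1)$-th standard basis vector, $\mathbf{n}$ is the unit normal, and $H=\mathrm{div}_\Sigma \mathbf{n}$ is the mean curvature (so $\Delta x=-H\mathbf{n}$ for the position vector $x$). $B_r(x)$ denotes the extrinsic (Euclidean) ball in $\mathbf{R}^{n+1}$ of radius $r$ centered at $x$, and $d\mu$ is the $n$-dimensional volume (area) measure of $\Sigma$ (the measure of the induced metric). *)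

theory Defs
  imports "HOL-Analysis.Analysis"
begin

text \<open>The ambient space $\mathbf{R}^{n+1}$ is the Euclidean space
  \<^typ>\<open>(real ^ 'n) \<times> real\<close> with \<^term>\<open>n = CARD('n)\<close>, whose
  last standard basis vector is \<open>(0, 1)\<close>. The hypersurface is an abstract smooth manifold
  together with an immersion \<open>F\<close>, so self-intersections are allowed and area is
  counted with multiplicity.\<close>

subsection \<open>Smooth maps on open subsets of Euclidean space\<close>

fun Ck_on :: "nat \<Rightarrow> 'a::real_normed_vector set \<Rightarrow> ('a \<Rightarrow> 'b::real_normed_vector) \<Rightarrow> bool" where
  "Ck_on 0 S f \<longleftrightarrow> continuous_on S f"
| "Ck_on (Suc k) S f \<longleftrightarrow> (\<forall>x\<in>S. f differentiable (at x)) \<and>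
     (\<forall>v. Ck_on k S (\<lambda>x. frechet_derivative f (at x) v))"

definition smooth_on :: "'a::real_normed_vector set \<Rightarrow> ('a \<Rightarrow> 'b::real_normed_vector) \<Rightarrow> bool" where
  "smooth_on S f \<longleftrightarrow> (\<forall>k. Ck_on k S f)"

subsection \<open>Smooth manifolds\<close>

text \<open>A chart is a pair of its domain and its coordinate map. The manifold is the union of the
  domains of its atlas (an open subset of the ambient type, so Hausdorff and second
  countable). Charts map onto open sets, so there is no boundary.\<close>

type_synonym ('m, 'n) chart = "'m set \<times> ('m \<Rightarrow> real ^ 'n)"

definition chart_image :: "('m, 'n) chart \<Rightarrow> (real ^ 'n) set" where
  "chart_image c = snd c ` fst c"

definition chart_inv :: "('m, 'n) chart \<Rightarrow> real ^ 'n \<Rightarrow> 'm" where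
  "chart_inv c = inv_into (fst c) (snd c)"

definition manifold_carrier :: "('m, 'n) chart set \<Rightarrow> 'm set" where
  "manifold_carrier A = (\<Union>c\<in>A. fst c)"

definition smooth_atlas ::
  "('m::{t2_space, second_countable_topology}, 'n::finite) chart set \<Rightarrow> bool" where
  "smooth_atlas A \<longleftrightarrow>
     (\<forall>c\<in>A. open (fst c) \<and> open (chart_image c) \<and>
        homeomorphism (fst c) (chart_image c) (snd c) (chart_inv c)) \<and>
     (\<forall>c\<in>A. \<forall>d\<in>A. smooth_on (snd c ` (fst c \<inter> fst d)) (snd d \<circ> chart_inv c))"

subsection \<open>Geometry of a parametrization\<close>

definition pd :: "(real ^ 'n \<Rightarrow> 'b::real_normed_vector) \<Rightarrow> 'n::finite \<Rightarrow> real ^ 'n \<Rightarrow> 'b" where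
  "pd X i u = frechet_derivative X (at u) (axis i 1)"

definition first_fundamental_form ::
  "(real ^ 'n \<Rightarrow> 'b::real_inner) \<Rightarrow> real ^ 'n \<Rightarrow> real ^ 'n ^ 'n::finite" where
  "first_fundamental_form X u = (\<chi> i j. pd X i u \<bullet> pd X j u)"

text \<open>The divergence over the hypersurface of a field \<open>V\<close> along \<open>X\<close>
  (not necessarily tangential), $g^{ij} \langle \partial_i V, \partial_j X\rangle$; this is
  $\sum_k \langle D_{e_k} V, e_k\rangle$ over an orthonormal basis of the tangent space.\<close>

definition div_surface ::
  "(real ^ 'n \<Rightarrow> 'b::real_inner) \<Rightarrow> (real ^ 'n \<Rightarrow> 'b) \<Rightarrow> real ^ 'n::finite \<Rightarrow> real" where
  "div_surface X V u =
     (\<Sum>i\<in>UNIV. \<Sum>j\<in>UNIV. matrix_inv (first_fundamental_form X u) $ i $ j * (pd V i u \<bullet> pd X j u))"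

definition unit_normal_on ::
  "(real ^ 'n::finite) set \<Rightarrow> (real ^ 'n \<Rightarrow> 'b::real_inner) \<Rightarrow> (real ^ 'n \<Rightarrow> 'b) \<Rightarrow> bool" where
  "unit_normal_on D X N \<longleftrightarrow> smooth_on D N \<and>
     (\<forall>u\<in>D. norm (N u) = 1 \<and> (\<forall>i. N u \<bullet> pd X i u = 0))"

definition mean_curvature ::
  "(real ^ 'n \<Rightarrow> 'b::real_inner) \<Rightarrow> (real ^ 'n \<Rightarrow> 'b) \<Rightarrow> real ^ 'n::finite \<Rightarrow> real" where
  "mean_curvature X N = div_surface X N"

subsection \<open>Immersed hypersurfaces\<close>

definition immersion ::
  "('m::{t2_space, second_countable_topology}, 'n::finite) chart set \<Rightarrow>
     ('m \<Rightarrow> (real ^ 'n) \<times> real) \<Rightarrow> bool" where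
  "immersion A F \<longleftrightarrow>
     (\<forall>c\<in>A. smooth_on (chart_image c) (F \<circ> chart_inv c) \<and>
        (\<forall>u\<in>chart_image c. inj (frechet_derivative (F \<circ> chart_inv c) (at u))))"

text \<open>Both sides of the translator equation change sign with the normal, so a unit normal is
  only needed locally (it always exists on a chart) and orientability is not assumed.\<close>

definition translator ::
  "('m::{t2_space, second_countable_topology}, 'n::finite) chart set \<Rightarrow>
     ('m \<Rightarrow> (real ^ 'n) \<times> real) \<Rightarrow> bool" where
  "translator A F \<longleftrightarrow> smooth_atlas A \<and> immersion A F \<and>
     (\<forall>c\<in>A. \<exists>N. unit_normal_on (chart_image c) (F \<circ> chart_inv c) N \<and>
        (\<forall>u\<in>chart_image c. mean_curvature (F \<circ> chart_inv c) N u = - ((0, 1) \<bullet> N u)))"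

definition properly_immersed ::
  "('m::topological_space, 'n) chart set \<Rightarrow> ('m \<Rightarrow> 'b::topological_space) \<Rightarrow> bool" where
  "properly_immersed A F \<longleftrightarrow> (\<forall>K. compact K \<longrightarrow> compact {p \<in> manifold_carrier A. F p \<in> K})"

text \<open>The distance of the induced metric. Since \<open>F\<close> is locally an embedding, a continuous
  curve is piecewise $C^1$ in the manifold iff its image curve is, and its length in the
  induced metric is the Euclidean length of the image. The library's piecewise $C^1$ condition
  does not bound the derivative near the exceptional points; the nonnegative integral gives a
  non-rectifiable curve length \<open>\<top>\<close>. The distance is \<open>\<top>\<close> between different
  components.\<close>

definition induced_dist ::
  "('m::topological_space, 'n) chart set \<Rightarrow> ('m \<Rightarrow> 'b::real_normed_vector) \<Rightarrow> 'm \<Rightarrow> 'm \<Rightarrow> ennreal"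
  where
  "induced_dist A F p q =
     (INF \<gamma>\<in>{\<gamma>. path \<gamma> \<and> path_image \<gamma> \<subseteq> manifold_carrier A \<and> pathstart \<gamma> = p \<and> pathfinish \<gamma> = q \<and>
             (F \<circ> \<gamma>) piecewise_C1_differentiable_on {0..1}}.
        \<integral>\<^sup>+ t\<in>{0..1}. ennreal (norm (vector_derivative (F \<circ> \<gamma>) (at t))) \<partial>lborel)"

definition complete_induced ::
  "('m::topological_space, 'n) chart set \<Rightarrow> ('m \<Rightarrow> 'b::real_normed_vector) \<Rightarrow> bool" where
  "complete_induced A F \<longleftrightarrow>
     (\<forall>s :: nat \<Rightarrow> 'm. range s \<subseteq> manifold_carrier A \<and>
        (\<forall>e>0. \<exists>k. \<forall>i\<ge>k. \<forall>j\<ge>k. induced_dist A F (s i) (s j) < e) \<longrightarrow>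
        (\<exists>p\<in>manifold_carrier A. (\<lambda>i. induced_dist A F (s i) p) \<longlonglongrightarrow> 0))"

text \<open>In a chart the measure of the induced metric is $\sqrt{\det g}\,du$. On overlaps of charts
  these measures agree, so the global measure is the least one that dominates all of them, i.e.
  their supremum in the complete lattice of measures on the Borel sets of \<open>'m\<close>; it does
  not charge the complement of the carrier.\<close>

definition chart_volume ::
  "('m::topological_space \<Rightarrow> 'b::real_inner) \<Rightarrow> ('m, 'n::finite) chart \<Rightarrow> 'm measure" where
  "chart_volume F c =
     distr
       (density (restrict_space lborel (chart_image c))
          (\<lambda>u. ennreal (sqrt (det (first_fundamental_form (F \<circ> chart_inv c) u)))))
       borel (chart_inv c)"

definition volume_measure ::
  "('m::topological_space, 'n::finite) chart set \<Rightarrow> ('m \<Rightarrow> 'b::real_inner) \<Rightarrow> 'm measure" where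
  "volume_measure A F = (SUP c\<in>A. chart_volume F c)"

end

theory Submission
  imports Defs
begin

text \<open>Write \<open>h\<close> for the height function on the translator. The translator equation gives
  $\Delta h = 1 - |\nabla h|^2$, that is $\mathrm{div}(e^h \nabla h) = e^h$, so
  $\int e^h (\varphi + \langle\nabla\varphi, \nabla h\rangle)\,d\mu = 0$ for every compactly
  supported $C^1$ function $\varphi$. Put $\rho = \sqrt{1 + |F - x|^2}$ and take
  $\varphi = e^{-\rho} (1 - |F - x|^2/r^2)_+^2$. Since $|\nabla h| \le 1$ and
  $|\nabla\rho| \le |F - x| / \rho < 1$, the terms without a derivative of the cutoff contribute at
  least a positive constant independent of $r \ge 1$. The other term is at most
  $\frac{4}{r} \int_{B_r(x)} e^{h - \rho}\,d\mu$, and $h - \rho \le h(x)$, so it is at most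
  $\frac{4}{r} e^{h(x)} \mathrm{Vol}(\Sigma \cap B_r(x))$. Properness makes $\varphi$ compactly
  supported.\<close>

section \<open>Continuously differentiable maps\<close>

text \<open>No global integral of signed functions is set up: the volume measure is a supremum of
  chart measures. The identity is proved inside single charts, for functions with compact support
  there, and assembled with a finite partition of unity over the compact preimage of the closed
  ball. The product rule leaves the terms e^h phi <grad zeta_i, grad h>. They cancel because the
  zeta_i add up to 1 on the ball, but only after they have been brought to common charts, so the
  integral and the pairing with grad h have to be chart independent. The volume measure enters at
  the very end, through the one inequality that it dominates each chart measure. The shape of rho
  has two reasons: unlike the distance it is differentiable at x, and its gradient stays strictly
  below 1, so that a positive amount survives. The constant must not depend on r although the
  partition does; it is therefore an integral over one fixed chart around a preimage of x, with the
  cutoff of radius 1, which lies below the one of radius r.\<close>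

definition C1_on :: "'a::real_normed_vector set \<Rightarrow> ('a \<Rightarrow> 'b::real_normed_vector) \<Rightarrow> bool" where
  "C1_on S f \<longleftrightarrow> (\<forall>x\<in>S. f differentiable (at x)) \<and>
     (\<forall>v. continuous_on S (\<lambda>x. frechet_derivative f (at x) v))"

lemma frechet_derivative_eqI:
  "(f has_derivative f') (at x) \<Longrightarrow> frechet_derivative f (at x) v = f' v"
  by (drule frechet_derivative_at) simp

lemma smooth_on_imp_C1_on: "smooth_on S f \<Longrightarrow> C1_on S f"
  unfolding smooth_on_def C1_on_def by (metis Ck_on.simps)

text \<open>\<open>C1_on\<close> is \<open>Ck_on 1\<close>. Applied to an immersion and to its
  directional derivatives it provides the two derivatives that the symmetry of mixed partials and
  the derivative of the metric consume.\<close>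

lemma smooth_on_imp_C1_on_derivative:
  "smooth_on S f \<Longrightarrow> C1_on S (\<lambda>x. frechet_derivative f (at x) v)"
  unfolding smooth_on_def C1_on_def by (metis Ck_on.simps)

lemma C1_onI:
  assumes "\<And>x. x \<in> S \<Longrightarrow> (f has_derivative f' x) (at x)"
    and "\<And>v. continuous_on S (\<lambda>x. f' x v)"
  shows "C1_on S f"
proof -
  have "frechet_derivative f (at x) = f' x" if "x \<in> S" for x
    using frechet_derivative_at[OF assms(1)[OF that]] by simp
  then have "continuous_on S (\<lambda>x. frechet_derivative f (at x) v)" for v
    using assms(2)[of v] by (subst continuous_on_cong[OF refl]) auto
  then show ?thesis
    using assms(1) unfolding C1_on_def differentiable_def by blast
qed

lemma C1_on_has_derivative:
  "C1_on S f \<Longrightarrow> x \<in> S \<Longrightarrow> (f has_derivative frechet_derivative f (at x)) (at x)"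
  unfolding C1_on_def using frechet_derivative_works by blast

lemma C1_on_continuous_derivative:
  "C1_on S f \<Longrightarrow> continuous_on S (\<lambda>x. frechet_derivative f (at x) v)"
  unfolding C1_on_def by blast

lemma C1_on_imp_continuous_on: "C1_on S f \<Longrightarrow> continuous_on S f"
  by (meson C1_on_has_derivative continuous_at_imp_continuous_on has_derivative_continuous)

lemma C1_on_cong_open:
  assumes "open S" "\<And>x. x \<in> S \<Longrightarrow> f x = g x" "C1_on S g"
  shows "C1_on S f"
proof (rule C1_onI)
  show "(f has_derivative frechet_derivative g (at x)) (at x)" if "x \<in> S" for x
    using C1_on_has_derivative[OF assms(3) that] assms(1,2) that
    by (metis has_derivative_transform_within_open)
  show "continuous_on S (\<lambda>x. frechet_derivative g (at x) v)" for v
    using assms(3) by (rule C1_on_continuous_derivative)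
qed

text \<open>Lets zero extensions and bump functions be checked separately near their support and
  away from it.\<close>

lemma C1_on_local:
  assumes "\<And>x. x \<in> S \<Longrightarrow> \<exists>T. open T \<and> x \<in> T \<and> C1_on T f"
  shows "C1_on S f"
  unfolding C1_on_def
proof (intro conjI ballI allI continuous_at_imp_continuous_on)
  fix x v assume "x \<in> S"
  then obtain T where T: "open T" "x \<in> T" "C1_on T f" using assms by blast
  then show "f differentiable at x" unfolding C1_on_def by blast
  show "isCont (\<lambda>x. frechet_derivative f (at x) v) x"
    using C1_on_continuous_derivative[OF T(3)] T(1,2) continuous_on_eq_continuous_at by blast
qed

lemma C1_on_const: "C1_on S (\<lambda>x. c)"
  by (rule C1_onI[where f' = "\<lambda>x v. 0"]) auto

lemma C1_on_add:
  assumes "C1_on S f" "C1_on S g"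
  shows "C1_on S (\<lambda>x. f x + g x)"
  by (rule C1_onI[where f' = "\<lambda>x v. frechet_derivative f (at x) v + frechet_derivative g (at x) v"])
    (auto intro!: has_derivative_add continuous_on_add C1_on_has_derivative
        C1_on_continuous_derivative assms)

lemma (in bounded_bilinear) C1_on:
  assumes "C1_on S f" "C1_on S g"
  shows "C1_on S (\<lambda>x. prod (f x) (g x))"
proof (rule C1_onI)
  show "((\<lambda>x. prod (f x) (g x)) has_derivative (\<lambda>v. prod (f x) (frechet_derivative g (at x) v)
          + prod (frechet_derivative f (at x) v) (g x))) (at x)" if "x \<in> S" for x
    using assms[THEN C1_on_has_derivative, OF that] by (rule FDERIV)
  show "continuous_on S (\<lambda>x. prod (f x) (frechet_derivative g (at x) v)
          + prod (frechet_derivative f (at x) v) (g x))" for v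
    using assms[THEN C1_on_imp_continuous_on] assms[THEN C1_on_continuous_derivative]
    by (intro continuous_on_add continuous_on)
qed

lemmas C1_on_mult = bounded_bilinear.C1_on[OF bounded_bilinear_mult]
lemmas C1_on_inner = bounded_bilinear.C1_on[OF bounded_bilinear_inner]

lemma C1_on_diff:
  assumes "C1_on S f" "C1_on S g"
  shows "C1_on S (\<lambda>x. f x - g x)"
  by (rule C1_onI[where f' = "\<lambda>x v. frechet_derivative f (at x) v - frechet_derivative g (at x) v"])
    (auto intro!: has_derivative_diff continuous_on_diff C1_on_has_derivative
        C1_on_continuous_derivative assms)

lemma C1_on_sum:
  assumes "\<And>i. i \<in> I \<Longrightarrow> C1_on S (f i)"
  shows "C1_on S (\<lambda>x. \<Sum>i\<in>I. f i x)"
  using assms by (induction I rule: infinite_finite_induct) (auto intro: C1_on_const C1_on_add)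

lemma C1_on_prod:
  fixes f :: "'i \<Rightarrow> 'a::real_normed_vector \<Rightarrow> real"
  assumes "\<And>i. i \<in> I \<Longrightarrow> C1_on S (f i)"
  shows "C1_on S (\<lambda>x. \<Prod>i\<in>I. f i x)"
  using assms by (induction I rule: infinite_finite_induct) (auto intro: C1_on_const C1_on_mult)

lemma C1_on_compose_real:
  fixes f :: "'a::real_normed_vector \<Rightarrow> real"
  assumes f: "C1_on S f"
    and g: "\<And>t. t \<in> f ` S \<Longrightarrow> (g has_real_derivative g' t) (at t)"
    and g': "continuous_on (f ` S) g'"
  shows "C1_on S (\<lambda>x. g (f x))"
proof (rule C1_onI)
  show "((\<lambda>x. g (f x)) has_derivative (\<lambda>v. g' (f x) * frechet_derivative f (at x) v)) (at x)"
    if "x \<in> S" for x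
    using has_derivative_compose[OF C1_on_has_derivative[OF f that]] g[of "f x"] that
    unfolding has_field_derivative_def by blast
  show "continuous_on S (\<lambda>x. g' (f x) * frechet_derivative f (at x) v)" for v
    by (intro continuous_on_mult continuous_on_compose2[OF g'] C1_on_imp_continuous_on
        C1_on_continuous_derivative f order_refl)
qed

lemma C1_on_exp:
  fixes f :: "'a::real_normed_vector \<Rightarrow> real"
  shows "C1_on S f \<Longrightarrow> C1_on S (\<lambda>x. exp (f x))"
  by (rule C1_on_compose_real[where g' = exp]) (auto intro!: DERIV_exp continuous_on_exp continuous_on_id)

lemma C1_on_inverse:
  fixes f :: "'a::real_normed_vector \<Rightarrow> real"
  assumes "C1_on S f" "\<And>x. x \<in> S \<Longrightarrow> f x \<noteq> 0"
  shows "C1_on S (\<lambda>x. inverse (f x))"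
proof (rule C1_on_compose_real[where g' = "\<lambda>t. - (inverse t ^ Suc (Suc 0))", OF assms(1)])
  show "(inverse has_real_derivative - (inverse t ^ Suc (Suc 0))) (at t)" if "t \<in> f ` S" for t
    using that assms(2) by (intro DERIV_inverse) auto
  show "continuous_on (f ` S) (\<lambda>t. - (inverse t ^ Suc (Suc 0)))"
    using assms(2)
    by (intro continuous_on_minus continuous_on_power continuous_on_inverse continuous_on_id) auto
qed

lemma C1_on_divide:
  fixes f g :: "'a::real_normed_vector \<Rightarrow> real"
  assumes "C1_on S f" "C1_on S g" "\<And>x. x \<in> S \<Longrightarrow> g x \<noteq> 0"
  shows "C1_on S (\<lambda>x. f x / g x)"
  unfolding divide_inverse by (intro C1_on_mult C1_on_inverse assms)

lemma C1_on_sqrt: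
  assumes "C1_on S f" "\<And>x. x \<in> S \<Longrightarrow> f x > 0"
  shows "C1_on S (\<lambda>x. sqrt (f x))"
proof (rule C1_on_compose_real[where g' = "\<lambda>t. inverse (sqrt t) / 2", OF assms(1)])
  show "(sqrt has_real_derivative inverse (sqrt t) / 2) (at t)" if "t \<in> f ` S" for t
    using that assms(2) by (intro DERIV_real_sqrt) auto
  have "sqrt t \<noteq> 0" if "t \<in> f ` S" for t
    using that assms(2) by force
  then show "continuous_on (f ` S) (\<lambda>t. inverse (sqrt t) / 2)"
    by (intro continuous_on_divide continuous_on_inverse continuous_on_real_sqrt
        continuous_on_id continuous_on_const) auto
qed

lemma linear_sum_axis:
  assumes "linear f"
  shows "f (v :: real ^ 'n::finite) = (\<Sum>i\<in>UNIV. v $ i *\<^sub>R f (axis i 1))"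
proof -
  have "v = (\<Sum>i\<in>UNIV. v $ i *\<^sub>R axis i 1)"
    by (metis basis_expansion scalar_mult_eq_scaleR)
  then have "f v = f (\<Sum>i\<in>UNIV. v $ i *\<^sub>R axis i 1)" by simp
  then show ?thesis
    by (simp add: linear_sum[OF assms] linear_cmul[OF assms] o_def)
qed

lemma C1_on_derivative_field:
  assumes "C1_on S f" "x \<in> S"
  shows "frechet_derivative f (at x) v = (\<Sum>i\<in>UNIV. v $ i *\<^sub>R pd f i (x :: real ^ 'n::finite))"
  unfolding pd_def using assms
  by (intro linear_sum_axis) (simp add: C1_on_def linear_frechet_derivative)

text \<open>\<open>C1_on\<close> controls the derivative in fixed directions only. Here the
  direction moves with the point, so it is expanded in the finite coordinate basis. The case of
  interest is the direction \<open>height_gradient\<close>.\<close>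

lemma C1_on_continuous_derivative_field:
  fixes f :: "real ^ 'n::finite \<Rightarrow> 'b::real_normed_vector"
  assumes "C1_on S f" "continuous_on T g" "continuous_on T v" "g ` T \<subseteq> S"
  shows "continuous_on T (\<lambda>x. frechet_derivative f (at (g x)) (v x))"
proof -
  have "continuous_on T (\<lambda>x. \<Sum>i\<in>UNIV. v x $ i *\<^sub>R frechet_derivative f (at (g x)) (axis i 1))"
    by (intro continuous_on_sum continuous_on_scaleR continuous_on_component assms
        continuous_on_compose2[OF C1_on_continuous_derivative[OF assms(1)] assms(2)])
  then show ?thesis
    by (rule continuous_on_eq) (use assms in \<open>auto simp: C1_on_derivative_field[OF assms(1)] pd_def\<close>)
qed

lemma pd_eqI: "(f has_derivative f') (at x) \<Longrightarrow> pd f i x = f' (axis i 1)"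
  unfolding pd_def by (simp add: frechet_derivative_at[symmetric])

section \<open>Determinants, mixed partial derivatives, hyperplanes\<close>

lemma matrix_inv_both:
  assumes "invertible A"
  shows "A ** matrix_inv A = mat 1" "matrix_inv A ** A = mat 1"
  using assms someI_ex[of "\<lambda>B. A ** B = mat 1 \<and> B ** A = mat 1"]
  unfolding invertible_def matrix_inv_def by blast+

text \<open>Jacobi's formula. Differentiating the Leibniz expansion gives the sum over i of the
  determinants in which row i of G is replaced by row i of G'. With G' = C G that row is a
  combination of the rows of G, and Cramer's rule leaves the diagonal entry of C times det
  G.\<close>

lemma has_derivative_det:
  fixes G :: "'a::real_normed_vector \<Rightarrow> real ^ 'n::finite ^ 'n"
  assumes "\<And>i j. ((\<lambda>x. G x $ i $ j) has_derivative (\<lambda>h. G' h $ i $ j)) (at x)"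
    and nz: "det (G x) \<noteq> 0"
  shows "((\<lambda>x. det (G x)) has_derivative (\<lambda>h. det (G x) * trace (matrix_inv (G x) ** G' h))) (at x)"
proof -
  have inv: "matrix_inv (G x) ** G x = mat 1"
    using nz by (simp add: invertible_det_nz[symmetric] matrix_inv_both(2))
  have "((\<lambda>x. det (G x)) has_derivative
      (\<lambda>h. \<Sum>p | p permutes UNIV. of_int (sign p) *
         (\<Sum>i\<in>UNIV. G' h $ i $ p i * (\<Prod>j\<in>UNIV - {i}. G x $ j $ p j)))) (at x)"
    unfolding det_def
    by (intro has_derivative_sum has_derivative_mult_right has_derivative_prod assms)
  moreover have "(\<Sum>p | p permutes UNIV. of_int (sign p) *
         (\<Sum>i\<in>UNIV. G' h $ i $ p i * (\<Prod>j\<in>UNIV - {i}. G x $ j $ p j)))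
       = det (G x) * trace (matrix_inv (G x) ** G' h)" (is "?lhs = _") for h
  proof -
    define C where "C = G' h ** matrix_inv (G x)"
    have CG: "C ** G x = G' h"
      unfolding C_def matrix_mul_assoc[symmetric] inv by simp
    have row: "(\<Sum>k\<in>UNIV. row i C $ k *s row k (G x)) = row i (G' h)" for i
      unfolding CG[symmetric] by (simp add: vec_eq_iff row_def matrix_matrix_mult_def)
    have "?lhs = (\<Sum>i\<in>UNIV. \<Sum>p | p permutes UNIV. of_int (sign p) *
         (G' h $ i $ p i * (\<Prod>j\<in>UNIV - {i}. G x $ j $ p j)))"
      unfolding sum_distrib_left by (rule sum.swap)
    also have "\<dots> = (\<Sum>i\<in>UNIV. det (\<chi> k. if k = i then row i (G' h) else row k (G x)))"
    proof (rule sum.cong[OF refl])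
      fix i
      have "(\<Prod>k\<in>UNIV. (\<chi> k. if k = i then row i (G' h) else row k (G x)) $ k $ p k)
          = G' h $ i $ p i * (\<Prod>j\<in>UNIV - {i}. G x $ j $ p j)" for p
        by (subst prod.remove[of _ i]) (auto simp: row_def intro!: prod.cong)
      then show "(\<Sum>p | p permutes UNIV. of_int (sign p) *
            (G' h $ i $ p i * (\<Prod>j\<in>UNIV - {i}. G x $ j $ p j)))
          = det (\<chi> k. if k = i then row i (G' h) else row k (G x))"
        unfolding det_def by simp
    qed
    also have "\<dots> = (\<Sum>i\<in>UNIV. row i C $ i * det (G x))"
      unfolding row[symmetric] by (subst cramer_lemma_transpose) simp
    also have "\<dots> = det (G x) * trace C"
      by (simp add: trace_def row_def sum_distrib_left mult.commute)
    also have "trace C = trace (matrix_inv (G x) ** G' h)"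
      unfolding C_def by (rule trace_mul_sym)
    finally show ?thesis .
  qed
  ultimately show ?thesis by simp
qed

text \<open>Along the segment from the identity to A the quadratic form stays positive, so the
  matrices stay invertible and the determinant cannot change sign from its value 1 at the
  identity.\<close>

lemma det_pos_of_positive_definite:
  fixes A :: "real ^ 'n::finite ^ 'n"
  assumes pos: "\<And>v. v \<noteq> 0 \<Longrightarrow> v \<bullet> (A *v v) > 0"
  shows "det A > 0"
proof (rule ccontr)
  assume "\<not> det A > 0"
  define B where "B t = (\<chi> i j. t * A $ i $ j + (1 - t) * mat 1 $ i $ j)" for t :: real
  have B: "B t *v v = t *\<^sub>R (A *v v) + (1 - t) *\<^sub>R v" for t v
  proof -
    have "B t = t *\<^sub>R A + (1 - t) *\<^sub>R mat 1" by (simp add: B_def vec_eq_iff)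
    then show ?thesis
      by (simp add: matrix_vector_mult_add_rdistrib scaleR_matrix_vector_assoc[symmetric])
  qed
  have "continuous_on {0..1} (\<lambda>t. det (B t))"
    unfolding det_def B_def by (auto intro!: continuous_intros)
  moreover have "B 0 = mat 1" "B 1 = A" by (auto simp: B_def vec_eq_iff)
  ultimately have "\<exists>t\<ge>0. t \<le> 1 \<and> det (B t) = 0"
    using \<open>\<not> det A > 0\<close> by (intro IVT2') auto
  then obtain t where t: "0 \<le> t" "t \<le> 1" "det (B t) = 0" by blast
  then obtain v where v: "v \<noteq> 0" "B t *v v = 0"
    by (metis invertible_det_nz invertible_left_inverse matrix_left_invertible_ker)
  have "v \<bullet> (B t *v v) = t * (v \<bullet> (A *v v)) + (1 - t) * (v \<bullet> v)"
    unfolding B by (simp add: inner_add_right)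
  moreover have "\<dots> > 0"
    using t pos[OF v(1)] v(1) by (cases "t = 0") (auto intro!: add_pos_nonneg)
  ultimately show False using v by simp
qed

section \<open>Symmetry of second derivatives by second differences\<close>

lemma mean_value_direction:
  fixes f :: "'a::real_normed_vector \<Rightarrow> real"
  assumes "0 < t" "\<And>s. 0 \<le> s \<Longrightarrow> s \<le> t \<Longrightarrow> f differentiable (at (x + s *\<^sub>R v))"
  obtains s where "0 < s" "s < t"
    "f (x + t *\<^sub>R v) - f x = t * frechet_derivative f (at (x + s *\<^sub>R v)) v"
proof -
  have der: "((\<lambda>s. f (x + s *\<^sub>R v)) has_derivative
      (\<lambda>h. h * frechet_derivative f (at (x + s *\<^sub>R v)) v)) (at s)" if s: "0 \<le> s" "s \<le> t" for s
  proof -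
    have f: "(f has_derivative frechet_derivative f (at (x + s *\<^sub>R v))) (at (x + s *\<^sub>R v))"
      using assms(2)[OF s] frechet_derivative_works by blast
    have "((\<lambda>s. x + s *\<^sub>R v) has_derivative (\<lambda>h. h *\<^sub>R v)) (at s)"
      by (auto intro!: derivative_eq_intros)
    from has_derivative_compose[OF this f] show ?thesis
      using linear_cmul[OF linear_frechet_derivative[OF assms(2)[OF s]]] by simp
  qed
  have "continuous_on {0..t} (\<lambda>s. f (x + s *\<^sub>R v))"
    by (intro continuous_at_imp_continuous_on ballI has_derivative_continuous[OF der]) auto
  from mvt[OF assms(1) this der] obtain s where "0 < s" "s < t"
      "f (x + t *\<^sub>R v) - f (x + 0 *\<^sub>R v) = (t - 0) * frechet_derivative f (at (x + s *\<^sub>R v)) v"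
    by (metis less_imp_le)
  then show ?thesis using that by simp
qed

text \<open>Two mean value steps, one along v for the increment of f in direction tw and one along w
  for the derivative in direction v, turn the second difference into t^2 times the mixed derivative
  at a nearby point. The second difference is symmetric in v and w while the two steps are not, and
  symmetry of the mixed derivative follows.\<close>

lemma second_difference_near:
  fixes f :: "'a::real_normed_vector \<Rightarrow> real" and v w :: 'a
  assumes "open S" "x \<in> S" "C1_on S f" "C1_on S (\<lambda>y. frechet_derivative f (at y) v)"
  defines "a \<equiv> frechet_derivative (\<lambda>y. frechet_derivative f (at y) v) (at x) w"
  assumes "e > 0"
  shows "\<exists>d>0. \<forall>t. 0 < t \<and> t < d \<longrightarrow>
    \<bar>f (x + t *\<^sub>R v + t *\<^sub>R w) - f (x + t *\<^sub>R v) - f (x + t *\<^sub>R w) + f x - t\<^sup>2 * a\<bar> \<le> t\<^sup>2 * e"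
proof -
  let ?g = "\<lambda>y. frechet_derivative f (at y) v"
  let ?h = "\<lambda>y. frechet_derivative ?g (at y) w"
  have "isCont ?h x"
    using C1_on_continuous_derivative[OF assms(4)] assms(1,2) continuous_on_eq_continuous_at by blast
  then obtain d1 where d1: "d1 > 0" "\<And>y. dist y x < d1 \<Longrightarrow> dist (?h y) (?h x) < e"
    using \<open>e > 0\<close> unfolding continuous_at_eps_delta by blast
  obtain d2 where d2: "d2 > 0" "ball x d2 \<subseteq> S"
    using assms(1,2) open_contains_ball by blast
  define D where "D = min d1 d2"
  \<comment> \<open>For t < d the parallelogram spanned by tv and tw stays within distance D of x;
    the summand 1 covers v = w = 0.\<close>
  define d where "d = D / (norm v + norm w + 1)"
  have D: "D > 0" "d > 0" using d1 d2 by (auto simp: D_def d_def intro!: divide_pos_pos add_nonneg_pos)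
  have near: "dist (x + s *\<^sub>R v + s' *\<^sub>R w) x < D"
    if "0 \<le> s" "s \<le> t" "0 \<le> s'" "s' \<le> t" "t < d" for s s' t
  proof -
    have "dist (x + s *\<^sub>R v + s' *\<^sub>R w) x = norm (s *\<^sub>R v + s' *\<^sub>R w)"
      by (simp add: dist_norm algebra_simps)
    also have "\<dots> \<le> s * norm v + s' * norm w"
      using norm_triangle_ineq[of "s *\<^sub>R v" "s' *\<^sub>R w"] that by simp
    also have "\<dots> \<le> t * norm v + t * norm w"
      using that by (intro add_mono mult_right_mono) auto
    also have "\<dots> \<le> t * (norm v + norm w + 1)" using that by (simp add: algebra_simps)
    also have "\<dots> < d * (norm v + norm w + 1)"
      using that by (intro mult_strict_right_mono add_nonneg_pos) auto
    also have "\<dots> = D"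
    proof -
      have "norm v + norm w + 1 > 0" by (intro add_nonneg_pos) auto
      then show ?thesis unfolding d_def by simp
    qed
    finally show ?thesis .
  qed
  have inS: "x + s *\<^sub>R v + s' *\<^sub>R w \<in> S" if "0 \<le> s" "s \<le> t" "0 \<le> s'" "s' \<le> t" "t < d" for s s' t
    using near[OF that] d2 by (auto simp: D_def dist_commute mem_ball subset_iff)
  show ?thesis
  proof (intro exI conjI allI impI)
    show "d > 0" by fact
    fix t assume t: "0 < t \<and> t < d"
    let ?F = "\<lambda>y. f (y + t *\<^sub>R w) - f y"
    have derF: "(?F has_derivative (\<lambda>h. frechet_derivative f (at (x + s *\<^sub>R v + t *\<^sub>R w)) h
        - frechet_derivative f (at (x + s *\<^sub>R v)) h)) (at (x + s *\<^sub>R v))"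
      if s: "0 \<le> s" "s \<le> t" for s
    proof (intro has_derivative_diff)
      show "(f has_derivative frechet_derivative f (at (x + s *\<^sub>R v))) (at (x + s *\<^sub>R v))"
        using inS[of s t 0] s t by (intro C1_on_has_derivative[OF assms(3)]) auto
      have "(f has_derivative frechet_derivative f (at (x + s *\<^sub>R v + t *\<^sub>R w))) (at (x + s *\<^sub>R v + t *\<^sub>R w))"
        using inS[of s t t] s t by (intro C1_on_has_derivative[OF assms(3)]) auto
      moreover have "((\<lambda>y. y + t *\<^sub>R w) has_derivative (\<lambda>h. h)) (at (x + s *\<^sub>R v))"
        by (auto intro!: derivative_eq_intros)
      ultimately
      show "((\<lambda>y. f (y + t *\<^sub>R w)) has_derivative frechet_derivative f (at (x + s *\<^sub>R v + t *\<^sub>R w))) (at (x + s *\<^sub>R v))"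
        by (rule has_derivative_compose[rotated])
    qed
    obtain s where s: "0 < s" "s < t" and
      "?F (x + t *\<^sub>R v) - ?F x = t * frechet_derivative ?F (at (x + s *\<^sub>R v)) v"
    proof (rule mean_value_direction[of t ?F x v])
      show "0 < t" using t by simp
      show "?F differentiable at (x + s *\<^sub>R v)" if "0 \<le> s" "s \<le> t" for s
        using derF[OF that] unfolding differentiable_def by blast
    qed
    moreover have "frechet_derivative ?F (at (x + s *\<^sub>R v)) v = ?g (x + s *\<^sub>R v + t *\<^sub>R w) - ?g (x + s *\<^sub>R v)"
      using fun_cong[OF frechet_derivative_at[OF derF[of s]], of v] s by simp
    moreover obtain s' where s': "0 < s'" "s' < t" and
      "?g (x + s *\<^sub>R v + t *\<^sub>R w) - ?g (x + s *\<^sub>R v) = t * ?h (x + s *\<^sub>R v + s' *\<^sub>R w)"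
    proof (rule mean_value_direction[of t ?g "x + s *\<^sub>R v" w])
      show "0 < t" using t by simp
      show "?g differentiable at (x + s *\<^sub>R v + s' *\<^sub>R w)" if "0 \<le> s'" "s' \<le> t" for s'
        using inS[of s t s'] s t that assms(4) unfolding C1_on_def by auto
    qed
    ultimately have eq: "?F (x + t *\<^sub>R v) - ?F x = t\<^sup>2 * ?h (x + s *\<^sub>R v + s' *\<^sub>R w)"
      by (simp add: power2_eq_square)
    have "\<bar>?h (x + s *\<^sub>R v + s' *\<^sub>R w) - a\<bar> \<le> e"
      using d1(2)[of "x + s *\<^sub>R v + s' *\<^sub>R w"] near[of s t s'] s s' t
      by (simp add: D_def a_def dist_real_def)
    then have "t\<^sup>2 * \<bar>?h (x + s *\<^sub>R v + s' *\<^sub>R w) - a\<bar> \<le> t\<^sup>2 * e"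
      by (intro mult_left_mono) auto
    moreover have "t\<^sup>2 * \<bar>?h (x + s *\<^sub>R v + s' *\<^sub>R w) - a\<bar> = \<bar>?F (x + t *\<^sub>R v) - ?F x - t\<^sup>2 * a\<bar>"
      unfolding eq by (simp add: abs_mult flip: right_diff_distrib)
    ultimately show "\<bar>f (x + t *\<^sub>R v + t *\<^sub>R w) - f (x + t *\<^sub>R v) - f (x + t *\<^sub>R w) + f x - t\<^sup>2 * a\<bar> \<le> t\<^sup>2 * e"
      by (simp add: algebra_simps)
  qed
qed

lemma second_derivative_symmetric_real:
  fixes f :: "'a::real_normed_vector \<Rightarrow> real"
  assumes "open S" "x \<in> S" "C1_on S f" "\<And>v. C1_on S (\<lambda>y. frechet_derivative f (at y) v)"
  shows "frechet_derivative (\<lambda>y. frechet_derivative f (at y) v) (at x) w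
       = frechet_derivative (\<lambda>y. frechet_derivative f (at y) w) (at x) v" (is "?a = ?b")
proof (rule ccontr)
  assume "?a \<noteq> ?b"
  \<comment> \<open>A third of the gap: the two approximations together account for at most two
    thirds of it.\<close>
  define e where "e = \<bar>?a - ?b\<bar> / 3"
  have e: "e > 0" using \<open>?a \<noteq> ?b\<close> by (simp add: e_def)
  obtain d where d: "d > 0" "\<And>t. 0 < t \<Longrightarrow> t < d \<Longrightarrow>
    \<bar>f (x + t *\<^sub>R v + t *\<^sub>R w) - f (x + t *\<^sub>R v) - f (x + t *\<^sub>R w) + f x - t\<^sup>2 * ?a\<bar> \<le> t\<^sup>2 * e"
    using second_difference_near[OF assms(1-4) e, of v w] by blast
  obtain d' where d': "d' > 0" "\<And>t. 0 < t \<Longrightarrow> t < d' \<Longrightarrow>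
    \<bar>f (x + t *\<^sub>R w + t *\<^sub>R v) - f (x + t *\<^sub>R w) - f (x + t *\<^sub>R v) + f x - t\<^sup>2 * ?b\<bar> \<le> t\<^sup>2 * e"
    using second_difference_near[OF assms(1-4) e, of w v] by blast
  define t where "t = min d d' / 2"
  have t: "0 < t" "t < d" "t < d'" using d(1) d'(1) by (auto simp: t_def)
  have sw: "x + t *\<^sub>R w + t *\<^sub>R v = x + t *\<^sub>R v + t *\<^sub>R w" by simp
  have "\<bar>t\<^sup>2 * ?a - t\<^sup>2 * ?b\<bar> \<le> 2 * (t\<^sup>2 * e)"
    using d(2)[OF t(1,2)] d'(2)[OF t(1,3)] unfolding sw by linarith
  moreover have "\<bar>t\<^sup>2 * ?a - t\<^sup>2 * ?b\<bar> = t\<^sup>2 * (3 * e)"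
    by (simp add: e_def abs_mult flip: right_diff_distrib)
  ultimately show False using e t(1) by simp
qed

text \<open>Reduces to scalar functions by pairing with an arbitrary fixed vector z, which commutes
  with both differentiations.\<close>

lemma second_derivative_symmetric:
  fixes f :: "'a::real_normed_vector \<Rightarrow> 'b::real_inner"
  assumes "open S" "x \<in> S" "C1_on S f" "\<And>v. C1_on S (\<lambda>y. frechet_derivative f (at y) v)"
  shows "frechet_derivative (\<lambda>y. frechet_derivative f (at y) v) (at x) w
       = frechet_derivative (\<lambda>y. frechet_derivative f (at y) w) (at x) v"
proof (rule vector_eq_rdot[THEN iffD1])
  show "\<forall>z. frechet_derivative (\<lambda>y. frechet_derivative f (at y) v) (at x) w \<bullet> z
       = frechet_derivative (\<lambda>y. frechet_derivative f (at y) w) (at x) v \<bullet> z"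
  proof
    fix z
    have comp: "frechet_derivative (\<lambda>y. g y \<bullet> z) (at y) u = frechet_derivative g (at y) u \<bullet> z"
      if "C1_on S g" "y \<in> S" for g :: "'a \<Rightarrow> 'b" and y u
      using fun_cong[OF frechet_derivative_at[OF has_derivative_inner_left[OF C1_on_has_derivative[OF that]]],
          of u z] by simp
    have C: "C1_on S (\<lambda>y. g y \<bullet> z)" if "C1_on S g" for g :: "'a \<Rightarrow> 'b"
      by (intro C1_on_inner C1_on_const that)
    have second: "frechet_derivative (\<lambda>y. frechet_derivative (\<lambda>y. f y \<bullet> z) (at y) u) (at x) u'
        = frechet_derivative (\<lambda>y. frechet_derivative f (at y) u) (at x) u' \<bullet> z" for u u'
    proof -
      have "((\<lambda>y. frechet_derivative (\<lambda>y. f y \<bullet> z) (at y) u) has_derivative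
          (\<lambda>u'. frechet_derivative (\<lambda>y. frechet_derivative f (at y) u) (at x) u' \<bullet> z)) (at x)"
        using has_derivative_inner_left[OF C1_on_has_derivative[OF assms(4,2), of u], of z] assms(1,2)
        by (rule has_derivative_transform_within_open) (simp add: comp assms)
      then show ?thesis by (metis frechet_derivative_at)
    qed
    have "C1_on S (\<lambda>y. frechet_derivative (\<lambda>y. f y \<bullet> z) (at y) u)" for u
      by (rule C1_on_cong_open[OF assms(1) _ C[OF assms(4)[of u]]]) (simp add: comp assms)
    then show "frechet_derivative (\<lambda>y. frechet_derivative f (at y) v) (at x) w \<bullet> z
       = frechet_derivative (\<lambda>y. frechet_derivative f (at y) w) (at x) v \<bullet> z"
      using second_derivative_symmetric_real[OF assms(1,2) C[OF assms(3)], of v w]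
      by (simp add: second)
  qed
qed

text \<open>A dimension count: the range of f has dimension n and misses N, so together they span
  the whole space, and y minus its N component is orthogonal to all of it. This later identifies the
  normal part of the vertical vector.\<close>

lemma orthogonal_complement_hyperplane:
  fixes f :: "real ^ 'n::finite \<Rightarrow> (real ^ 'n) \<times> real"
  assumes "linear f" "inj f" "norm N = 1" "\<And>v. N \<bullet> f v = 0" "\<And>v. y \<bullet> f v = 0"
  shows "y = (y \<bullet> N) *\<^sub>R N"
proof -
  have sub: "subspace (range f)" by (simp add: assms(1) linear_subspace_image)
  have NN: "N \<bullet> N = 1" using assms(3) by (simp add: dot_square_norm)
  have "N \<notin> range f" using assms(4) NN by fastforce
  then have "N \<notin> span (range f)" using sub by (simp add: span_eq_iff[THEN iffD2])
  moreover have "dim (range f) = CARD('n)"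
    using dim_image_eq[OF assms(1), of UNIV] assms(2) by simp
  ultimately have "dim (insert N (range f)) = DIM((real ^ 'n) \<times> real)"
    by (simp add: dim_insert)
  then have U: "span (insert N (range f)) = UNIV" using dim_eq_full by blast
  define z where "z = y - (y \<bullet> N) *\<^sub>R N"
  have "orthogonal z a" if "a \<in> insert N (range f)" for a
    using that assms(4,5) NN by (auto simp: orthogonal_def z_def inner_diff_left)
  then have "orthogonal z z" using orthogonal_to_span[of z "insert N (range f)" z] U
    by (metis UNIV_I orthogonal_commute)
  then show ?thesis by (simp add: orthogonal_def z_def)
qed

section \<open>Change of variables over a finite index type\<close>

text \<open>Induction over transpositions: conjugation by e carries the transposition of a and b to
  that of e a and e b. Since e joins two different types, this is not the usual conjugation inside
  one permutation group.\<close>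

lemma sign_conjugate_bij:
  fixes e :: "'a::finite \<Rightarrow> 'b::finite"
  assumes "bij e" "p permutes UNIV"
  shows "sign (e \<circ> p \<circ> inv e) = sign p"
  using assms(2) finite
proof (induction rule: permutes_induct)
  case id
  have "e \<circ> inv e = id" using assms(1) by (simp add: bij_is_surj flip: surj_iff)
  then show ?case by simp
next
  case (swap a b p)
  have inv: "inv e (e x) = x" for x using assms(1) by (simp add: bij_is_inj)
  have eq: "e \<circ> (Transposition.transpose a b \<circ> p) \<circ> inv e
      = Transposition.transpose (e a) (e b) \<circ> (e \<circ> p \<circ> inv e)"
    using assms(1) by (auto simp: fun_eq_iff Transposition.transpose_def bij_def inj_def)
  have "(e \<circ> p \<circ> inv e) permutes UNIV"
    by (intro bij_imp_permutes bij_betw_trans[of _ _ UNIV] bij_imp_bij_inv assms permutes_bij[OF swap(4)]) auto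
  then have "permutation (e \<circ> p \<circ> inv e)" "permutation p"
    using swap(4) by (auto intro: permutes_imp_permutation[of UNIV])
  moreover have "e a \<noteq> e b" using assms(1) swap(3) by (auto simp: bij_def inj_def)
  ultimately show ?case
    unfolding eq by (subst (1 2) sign_compose)
      (use swap(3,5) in \<open>simp_all add: sign_swap_id permutation_swap_id del: o_apply\<close>)
qed

lemma det_reindex:
  fixes e :: "'a::finite \<Rightarrow> 'b::finite" and A :: "real ^ 'b ^ 'b"
  assumes "bij e"
  shows "det (\<chi> i j. A $ e i $ e j) = det A"
proof -
  have inv: "inv e (e x) = x" "e (inv e y) = y" for x y
    using assms by (auto simp: bij_is_inj bij_is_surj surj_f_inv_f)
  have bij: "bij (inv e)" using assms by (rule bij_imp_bij_inv)
  have perm: "(e \<circ> p \<circ> inv e) permutes UNIV" if "p permutes UNIV" for p :: "'a \<Rightarrow> 'a"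
    using bij_comp[OF bij bij_comp[OF permutes_bij[OF that] assms]]
    by (auto intro!: bij_imp_permutes simp: o_assoc)
  have perm': "(inv e \<circ> q \<circ> e) permutes UNIV" if "q permutes UNIV" for q :: "'b \<Rightarrow> 'b"
    using bij_comp[OF assms bij_comp[OF permutes_bij[OF that] bij]]
    by (auto intro!: bij_imp_permutes simp: o_assoc)
  have prod: "(\<Prod>i\<in>UNIV. A $ e i $ e (p i)) = (\<Prod>j\<in>UNIV. A $ j $ (e \<circ> p \<circ> inv e) j)" for p
    by (rule prod.reindex_bij_witness[where i = "inv e" and j = e]) (auto simp: inv)
  have "det (\<chi> i j. A $ e i $ e j)
      = (\<Sum>p | p permutes UNIV. of_int (sign (e \<circ> p \<circ> inv e)) * (\<Prod>j\<in>UNIV. A $ j $ (e \<circ> p \<circ> inv e) j))"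
    unfolding det_def prod[symmetric] by (auto intro!: sum.cong simp: sign_conjugate_bij[OF assms])
  also have "\<dots> = det A"
    unfolding det_def
    by (rule sum.reindex_bij_witness
        [where i = "\<lambda>q. inv e \<circ> q \<circ> e" and j = "\<lambda>p. e \<circ> p \<circ> inv e"])
      (auto simp: perm perm' inv fun_eq_iff)
  finally show ?thesis .
qed

lemma prod_Basis_vec: "(\<Prod>b\<in>(Basis :: (real ^ 'n::finite) set). f b) = (\<Prod>i\<in>UNIV. f (axis i 1))"
proof -
  have B: "(Basis :: (real ^ 'n) set) = range (\<lambda>i. axis i 1)"
    by (auto simp: Basis_vec_def)
  have inj: "inj (\<lambda>i::'n. axis i (1::real))"
    by (auto simp: inj_def axis_eq_axis)
  show ?thesis unfolding B by (subst prod.reindex[OF inj]) (simp add: o_def)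
qed

definition reindex_vec :: "('b \<Rightarrow> 'a) \<Rightarrow> real ^ 'a \<Rightarrow> real ^ 'b" where
  "reindex_vec e x = (\<chi> i. x $ e i)"

lemma bounded_linear_reindex_vec: "bounded_linear (reindex_vec e :: real ^ 'a::finite \<Rightarrow> real ^ 'b::finite)"
  unfolding linear_conv_bounded_linear[symmetric]
  by (rule linearI) (auto simp: reindex_vec_def vec_eq_iff)

lemma reindex_vec_inverse:
  "bij e \<Longrightarrow> reindex_vec e (reindex_vec (inv e) x) = x"
  "bij e \<Longrightarrow> reindex_vec (inv e) (reindex_vec e y) = y"
  by (simp_all add: reindex_vec_def vec_eq_iff bij_is_inj bij_is_surj surj_f_inv_f)

text \<open>Relabelling coordinates maps boxes to boxes with the same side lengths in another order,
  and Lebesgue measure is determined by its values on boxes.\<close>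

lemma distr_lborel_reindex_vec:
  fixes e :: "'b::finite \<Rightarrow> 'a::finite"
  assumes "bij e"
  shows "distr lborel borel (reindex_vec e) = (lborel :: (real ^ 'b) measure)"
proof (rule lborel_eqI[symmetric])
  have [measurable]: "reindex_vec e \<in> borel_measurable borel"
    by (intro borel_measurable_continuous_onI linear_continuous_on bounded_linear_reindex_vec)
  fix l u :: "real ^ 'b"
  assume le: "\<And>b. b \<in> Basis \<Longrightarrow> l \<bullet> b \<le> u \<bullet> b"
  let ?T = "reindex_vec (inv e) :: real ^ 'b \<Rightarrow> real ^ 'a"
  have le': "l $ i \<le> u $ i" for i
    using le[of "axis i 1"] by (simp add: inner_axis)
  have inv: "inv e (e x) = x" "e (inv e y) = y" for x y
    using assms by (auto simp: bij_is_inj bij_is_surj surj_f_inv_f)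
  have "reindex_vec e -` box l u = box (?T l) (?T u)"
  proof (rule set_eqI)
    fix x
    have "x \<in> reindex_vec e -` box l u \<longleftrightarrow> (\<forall>i. l $ i < x $ e i \<and> x $ e i < u $ i)"
      by (simp add: mem_box_cart reindex_vec_def)
    also have "\<dots> \<longleftrightarrow> (\<forall>j. l $ inv e j < x $ j \<and> x $ j < u $ inv e j)"
      by (metis inv)
    finally show "x \<in> reindex_vec e -` box l u \<longleftrightarrow> x \<in> box (?T l) (?T u)"
      by (simp add: mem_box_cart reindex_vec_def)
  qed
  then have "emeasure (distr lborel borel (reindex_vec e)) (box l u) = emeasure lborel (box (?T l) (?T u))"
    by (subst emeasure_distr) auto
  also have "\<dots> = (\<Prod>b\<in>Basis. (?T u - ?T l) \<bullet> b)"
    by (rule emeasure_lborel_box) (auto simp: Basis_vec_def inner_axis reindex_vec_def le')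
  also have "(\<Prod>b\<in>Basis. (?T u - ?T l) \<bullet> b) = (\<Prod>b\<in>Basis. (u - l) \<bullet> b)"
    unfolding prod_Basis_vec
    by (rule prod.reindex_bij_witness[where i = e and j = "inv e"])
      (auto simp: inv inner_axis reindex_vec_def)
  finally show "emeasure (distr lborel borel (reindex_vec e)) (box l u) = ennreal (\<Prod>b\<in>Basis. (u - l) \<bullet> b)" .
qed simp

text \<open>The library's change of variables theorem needs a well-ordered index type; this copy of
  an arbitrary finite index type has one.\<close>

typedef ('n::finite) ordered_index = "{..<CARD('n)}"
  by (rule exI[of _ 0]) simp

lemma card_ordered_index: "CARD('n::finite ordered_index) = CARD('n)"
  using type_definition.card[OF type_definition_ordered_index[where 'n = 'n]] by simp

instance ordered_index :: (finite) finite
proof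
  show "finite (UNIV :: 'a ordered_index set)"
    unfolding type_definition.univ[OF type_definition_ordered_index]
    by (rule finite_imageI) (rule finite_lessThan)
qed

instantiation ordered_index :: (finite) wellorder
begin

definition less_eq_ordered_index :: "'a ordered_index \<Rightarrow> 'a ordered_index \<Rightarrow> bool" where
  "i \<le> j \<longleftrightarrow> Rep_ordered_index i \<le> Rep_ordered_index j"

definition less_ordered_index :: "'a ordered_index \<Rightarrow> 'a ordered_index \<Rightarrow> bool" where
  "i < j \<longleftrightarrow> Rep_ordered_index i < Rep_ordered_index j"

instance
proof (intro_classes, goal_cases)
  case (4 i j)
  then have "Rep_ordered_index i = Rep_ordered_index j"
    by (simp add: less_eq_ordered_index_def)
  then show ?case by (rule Rep_ordered_index_inject[THEN iffD1])
next
  case (6 P a)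
  show ?case
  proof (induction "Rep_ordered_index a" arbitrary: a rule: less_induct)
    case less
    show ?case
      by (rule 6, rule less) (simp add: less_ordered_index_def)
  qed
qed (auto simp: less_eq_ordered_index_def less_ordered_index_def)

end

lemma ex_bij_ordered_index: "\<exists>e :: 'n::finite ordered_index \<Rightarrow> 'n. bij e"
  using finite_same_card_bij[of "UNIV :: 'n ordered_index set" "UNIV :: 'n set"]
  by (simp add: card_ordered_index)

text \<open>Passes from Lebesgue integrals of functions extended by zero to gauge integrals over a
  set, the setting of the change of variables theorem.\<close>

lemma absolutely_integrable_lborel_support:
  fixes f :: "'a::euclidean_space \<Rightarrow> 'b::euclidean_space"
  assumes "integrable lborel f" "\<And>x. x \<notin> S \<Longrightarrow> f x = 0"
  shows "f absolutely_integrable_on S" "integral S f = integral\<^sup>L lborel f"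
proof -
  have "integrable lebesgue f"
    using assms(1) by (simp add: integrable_completion)
  then have "f absolutely_integrable_on UNIV"
    by (simp add: set_integrable_def)
  moreover have eq: "(\<lambda>x. if x \<in> S then f x else 0) = f" using assms(2) by auto
  ultimately show "f absolutely_integrable_on S"
    using absolutely_integrable_restrict_UNIV[of S f] by simp
  show "integral S f = integral\<^sup>L lborel f"
    using Henstock_Kurzweil_Integration.integral_restrict_UNIV[of S f] integral_lborel[OF assms(1)]
    unfolding eq by simp
qed

text \<open>Both integrands are total functions that vanish off U and off its image. This is the
  form in which chart integrals appear, and integrability is known for them beforehand.\<close>

lemma lborel_change_of_variables_wellorder:
  fixes g :: "real ^ 'w::{finite,wellorder} \<Rightarrow> real ^ 'w::_" and F :: "real ^ 'w::_ \<Rightarrow> real"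
  assumes "open U" "inj_on g U" "\<And>x. x \<in> U \<Longrightarrow> (g has_derivative g' x) (at x)"
    and F: "integrable lborel F" "\<And>y. y \<notin> g ` U \<Longrightarrow> F y = 0"
    and G: "integrable lborel G" "\<And>x. x \<notin> U \<Longrightarrow> G x = 0"
    and GF: "\<And>x. x \<in> U \<Longrightarrow> G x = \<bar>det (matrix (g' x))\<bar> * F (g x)"
  shows "integral\<^sup>L lborel G = integral\<^sup>L lborel F"
proof -
  \<comment> \<open>The theorem applied below is about integrands with values in some
    \<open>real ^ 'k\<close>, so scalars are viewed as vectors with one coordinate.\<close>
  define lift :: "real \<Rightarrow> real ^ 1" where "lift r = r *\<^sub>R 1" for r
  have lift: "integrable lborel (\<lambda>x. lift (h x))" "integral\<^sup>L lborel (\<lambda>x. lift (h x)) = lift (integral\<^sup>L lborel h)"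
    if "integrable lborel h" for h :: "real ^ 'w::_ \<Rightarrow> real"
    using that by (simp_all add: lift_def)
  have lift0: "lift r = 0 \<longleftrightarrow> r = 0" for r by (simp add: lift_def)
  note AF = absolutely_integrable_lborel_support[OF lift(1)[OF F(1)], of "g ` U", unfolded lift0, OF F(2)]
  note AG = absolutely_integrable_lborel_support[OF lift(1)[OF G(1)], of U, unfolded lift0, OF G(2)]
  have "U \<in> sets lebesgue" using assms(1) by (simp add: borel_open)
  from has_absolute_integral_change_of_variables[OF this has_derivative_at_withinI[OF assms(3)] assms(2),
      of "\<lambda>x. lift (F x)" "lift (integral\<^sup>L lborel F)"]
  have "integral U (\<lambda>x. \<bar>det (matrix (g' x))\<bar> *\<^sub>R lift (F (g x))) = lift (integral\<^sup>L lborel F)"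
    using AF lift(2)[OF F(1)] by auto
  moreover have "integral U (\<lambda>x. \<bar>det (matrix (g' x))\<bar> *\<^sub>R lift (F (g x))) = integral U (\<lambda>x. lift (G x))"
    by (rule Henstock_Kurzweil_Integration.integral_cong) (simp add: GF lift_def)
  ultimately have "lift (integral\<^sup>L lborel G) = lift (integral\<^sup>L lborel F)"
    using AG lift(2)[OF G(1)] by simp
  then show ?thesis by (simp add: lift_def)
qed

text \<open>Conjugating g with a relabelling of the coordinates moves the problem to a well-ordered
  index type; neither Lebesgue measure nor the Jacobian determinant notices the relabelling.\<close>

lemma lborel_change_of_variables:
  fixes g :: "real ^ 'n::finite \<Rightarrow> real ^ 'n" and F :: "real ^ 'n \<Rightarrow> real"
  assumes "open U" "inj_on g U" "\<And>x. x \<in> U \<Longrightarrow> (g has_derivative g' x) (at x)"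
    and F: "integrable lborel F" "\<And>y. y \<notin> g ` U \<Longrightarrow> F y = 0"
    and G: "integrable lborel G" "\<And>x. x \<notin> U \<Longrightarrow> G x = 0"
    and GF: "\<And>x. x \<in> U \<Longrightarrow> G x = \<bar>det (matrix (g' x))\<bar> * F (g x)"
  shows "integral\<^sup>L lborel G = integral\<^sup>L lborel F"
proof -
  obtain e0 :: "'n ordered_index \<Rightarrow> 'n" where e0: "bij e0" using ex_bij_ordered_index by blast
  define e where "e = inv e0"
  have e: "bij e" "inv e = e0" unfolding e_def using e0 by (auto intro: bij_imp_bij_inv simp: inv_inv_eq)
  let ?T = "reindex_vec e :: real ^ 'n ordered_index \<Rightarrow> real ^ 'n"
  let ?S = "reindex_vec e0 :: real ^ 'n \<Rightarrow> real ^ 'n ordered_index"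
  have TS: "?T (?S x) = x" "?S (?T y) = y" for x y
    using reindex_vec_inverse[OF e(1)] unfolding e(2) by auto
  have blT: "bounded_linear ?T" and blS: "bounded_linear ?S" by (rule bounded_linear_reindex_vec)+
  have [measurable]: "?T \<in> borel_measurable lborel"
    using borel_measurable_continuous_onI[OF linear_continuous_on[OF blT]] by simp
  have int: "integrable lborel (\<lambda>x. f (?T x)) \<and> integral\<^sup>L lborel (\<lambda>x. f (?T x)) = integral\<^sup>L lborel f"
    if f: "integrable lborel f" for f :: "real ^ 'n \<Rightarrow> real"
  proof -
    have "integrable (distr lborel borel ?T) f"
      unfolding distr_lborel_reindex_vec[OF e(1)] by (rule f)
    moreover have [measurable]: "f \<in> borel_measurable borel" using f by auto
    ultimately have "integrable lborel (\<lambda>x. f (?T x))"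
      by (subst (asm) integrable_distr_eq) auto
    moreover have "integral\<^sup>L (distr lborel borel ?T) f = integral\<^sup>L lborel (\<lambda>x. f (?T x))"
      by (rule integral_distr) auto
    ultimately show ?thesis unfolding distr_lborel_reindex_vec[OF e(1)] by simp
  qed
  let ?g = "\<lambda>x. ?S (g (?T x))"
  let ?g' = "\<lambda>x h. ?S (g' (?T x) (?T h))"
  have "integral\<^sup>L lborel (\<lambda>x. G (?T x)) = integral\<^sup>L lborel (\<lambda>x. F (?T x))"
  proof (rule lborel_change_of_variables_wellorder[where g = ?g and g' = ?g' and U = "?T -` U"])
    show "open (?T -` U)"
      using assms(1) by (intro open_vimage linear_continuous_on blT)
    show "inj_on ?g (?T -` U)"
      using assms(2) by (auto simp: inj_on_def) (metis TS)
    show "(?g has_derivative ?g' x) (at x)" if "x \<in> ?T -` U" for x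
      using assms(3)[of "?T x"] that
      by (intro bounded_linear.has_derivative[OF blS]
          has_derivative_compose[OF bounded_linear_imp_has_derivative[OF blT]]) auto
    show "integrable lborel (\<lambda>x. F (?T x))" "integrable lborel (\<lambda>x. G (?T x))"
      using int F(1) G(1) by auto
    show "F (?T y) = 0" if "y \<notin> ?g ` (?T -` U)" for y
    proof (rule F(2), rule notI)
      assume "?T y \<in> g ` U"
      then obtain x where x: "x \<in> U" "?T y = g x" by blast
      then have "y = ?g (?S x)" by (metis TS)
      moreover have "?S x \<in> ?T -` U" using x TS by simp
      ultimately show False using that by blast
    qed
    show "G (?T x) = 0" if "x \<notin> ?T -` U" for x using G(2) that by auto
    show "G (?T x) = \<bar>det (matrix (?g' x))\<bar> * F (?T (?g x))" if "x \<in> ?T -` U" for x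
    proof -
      have ax: "?T (axis j 1) = axis (e0 j) 1" for j
      proof -
        have "e i = j \<longleftrightarrow> i = e0 j" for i
          using e0 unfolding e_def by (metis bij_inv_eq_iff)
        then show ?thesis by (auto simp: reindex_vec_def vec_eq_iff axis_def)
      qed
      \<comment> \<open>The Jacobian matrix of the conjugated map is the old one with rows and
        columns renamed by the same bijection, which \<open>det_reindex\<close> ignores.\<close>
      have "matrix (?g' x) = (\<chi> i j. matrix (g' (?T x)) $ e0 i $ e0 j)"
        by (simp add: matrix_def vec_eq_iff ax) (simp add: reindex_vec_def)
      then show ?thesis using GF[of "?T x"] that det_reindex[OF e0] by (simp add: TS)
    qed
  qed
  then show ?thesis using int F(1) G(1) by auto
qed

section \<open>Integrals of compactly supported functions\<close>

text \<open>U and the complement of K form an open cover; the extension is f on the one and 0 on the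
  other. The Hausdorff property makes K closed.\<close>

lemma continuous_on_extension_by_zero:
  fixes f :: "'a::t2_space \<Rightarrow> 'b::real_normed_vector"
  assumes "open U" "compact K" "K \<subseteq> U" "continuous_on U f" "\<And>x. x \<in> U \<Longrightarrow> x \<notin> K \<Longrightarrow> f x = 0"
  shows "continuous_on UNIV (\<lambda>x. if x \<in> U then f x else 0)"
proof -
  have "continuous_on (U \<union> - K) (\<lambda>x. if x \<in> U then f x else 0)"
  proof (rule continuous_on_open_Un)
    show "continuous_on U (\<lambda>x. if x \<in> U then f x else 0)"
      using assms(4) by (rule continuous_on_eq) simp
    show "continuous_on (- K) (\<lambda>x. if x \<in> U then f x else 0)"
      by (rule continuous_on_eq[OF continuous_on_const[of _ 0]]) (use assms(5) in auto)
  qed (use assms compact_imp_closed in auto)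
  moreover have "U \<union> - K = UNIV" using assms(3) by blast
  ultimately show ?thesis by simp
qed

lemma C1_on_extension_by_zero:
  assumes "open U" "compact K" "K \<subseteq> U" "C1_on U f" "\<And>x. x \<in> U \<Longrightarrow> x \<notin> K \<Longrightarrow> f x = 0"
  shows "C1_on UNIV (\<lambda>x. if x \<in> U then f x else 0)"
proof (rule C1_on_local)
  fix x
  show "\<exists>T. open T \<and> x \<in> T \<and> C1_on T (\<lambda>x. if x \<in> U then f x else 0)"
  proof (cases "x \<in> U")
    case True
    have "C1_on U (\<lambda>x. if x \<in> U then f x else 0)"
      by (rule C1_on_cong_open[OF assms(1) _ assms(4)]) simp
    with True assms(1) show ?thesis by blast
  next
    case False
    have "open (- K)" using assms(2) by (simp add: compact_imp_closed open_Compl)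
    then have "C1_on (- K) (\<lambda>x. if x \<in> U then f x else 0)"
      by (rule C1_on_cong_open[OF _ _ C1_on_const[of _ 0]]) (use assms(5) in auto)
    with False assms(3) \<open>open (- K)\<close> show ?thesis by blast
  qed
qed

lemma integrable_compact_support:
  fixes f :: "'a::euclidean_space \<Rightarrow> 'b::{banach, second_countable_topology}"
  assumes "compact K" "continuous_on UNIV f" "\<And>x. x \<notin> K \<Longrightarrow> f x = 0"
  shows "integrable lborel f"
proof -
  have "integrable lborel (\<lambda>x. indicator K x *\<^sub>R f x)"
    by (rule borel_integrable_compact) (use assms continuous_on_subset in blast)+
  moreover have "(\<lambda>x. indicator K x *\<^sub>R f x) = f"
    using assms(3) by (auto simp: indicator_def)
  ultimately show ?thesis by simp
qed

lemma frechet_derivative_zero_outside: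
  assumes "closed K" "\<And>x. x \<notin> K \<Longrightarrow> f x = 0" "x \<notin> K"
  shows "frechet_derivative f (at x) v = 0"
proof -
  have "((\<lambda>x. 0) has_derivative (\<lambda>h. 0)) (at x)" by simp
  then have "(f has_derivative (\<lambda>h. 0)) (at x)"
    by (rule has_derivative_transform_within_open[of _ _ _ _ "- K"]) (use assms in auto)
  then show ?thesis by (metis frechet_derivative_at)
qed

text \<open>The divergence theorem for one coordinate direction. By translation invariance every
  difference quotient integrates to 0, and dominated convergence carries this to the
  derivative.\<close>

lemma integral_derivative_compact_support:
  fixes f :: "'a::euclidean_space \<Rightarrow> real"
  assumes C1: "C1_on UNIV f" and K: "compact K" "\<And>x. x \<notin> K \<Longrightarrow> f x = 0"
  shows "integral\<^sup>L lborel (\<lambda>x. frechet_derivative f (at x) v) = 0"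
proof -
  let ?D = "\<lambda>x. frechet_derivative f (at x) v"
  define g where "g n x = (f (x + (1 / real (Suc n)) *\<^sub>R v) - f x) * real (Suc n)" for n x
  have cont: "continuous_on UNIV f" using C1 by (rule C1_on_imp_continuous_on)
  have contD: "continuous_on UNIV ?D" using C1 by (rule C1_on_continuous_derivative)
  have [measurable]: "f \<in> borel_measurable borel" "?D \<in> borel_measurable borel"
    using cont contD by (auto intro: borel_measurable_continuous_onI)
  have intf: "integrable lborel f" by (rule integrable_compact_support[OF K(1) cont K(2)])
  have D0: "?D x = 0" if "x \<notin> K" for x
    using frechet_derivative_zero_outside[OF compact_imp_closed[OF K(1)] K(2) that] .
  have trans: "integrable lborel (\<lambda>x. f (x + c)) \<and> integral\<^sup>L lborel (\<lambda>x. f (x + c)) = integral\<^sup>L lborel f" for c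
  proof -
    have "integrable (distr lborel borel ((+) c)) f"
      unfolding lborel_distr_plus by (rule intf)
    then have "integrable lborel (\<lambda>x. f (c + x))"
      by (subst (asm) integrable_distr_eq) auto
    moreover have "integral\<^sup>L (distr lborel borel ((+) c)) f = integral\<^sup>L lborel (\<lambda>x. f (c + x))"
      by (rule integral_distr) auto
    ultimately show ?thesis unfolding lborel_distr_plus by (simp add: add.commute)
  qed
  have intg: "integral\<^sup>L lborel (g n) = 0" for n
    unfolding g_def using trans[of "(1 / real (Suc n)) *\<^sub>R v"] intf by simp
  have "compact (?D ` K)" by (rule compact_continuous_image[OF continuous_on_subset[OF contD] K(1)]) simp
  then have "bounded (?D ` K)" by (rule compact_imp_bounded)
  then obtain M0 where M0: "\<forall>y\<in>?D ` K. norm y \<le> M0" unfolding bounded_iff ..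
  define M where "M = max M0 0"
  have M: "\<bar>?D x\<bar> \<le> M" for x
  proof (cases "x \<in> K")
    case True
    then have "norm (?D x) \<le> M0" using M0 by blast
    then show ?thesis by (simp add: M_def)
  next
    case False
    show ?thesis unfolding D0[OF False] by (simp add: M_def)
  qed
  obtain R where R: "K \<subseteq> cball 0 R"
    using compact_imp_bounded[OF K(1)] bounded_subset_ballD[of K 0] ball_subset_cball by (metis order_trans)
  \<comment> \<open>The increments are at most \<open>v\<close> in size because the step 1/(n+1) is
    at most 1, so all difference quotients vanish outside this one ball.\<close>
  define B where "B = cball (0::'a) (R + norm v)"
  have bound: "\<bar>g n x\<bar> \<le> M * indicator B x" for n x
  proof -
    let ?t = "1 / real (Suc n)"
    obtain s where s: "0 < s" "s < ?t" "f (x + ?t *\<^sub>R v) - f x = ?t * ?D (x + s *\<^sub>R v)"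
      by (rule mean_value_direction[of ?t f x v]) (use C1 in \<open>simp_all add: C1_on_def\<close>)
    then have eq: "g n x = ?D (x + s *\<^sub>R v)" by (simp add: g_def)
    show ?thesis
    proof (cases "x \<in> B")
      case True
      then show ?thesis using M eq by simp
    next
      case False
      have "x + s *\<^sub>R v \<notin> K"
      proof
        assume "x + s *\<^sub>R v \<in> K"
        then have "norm (x + s *\<^sub>R v) \<le> R" using R by auto
        moreover have "norm x \<le> norm (x + s *\<^sub>R v) + norm (s *\<^sub>R v)"
          using norm_triangle_ineq4[of "x + s *\<^sub>R v" "s *\<^sub>R v"] by simp
        moreover have "?t \<le> 1" by simp
        then have "s \<le> 1" using s(2) by linarith
        then have "norm (s *\<^sub>R v) \<le> norm v" using s(1) by (simp add: mult_left_le_one_le)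
        ultimately show False using False by (simp add: B_def)
      qed
      then show ?thesis using False eq D0 by simp
    qed
  qed
  have lim: "(\<lambda>n. g n x) \<longlonglongrightarrow> ?D x" for x
  proof -
    have der: "((\<lambda>t. f (x + t *\<^sub>R v)) has_derivative (\<lambda>h. h * ?D x)) (at 0)"
    proof -
      have f: "(f has_derivative frechet_derivative f (at x)) (at (x + 0 *\<^sub>R v))"
        using C1_on_has_derivative[OF C1] by simp
      have "((\<lambda>t. x + t *\<^sub>R v) has_derivative (\<lambda>h. h *\<^sub>R v)) (at 0)"
        by (auto intro!: derivative_eq_intros)
      from has_derivative_compose[OF this f] show ?thesis
        using linear_cmul[OF linear_frechet_derivative, of f "at x"] C1 by (simp add: C1_on_def)
    qed
    then have "((\<lambda>t. f (x + t *\<^sub>R v)) has_real_derivative ?D x) (at 0)"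
      by (simp add: has_field_derivative_def mult.commute[of _ "?D x"])
    then have "((\<lambda>h. (f (x + h *\<^sub>R v) - f x) / h) \<longlongrightarrow> ?D x) (at 0)"
      by (simp add: DERIV_def)
    moreover have "filterlim (\<lambda>n. 1 / real (Suc n)) (at 0) sequentially"
      unfolding filterlim_at using LIMSEQ_inverse_real_of_nat by (simp add: divide_inverse)
    ultimately have "(\<lambda>n. (f (x + (1 / real (Suc n)) *\<^sub>R v) - f x) / (1 / real (Suc n))) \<longlonglongrightarrow> ?D x"
      by (rule filterlim_compose)
    then show ?thesis by (simp add: g_def)
  qed
  have "(\<lambda>n. integral\<^sup>L lborel (g n)) \<longlonglongrightarrow> integral\<^sup>L lborel ?D"
  proof (rule integral_dominated_convergence[where w = "\<lambda>x. M * indicator B x"])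
    show "integrable lborel (\<lambda>x. M * indicator B x)"
      by (intro integrable_mult_right integrable_real_indicator)
        (auto simp: B_def emeasure_lborel_cball_finite[unfolded infinity_ennreal_def])
    show "AE x in lborel. (\<lambda>n. g n x) \<longlonglongrightarrow> ?D x" using lim by simp
    show "AE x in lborel. norm (g n x) \<le> M * indicator B x" for n using bound by simp
    show "g n \<in> borel_measurable lborel" for n unfolding g_def by measurable
  qed simp
  then have "(\<lambda>n. 0) \<longlonglongrightarrow> integral\<^sup>L lborel ?D" unfolding intg .
  then show ?thesis by (simp add: LIMSEQ_const_iff)
qed

section \<open>Local parametrizations of a translator\<close>

lemma transpose_matrix_inv:
  fixes A :: "real ^ 'n::finite ^ 'n"
  assumes "invertible A" "transpose A = A"
  shows "transpose (matrix_inv A) = matrix_inv A"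
proof -
  let ?B = "matrix_inv A"
  have "transpose ?B ** A = transpose (A ** ?B)"
    by (simp add: matrix_transpose_mul assms(2))
  also have "\<dots> = mat 1" by (simp add: matrix_inv_both(1)[OF assms(1)])
  finally have "transpose ?B ** A ** ?B = ?B" by simp
  then show ?thesis
    by (simp add: matrix_mul_assoc[symmetric] matrix_inv_both(1)[OF assms(1)])
qed

definition area_density :: "(real ^ 'n \<Rightarrow> 'b::real_inner) \<Rightarrow> real ^ 'n::finite \<Rightarrow> real" where
  "area_density X u = sqrt (det (first_fundamental_form X u))"

text \<open>The coordinate vector v with components g^{kl} d_l h of the intrinsic gradient of the
  height h. With it, the derivative of psi in direction v is the pairing <grad psi, grad h>.\<close>

definition height_gradient :: "(real ^ 'n \<Rightarrow> 'b::real_inner \<times> real) \<Rightarrow> real ^ 'n::finite \<Rightarrow> real ^ 'n" where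
  "height_gradient X u = matrix_inv (first_fundamental_form X u) *v (\<chi> i. pd X i u \<bullet> (0, 1))"

text \<open>Collects what can be said without a normal. Normals are chosen chart by chart and need
  not match on overlaps, so all transition formulas are derived at this level.\<close>

locale immersed_patch =
  fixes U :: "(real ^ 'n::finite) set" and X :: "real ^ 'n \<Rightarrow> (real ^ 'n) \<times> real"
  assumes open_U: "open U" and smooth_X: "smooth_on U X"
    and inj_dX: "u \<in> U \<Longrightarrow> inj (frechet_derivative X (at u))"
begin

lemma C1_X: "C1_on U X" using smooth_X by (rule smooth_on_imp_C1_on)

lemma C1_pd: "C1_on U (pd X i)"
  using smooth_on_imp_C1_on_derivative[OF smooth_X] unfolding pd_def[abs_def] .

lemma dX_linear: "u \<in> U \<Longrightarrow> linear (frechet_derivative X (at u))"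
  using C1_X by (simp add: C1_on_def linear_frechet_derivative)

lemma dX_eq_sum: "u \<in> U \<Longrightarrow> frechet_derivative X (at u) v = (\<Sum>i\<in>UNIV. v $ i *\<^sub>R pd X i u)"
  by (rule C1_on_derivative_field[OF C1_X])

lemma fff_component: "first_fundamental_form X u $ i $ j = pd X i u \<bullet> pd X j u"
  by (simp add: first_fundamental_form_def)

lemma fff_symmetric: "transpose (first_fundamental_form X u) = first_fundamental_form X u"
  by (simp add: vec_eq_iff transpose_def fff_component inner_commute)

lemma inner_fff:
  assumes "u \<in> U"
  shows "v \<bullet> (first_fundamental_form X u *v w)
       = frechet_derivative X (at u) v \<bullet> frechet_derivative X (at u) w"
  by (simp add: dX_eq_sum[OF assms] inner_vec_def matrix_vector_mult_def fff_component
      inner_sum_left inner_sum_right sum_distrib_left mult_ac) (rule sum.swap)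

lemma det_fff_pos:
  assumes "u \<in> U"
  shows "det (first_fundamental_form X u) > 0"
proof (rule det_pos_of_positive_definite)
  fix v :: "real ^ 'n" assume "v \<noteq> 0"
  then have "frechet_derivative X (at u) v \<noteq> 0"
    using inj_dX[OF assms] linear_injective_0[OF dX_linear[OF assms]] by blast
  then show "v \<bullet> (first_fundamental_form X u *v v) > 0" by (simp add: inner_fff[OF assms])
qed

lemma fff_invertible: "u \<in> U \<Longrightarrow> invertible (first_fundamental_form X u)"
  using det_fff_pos[of u] by (simp add: invertible_det_nz)

lemma area_density_pos: "u \<in> U \<Longrightarrow> area_density X u > 0"
  by (simp add: area_density_def det_fff_pos)

lemma C1_fff: "C1_on U (\<lambda>u. first_fundamental_form X u $ i $ j)"
  unfolding fff_component by (intro C1_on_inner C1_pd)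

lemma C1_det_fff: "C1_on U (\<lambda>u. det (first_fundamental_form X u))"
  unfolding det_def by (intro C1_on_sum C1_on_mult C1_on_const C1_on_prod C1_fff)

lemma C1_area_density: "C1_on U (area_density X)"
  using C1_on_sqrt[OF C1_det_fff det_fff_pos] unfolding area_density_def[abs_def] .

lemma fff_height_gradient:
  "u \<in> U \<Longrightarrow> first_fundamental_form X u *v height_gradient X u = (\<chi> i. pd X i u \<bullet> (0, 1))"
  by (simp add: height_gradient_def matrix_vector_mul_assoc matrix_inv_both(1) fff_invertible)

text \<open>By Cramer's rule each component is a quotient of determinants with continuously
  differentiable entries, so \<open>matrix_inv\<close> never has to be differentiated.\<close>

lemma C1_height_gradient: "C1_on U (\<lambda>u. height_gradient X u $ k)"
proof (rule C1_on_cong_open[OF open_U])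
  let ?M = "\<lambda>u. (\<chi> i j. if j = k then pd X i u \<bullet> (0, 1) else first_fundamental_form X u $ i $ j)"
  show "height_gradient X u $ k = det (?M u) / det (first_fundamental_form X u)" if "u \<in> U" for u
  proof -
    have "det (first_fundamental_form X u) \<noteq> 0" using det_fff_pos[OF that] by simp
    note eq = cramer[OF this, THEN iffD1, OF fff_height_gradient[OF that], unfolded vec_lambda_beta]
    show ?thesis by (subst eq) (rule vec_lambda_beta)
  qed
  have "C1_on U (\<lambda>u. ?M u $ i $ j)" for i j
    by (cases "j = k") (simp_all add: C1_fff C1_on_inner C1_on_const C1_pd)
  then have "C1_on U (\<lambda>u. det (?M u))"
    unfolding det_def by (intro C1_on_sum C1_on_mult C1_on_const C1_on_prod)
  then show "C1_on U (\<lambda>u. det (?M u) / det (first_fundamental_form X u))"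
    by (intro C1_on_divide C1_det_fff) (use det_fff_pos in force)+
qed

lemma dX_height_gradient_inner:
  assumes "u \<in> U"
  shows "frechet_derivative X (at u) (height_gradient X u) \<bullet> frechet_derivative X (at u) w
       = (0, 1) \<bullet> frechet_derivative X (at u) w"
proof -
  have "frechet_derivative X (at u) w \<bullet> frechet_derivative X (at u) (height_gradient X u)
      = w \<bullet> (\<chi> i. pd X i u \<bullet> (0, 1))"
    by (simp add: inner_fff[OF assms, symmetric] fff_height_gradient[OF assms])
  also have "\<dots> = frechet_derivative X (at u) w \<bullet> (0, 1)"
    unfolding dX_eq_sum[OF assms] inner_sum_left by (simp add: inner_vec_def)
  finally show ?thesis by (simp add: inner_commute)
qed

lemma matrix_inv_fff_symmetric:
  assumes "u \<in> U"
  shows "matrix_inv (first_fundamental_form X u) $ k $ l = matrix_inv (first_fundamental_form X u) $ l $ k"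
proof -
  have "transpose (matrix_inv (first_fundamental_form X u)) $ l $ k
      = matrix_inv (first_fundamental_form X u) $ l $ k"
    unfolding transpose_matrix_inv[OF fff_invertible[OF assms] fff_symmetric] ..
  then show ?thesis by (simp only: transpose_def vec_lambda_beta)
qed

text \<open>The differential is injective, so a tangent vector is determined by its products with
  tangent vectors. This gives the transformation law between charts without transforming an inverse
  matrix.\<close>

lemma height_gradient_unique:
  assumes "u \<in> U" "\<And>w. frechet_derivative X (at u) v \<bullet> frechet_derivative X (at u) w
       = (0, 1) \<bullet> frechet_derivative X (at u) w"
  shows "v = height_gradient X u"
proof -
  let ?d = "v - height_gradient X u"
  have "frechet_derivative X (at u) ?d \<bullet> frechet_derivative X (at u) ?d = 0"
    using assms(2)[of ?d] dX_height_gradient_inner[OF assms(1), of ?d]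
    by (simp add: linear_diff[OF dX_linear[OF assms(1)]] inner_diff_left)
  then have "frechet_derivative X (at u) ?d = 0" by simp
  then have "?d = 0"
    using inj_dX[OF assms(1)] linear_injective_0[OF dX_linear[OF assms(1)]] by blast
  then show ?thesis by simp
qed

text \<open>The image T is the tangential projection of the unit vector (0, 1): its squared norm
  equals its product with (0, 1), hence is at most its norm.\<close>

lemma norm_dX_height_gradient_le:
  assumes "u \<in> U"
  shows "norm (frechet_derivative X (at u) (height_gradient X u)) \<le> 1"
proof -
  let ?T = "frechet_derivative X (at u) (height_gradient X u)"
  have "(norm ?T)\<^sup>2 = (0, 1) \<bullet> ?T"
    using dX_height_gradient_inner[OF assms] by (simp add: power2_norm_eq_inner)
  also have "\<dots> \<le> norm (0 :: real ^ 'n, 1 :: real) * norm ?T" by (rule norm_cauchy_schwarz)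
  finally have "norm ?T * norm ?T \<le> 1 * norm ?T" by (simp add: norm_Pair power2_eq_square)
  then show ?thesis by (cases "?T = 0") (simp_all only: mult_le_cancel_right, simp_all)
qed

text \<open>Jacobi's formula gives half the trace of g^{-1} g'. Each entry of g' has two terms by
  the product rule, and the symmetry of g^{-1} makes their contributions equal, which absorbs the
  factor 1/2.\<close>

lemma frechet_derivative_area_density:
  assumes "u \<in> U"
  shows "frechet_derivative (area_density X) (at u) h = area_density X u *
    (\<Sum>k\<in>UNIV. \<Sum>l\<in>UNIV. matrix_inv (first_fundamental_form X u) $ k $ l *
       (frechet_derivative (pd X k) (at u) h \<bullet> pd X l u))"
proof -
  let ?g = "first_fundamental_form X" and ?B = "matrix_inv (first_fundamental_form X u)"
  let ?D = "\<lambda>k. frechet_derivative (pd X k) (at u)"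
  define G' where "G' h = (\<chi> i j. pd X i u \<bullet> ?D j h + ?D i h \<bullet> pd X j u)" for h
  have "((\<lambda>u. ?g u $ i $ j) has_derivative (\<lambda>h. G' h $ i $ j)) (at u)" for i j
    unfolding fff_component G'_def
    using has_derivative_inner[OF C1_on_has_derivative[OF C1_pd assms] C1_on_has_derivative[OF C1_pd assms]]
    by simp
  from has_derivative_det[OF this] det_fff_pos[OF assms]
  have det: "((\<lambda>u. det (?g u)) has_derivative (\<lambda>h. det (?g u) * trace (?B ** G' h))) (at u)"
    by simp
  have "(area_density X has_derivative
      (\<lambda>h. inverse (sqrt (det (?g u))) / 2 * (det (?g u) * trace (?B ** G' h)))) (at u)"
    using has_derivative_compose[OF det
        DERIV_real_sqrt[OF det_fff_pos[OF assms], unfolded has_field_derivative_def]]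
    unfolding area_density_def[abs_def] .
  then have "frechet_derivative (area_density X) (at u) h
      = inverse (sqrt (det (?g u))) / 2 * (det (?g u) * trace (?B ** G' h))"
    by (rule frechet_derivative_eqI)
  also have "\<dots> = area_density X u * (trace (?B ** G' h) / 2)"
    using det_fff_pos[OF assms] real_sqrt_mult_self[of "det (?g u)"]
    by (simp add: area_density_def field_simps)
  also have "trace (?B ** G' h) / 2 = (\<Sum>k\<in>UNIV. \<Sum>l\<in>UNIV. ?B $ k $ l * (?D k h \<bullet> pd X l u))"
  proof -
    note sym = matrix_inv_fff_symmetric[OF assms]
    have "trace (?B ** G' h) = (\<Sum>k\<in>UNIV. \<Sum>l\<in>UNIV. ?B $ k $ l * (?D k h \<bullet> pd X l u))
        + (\<Sum>k\<in>UNIV. \<Sum>l\<in>UNIV. ?B $ k $ l * (?D l h \<bullet> pd X k u))"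
      by (simp add: trace_def matrix_matrix_mult_def G'_def distrib_left sum.distrib inner_commute)
    also have "(\<Sum>k\<in>UNIV. \<Sum>l\<in>UNIV. ?B $ k $ l * (?D l h \<bullet> pd X k u))
        = (\<Sum>l\<in>UNIV. \<Sum>k\<in>UNIV. ?B $ l $ k * (?D l h \<bullet> pd X k u))"
      by (subst sum.swap) (intro sum.cong refl arg_cong2[of _ _ _ _ "(*)"] sym)
    finally show ?thesis by simp
  qed
  finally show ?thesis .
qed

end

locale translator_patch = immersed_patch U X
  for U :: "(real ^ 'n::finite) set" and X :: "real ^ 'n \<Rightarrow> (real ^ 'n) \<times> real" +
  fixes N :: "real ^ 'n \<Rightarrow> (real ^ 'n) \<times> real"
  assumes normal: "unit_normal_on U X N"
    and translating: "u \<in> U \<Longrightarrow> mean_curvature X N u = - ((0, 1) \<bullet> N u)"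
begin

lemma C1_N: "C1_on U N"
  using normal by (simp add: unit_normal_on_def smooth_on_imp_C1_on)

lemma N_orthogonal_pd: "u \<in> U \<Longrightarrow> N u \<bullet> pd X i u = 0"
  using normal by (simp add: unit_normal_on_def)

lemma N_orthogonal: "u \<in> U \<Longrightarrow> N u \<bullet> frechet_derivative X (at u) v = 0"
  by (simp add: dX_eq_sum inner_sum_right N_orthogonal_pd)

lemma norm_N: "u \<in> U \<Longrightarrow> norm (N u) = 1"
  using normal by (simp add: unit_normal_on_def)

text \<open>The vertical vector minus the image of the gradient is orthogonal to the tangent space,
  hence a multiple of N; its coefficient is found by pairing with N.\<close>

lemma dX_height_gradient:
  assumes "u \<in> U"
  shows "frechet_derivative X (at u) (height_gradient X u) = (0, 1) - ((0, 1) \<bullet> N u) *\<^sub>R N u"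
proof -
  let ?T = "frechet_derivative X (at u) (height_gradient X u)"
  have "((0, 1) - ?T) \<bullet> frechet_derivative X (at u) w = 0" for w
    by (simp only: inner_diff_left dX_height_gradient_inner[OF assms] diff_self)
  then have a: "(0, 1) - ?T = (((0, 1) - ?T) \<bullet> N u) *\<^sub>R N u"
    using orthogonal_complement_hyperplane[OF dX_linear[OF assms] inj_dX[OF assms] norm_N[OF assms]
          N_orthogonal[OF assms]] by blast
  have b: "((0, 1) - ?T) \<bullet> N u = (0, 1) \<bullet> N u"
    using N_orthogonal[OF assms] by (simp only: inner_diff_left inner_commute[of ?T])
  have eq: "(0, 1) - ?T = ((0, 1) \<bullet> N u) *\<^sub>R N u" using a unfolding b .
  have "t = e - n" if "e - t = n" for e t n :: "(real ^ 'n) \<times> real"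
    using that by auto
  from this[OF eq] show ?thesis .
qed

text \<open>Differentiate $dX(v) = E - \langle E, N\rangle N$ and contract with $g^{kl} X_l$: the left side
  becomes $\mathrm{div}\,v + v(\log\sqrt{\det g})$ by Jacobi's formula, the right side
  $-\langle E, N\rangle H$.\<close>

lemma divergence_height_gradient:
  assumes u: "u \<in> U"
  shows "(\<Sum>k\<in>UNIV. pd (\<lambda>u. area_density X u * height_gradient X u $ k) k u)
       = area_density X u * ((0, 1) \<bullet> N u)\<^sup>2"
proof -
  let ?g = "first_fundamental_form X u" and ?B = "matrix_inv (first_fundamental_form X u)"
  let ?v = "height_gradient X" and ?\<sigma> = "area_density X"
  let ?E = "(0, 1) :: (real ^ 'n) \<times> real"
  define D where "D k = frechet_derivative (pd X k) (at u) (?v u)" for k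
  note sym = matrix_inv_fff_symmetric[OF u]
  have gB: "(\<Sum>l\<in>UNIV. ?B $ k $ l * (pd X i u \<bullet> pd X l u)) = (if i = k then 1 else 0)" for i k
  proof -
    have "(?g ** ?B) $ i $ k = (\<Sum>l\<in>UNIV. ?B $ k $ l * (pd X i u \<bullet> pd X l u))"
      by (simp add: matrix_matrix_mult_def fff_component sym[of k] mult.commute)
    then show ?thesis by (simp add: matrix_inv_both(1)[OF fff_invertible[OF u]] mat_def)
  qed
  have mixed: "frechet_derivative (pd X i) (at u) (axis k 1) = frechet_derivative (pd X k) (at u) (axis i 1)" for i k
    using second_derivative_symmetric[OF open_U u C1_X smooth_on_imp_C1_on_derivative[OF smooth_X],
        of "axis i 1" "axis k 1"]
    unfolding pd_def[abs_def] .
  have key: "(\<Sum>i\<in>UNIV. pd (\<lambda>u. ?v u $ i) k u * (pd X i u \<bullet> pd X l u)) + D k \<bullet> pd X l u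
      = - (?E \<bullet> N u) * (pd N k u \<bullet> pd X l u)" for k l
  proof -
    have "((\<lambda>u. \<Sum>i\<in>UNIV. ?v u $ i *\<^sub>R pd X i u) has_derivative
        (\<lambda>h. \<Sum>i\<in>UNIV. ?v u $ i *\<^sub>R frechet_derivative (pd X i) (at u) h
          + frechet_derivative (\<lambda>u. ?v u $ i) (at u) h *\<^sub>R pd X i u)) (at u)"
      by (intro has_derivative_sum has_derivative_scaleR C1_on_has_derivative[OF _ u] C1_height_gradient C1_pd)
    then have l: "((\<lambda>u. frechet_derivative X (at u) (?v u)) has_derivative
        (\<lambda>h. \<Sum>i\<in>UNIV. ?v u $ i *\<^sub>R frechet_derivative (pd X i) (at u) h
          + frechet_derivative (\<lambda>u. ?v u $ i) (at u) h *\<^sub>R pd X i u)) (at u)"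
      by (rule has_derivative_transform_within_open[OF _ open_U u]) (simp add: dX_eq_sum)
    have "((\<lambda>u. ?E - (?E \<bullet> N u) *\<^sub>R N u) has_derivative
        (\<lambda>h. 0 - ((?E \<bullet> N u) *\<^sub>R frechet_derivative N (at u) h
             + (?E \<bullet> frechet_derivative N (at u) h) *\<^sub>R N u))) (at u)"
      by (intro has_derivative_diff has_derivative_const has_derivative_scaleR
          has_derivative_inner_right C1_on_has_derivative[OF C1_N u])
    then have r: "((\<lambda>u. frechet_derivative X (at u) (?v u)) has_derivative
        (\<lambda>h. 0 - ((?E \<bullet> N u) *\<^sub>R frechet_derivative N (at u) h
             + (?E \<bullet> frechet_derivative N (at u) h) *\<^sub>R N u))) (at u)"
      by (rule has_derivative_transform_within_open[OF _ open_U u]) (simp add: dX_height_gradient)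
    have eq: "(\<Sum>i\<in>UNIV. ?v u $ i *\<^sub>R frechet_derivative (pd X i) (at u) (axis k 1)
          + frechet_derivative (\<lambda>u. ?v u $ i) (at u) (axis k 1) *\<^sub>R pd X i u)
        = 0 - ((?E \<bullet> N u) *\<^sub>R frechet_derivative N (at u) (axis k 1)
             + (?E \<bullet> frechet_derivative N (at u) (axis k 1)) *\<^sub>R N u)"
      using has_derivative_unique[OF l r] by meson
    \<comment> \<open>Symmetry of mixed partials exchanges the indices k and i, so the sum becomes
      the derivative of X_k along v, the quantity that occurs in the derivative of the area density
      along v.\<close>
    have Dk: "(\<Sum>i\<in>UNIV. ?v u $ i *\<^sub>R frechet_derivative (pd X i) (at u) (axis k 1)) = D k"
      unfolding D_def mixed[of _ k] using C1_on_derivative_field[OF C1_pd u, of k "?v u"]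
      by (simp add: pd_def)
    have "D k + (\<Sum>i\<in>UNIV. pd (\<lambda>u. ?v u $ i) k u *\<^sub>R pd X i u)
        = - (?E \<bullet> N u) *\<^sub>R pd N k u - (?E \<bullet> pd N k u) *\<^sub>R N u"
      using eq unfolding sum.distrib Dk by (simp add: pd_def)
    then have "(D k + (\<Sum>i\<in>UNIV. pd (\<lambda>u. ?v u $ i) k u *\<^sub>R pd X i u)) \<bullet> pd X l u
        = (- (?E \<bullet> N u) *\<^sub>R pd N k u - (?E \<bullet> pd N k u) *\<^sub>R N u) \<bullet> pd X l u"
      by (rule arg_cong)
    then show ?thesis
      unfolding inner_add_left inner_diff_left inner_sum_left inner_scaleR_left N_orthogonal_pd[OF u]
      by simp
  qed
  have "(\<Sum>k\<in>UNIV. \<Sum>l\<in>UNIV. ?B $ k $ l *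
        ((\<Sum>i\<in>UNIV. pd (\<lambda>u. ?v u $ i) k u * (pd X i u \<bullet> pd X l u)) + D k \<bullet> pd X l u))
      = - (?E \<bullet> N u) * mean_curvature X N u"
    unfolding key mean_curvature_def div_surface_def by (simp add: sum_distrib_left sum_negf mult_ac)
  \<comment> \<open>The translator equation enters here and makes -<E, N> H equal to the square of
    <E, N>.\<close>
  then have "(\<Sum>k\<in>UNIV. \<Sum>l\<in>UNIV. ?B $ k $ l * (\<Sum>i\<in>UNIV. pd (\<lambda>u. ?v u $ i) k u * (pd X i u \<bullet> pd X l u)))
      + (\<Sum>k\<in>UNIV. \<Sum>l\<in>UNIV. ?B $ k $ l * (D k \<bullet> pd X l u)) = (?E \<bullet> N u)\<^sup>2"
    unfolding translating[OF u] by (simp add: distrib_left sum.distrib power2_eq_square)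
  moreover have "(\<Sum>l\<in>UNIV. ?B $ k $ l * (\<Sum>i\<in>UNIV. pd (\<lambda>u. ?v u $ i) k u * (pd X i u \<bullet> pd X l u)))
      = pd (\<lambda>u. ?v u $ k) k u" for k
  proof -
    have "(\<Sum>l\<in>UNIV. ?B $ k $ l * (\<Sum>i\<in>UNIV. pd (\<lambda>u. ?v u $ i) k u * (pd X i u \<bullet> pd X l u)))
        = (\<Sum>i\<in>UNIV. pd (\<lambda>u. ?v u $ i) k u * (\<Sum>l\<in>UNIV. ?B $ k $ l * (pd X i u \<bullet> pd X l u)))"
      unfolding sum_distrib_left by (subst sum.swap) (simp add: mult_ac)
    then show ?thesis unfolding gB by (simp add: if_distrib cong: if_cong)
  qed
  ultimately have div: "(\<Sum>k\<in>UNIV. pd (\<lambda>u. ?v u $ k) k u)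
      + (\<Sum>k\<in>UNIV. \<Sum>l\<in>UNIV. ?B $ k $ l * (D k \<bullet> pd X l u)) = (?E \<bullet> N u)\<^sup>2"
    by simp
  have "pd (\<lambda>u. ?\<sigma> u * ?v u $ k) k u = ?\<sigma> u * pd (\<lambda>u. ?v u $ k) k u + pd ?\<sigma> k u * ?v u $ k" for k
    using pd_eqI[OF has_derivative_mult[OF C1_on_has_derivative[OF C1_area_density u]
          C1_on_has_derivative[OF C1_height_gradient u]], of k k]
    by (simp add: pd_def)
  then have "(\<Sum>k\<in>UNIV. pd (\<lambda>u. ?\<sigma> u * ?v u $ k) k u)
      = ?\<sigma> u * (\<Sum>k\<in>UNIV. pd (\<lambda>u. ?v u $ k) k u) + (\<Sum>k\<in>UNIV. ?v u $ k *\<^sub>R pd ?\<sigma> k u)"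
    by (simp add: sum.distrib sum_distrib_left mult.commute)
  also have "(\<Sum>k\<in>UNIV. ?v u $ k *\<^sub>R pd ?\<sigma> k u) = frechet_derivative ?\<sigma> (at u) (?v u)"
    using C1_on_derivative_field[OF C1_area_density u] by simp
  also have "\<dots> = ?\<sigma> u * (\<Sum>k\<in>UNIV. \<Sum>l\<in>UNIV. ?B $ k $ l * (D k \<bullet> pd X l u))"
    unfolding D_def by (rule frechet_derivative_area_density[OF u])
  finally show ?thesis using div by (simp flip: distrib_left)
qed

text \<open>The divergence theorem for the compactly supported field sigma e^h psi v. The divergence
  of sigma v contributes <E, N>^2 and the derivative of e^h along v contributes |grad h|^2 = 1 - <E,
  N>^2. They add up to 1, so the normal disappears from the identity.\<close>

lemma integral_weighted_divergence:
  fixes \<psi> :: "real ^ 'n \<Rightarrow> real"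
  assumes \<psi>: "C1_on U \<psi>" and K: "compact K" "K \<subseteq> U" "\<And>u. u \<in> U \<Longrightarrow> u \<notin> K \<Longrightarrow> \<psi> u = 0"
  shows "integral\<^sup>L lborel (\<lambda>u. if u \<in> U then area_density X u * exp (X u \<bullet> (0, 1)) *
     (\<psi> u + frechet_derivative \<psi> (at u) (height_gradient X u)) else 0) = 0"
proof -
  let ?v = "height_gradient X" and ?\<sigma> = "area_density X" and ?e = "\<lambda>u. exp (X u \<bullet> (0, 1))"
  let ?E = "(0, 1) :: (real ^ 'n) \<times> real"
  define \<theta> where "\<theta> u = ?e u * \<psi> u" for u
  define w where "w k u = (if u \<in> U then ?\<sigma> u * ?v u $ k * \<theta> u else 0)" for k u
  have e: "C1_on U ?e" by (intro C1_on_exp C1_on_inner C1_on_const C1_X)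
  have \<theta>: "C1_on U \<theta>" unfolding \<theta>_def[abs_def] by (intro C1_on_mult e \<psi>)
  have \<sigma>v: "C1_on U (\<lambda>u. ?\<sigma> u * ?v u $ k)" for k
    by (intro C1_on_mult C1_area_density C1_height_gradient)
  have C1w: "C1_on UNIV (w k)" for k
    unfolding w_def[abs_def]
    by (rule C1_on_extension_by_zero[OF open_U K(1,2)])
      (use K(3) in \<open>auto simp: \<theta>_def intro!: C1_on_mult[OF \<sigma>v \<theta>, unfolded \<theta>_def]\<close>)
  have w0: "w k u = 0" if "u \<notin> K" for k u using that K(3) by (auto simp: w_def \<theta>_def)
  have pdw0: "pd (w k) k u = 0" if "u \<notin> K" for k u
    unfolding pd_def using frechet_derivative_zero_outside[OF compact_imp_closed[OF K(1)] w0 that] .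
  have int0: "integral\<^sup>L lborel (pd (w k) k) = 0" for k
    unfolding pd_def[abs_def] by (rule integral_derivative_compact_support[OF C1w K(1) w0])
  have intw: "integrable lborel (pd (w k) k)" for k
    by (rule integrable_compact_support[OF K(1) _ pdw0])
      (use C1_on_continuous_derivative[OF C1w] in \<open>simp add: pd_def[abs_def]\<close>)
  have "(\<Sum>k\<in>UNIV. pd (w k) k u) = (if u \<in> U then ?\<sigma> u * ?e u *
     (\<psi> u + frechet_derivative \<psi> (at u) (?v u)) else 0)" for u
  proof (cases "u \<in> U")
    case u: True
    have "((\<lambda>u. ?\<sigma> u * ?v u $ k * \<theta> u) has_derivative
        (\<lambda>h. ?\<sigma> u * ?v u $ k * frechet_derivative \<theta> (at u) h
           + frechet_derivative (\<lambda>u. ?\<sigma> u * ?v u $ k) (at u) h * \<theta> u)) (at u)" for k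
      by (intro has_derivative_mult C1_on_has_derivative[OF _ u] \<sigma>v \<theta>)
    then have "(w k has_derivative (\<lambda>h. ?\<sigma> u * ?v u $ k * frechet_derivative \<theta> (at u) h
           + frechet_derivative (\<lambda>u. ?\<sigma> u * ?v u $ k) (at u) h * \<theta> u)) (at u)" for k
      by (rule has_derivative_transform_within_open[OF _ open_U u]) (simp add: w_def)
    from pd_eqI[OF this]
    have "pd (w k) k u = ?\<sigma> u * (?v u $ k *\<^sub>R pd \<theta> k u) + pd (\<lambda>u. ?\<sigma> u * ?v u $ k) k u * \<theta> u" for k
      by (simp add: pd_def)
    then have "(\<Sum>k\<in>UNIV. pd (w k) k u)
        = ?\<sigma> u * (\<Sum>k\<in>UNIV. ?v u $ k *\<^sub>R pd \<theta> k u) + (\<Sum>k\<in>UNIV. pd (\<lambda>u. ?\<sigma> u * ?v u $ k) k u) * \<theta> u"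
      by (simp add: sum.distrib sum_distrib_left sum_distrib_right)
    also have "(\<Sum>k\<in>UNIV. ?v u $ k *\<^sub>R pd \<theta> k u) = frechet_derivative \<theta> (at u) (?v u)"
      by (rule C1_on_derivative_field[OF \<theta> u, symmetric])
    also have "frechet_derivative \<theta> (at u) (?v u)
        = ?e u * frechet_derivative \<psi> (at u) (?v u) + (frechet_derivative X (at u) (?v u) \<bullet> ?E) * ?e u * \<psi> u"
    proof -
      have "(?e has_derivative (\<lambda>h. (frechet_derivative X (at u) h \<bullet> ?E) * ?e u)) (at u)"
        by (intro has_derivative_exp has_derivative_inner_left C1_on_has_derivative[OF C1_X u])
      from has_derivative_mult[OF this C1_on_has_derivative[OF \<psi> u]]
      have "(\<theta> has_derivative (\<lambda>h. ?e u * frechet_derivative \<psi> (at u) h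
          + (frechet_derivative X (at u) h \<bullet> ?E) * ?e u * \<psi> u)) (at u)"
        unfolding \<theta>_def[abs_def] .
      then show ?thesis by (rule frechet_derivative_eqI)
    qed
    also have "frechet_derivative X (at u) (?v u) \<bullet> ?E = 1 - (?E \<bullet> N u)\<^sup>2"
      unfolding dX_height_gradient[OF u] inner_diff_left inner_scaleR_left inner_commute[of "N u" ?E]
      by (simp add: power2_eq_square)
    also note divergence_height_gradient[OF u]
    finally show ?thesis using u by (simp add: \<theta>_def algebra_simps)
  next
    case False
    then have "u \<notin> K" using K(2) by blast
    with False show ?thesis by (simp add: pdw0)
  qed
  then have "integral\<^sup>L lborel (\<lambda>u. if u \<in> U then ?\<sigma> u * ?e u *
     (\<psi> u + frechet_derivative \<psi> (at u) (?v u)) else 0) = integral\<^sup>L lborel (\<lambda>u. \<Sum>k\<in>UNIV. pd (w k) k u)"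
    by simp
  also have "\<dots> = 0" by (subst Bochner_Integration.integral_sum) (simp_all add: intw int0)
  finally show ?thesis .
qed

end

section \<open>Integration over a translator\<close>

locale translator_manifold =
  fixes A :: "('m::{t2_space, second_countable_topology}, 'n::finite) chart set"
    and F :: "'m \<Rightarrow> (real ^ 'n) \<times> real"
  assumes translator_F: "translator A F"
begin

section \<open>Charts, overlaps and transition maps\<close>

lemma chart_homeomorphism:
  "c \<in> A \<Longrightarrow> homeomorphism (fst c) (chart_image c) (snd c) (chart_inv c)"
  using translator_F by (simp add: translator_def smooth_atlas_def)

lemma open_chart_domain: "c \<in> A \<Longrightarrow> open (fst c)"
  and open_chart_image: "c \<in> A \<Longrightarrow> open (chart_image c)"
  using translator_F by (simp_all add: translator_def smooth_atlas_def)

lemma chart_inv_left: "c \<in> A \<Longrightarrow> p \<in> fst c \<Longrightarrow> chart_inv c (snd c p) = p"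
  and chart_inv_right: "c \<in> A \<Longrightarrow> u \<in> chart_image c \<Longrightarrow> snd c (chart_inv c u) = u"
  and chart_in_image: "p \<in> fst c \<Longrightarrow> snd c p \<in> chart_image c"
  and chart_inv_in_domain: "c \<in> A \<Longrightarrow> u \<in> chart_image c \<Longrightarrow> chart_inv c u \<in> fst c"
  using chart_homeomorphism[of c] by (auto simp: homeomorphism_def chart_image_def)

lemma continuous_on_chart: "c \<in> A \<Longrightarrow> continuous_on (fst c) (snd c)"
  and continuous_on_chart_inv: "c \<in> A \<Longrightarrow> continuous_on (chart_image c) (chart_inv c)"
  using chart_homeomorphism[of c] by (simp_all add: homeomorphism_def)

lemma open_carrier: "open (manifold_carrier A)"
  unfolding manifold_carrier_def by (intro open_UN ballI open_chart_domain)

lemma domain_subset_carrier: "c \<in> A \<Longrightarrow> fst c \<subseteq> manifold_carrier A"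
  by (auto simp: manifold_carrier_def)

lemma open_overlap_image:
  assumes "c \<in> A" "open V"
  shows "open (snd c ` (fst c \<inter> V))"
proof -
  have "openin (top_of_set (chart_image c)) (snd c ` (fst c \<inter> V))"
    using homeomorphism_imp_open_map[OF chart_homeomorphism[OF assms(1)]] assms(2)
    by (simp add: openin_open_Int)
  then show ?thesis
    using open_chart_image[OF assms(1)] openin_open_trans by blast
qed

definition chart_map :: "('m, 'n) chart \<Rightarrow> real ^ 'n \<Rightarrow> (real ^ 'n) \<times> real" where
  "chart_map c = F \<circ> chart_inv c"

lemma translator_patch_chart:
  assumes "c \<in> A"
  obtains N where "translator_patch (chart_image c) (chart_map c) N"
proof -
  obtain N where "unit_normal_on (chart_image c) (chart_map c) N"
    "\<forall>u\<in>chart_image c. mean_curvature (chart_map c) N u = - ((0, 1) \<bullet> N u)"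
    using translator_F assms unfolding translator_def chart_map_def by blast
  moreover have "immersed_patch (chart_image c) (chart_map c)"
    using translator_F assms
    by (auto simp: immersed_patch_def chart_map_def translator_def immersion_def open_chart_image)
  ultimately have "translator_patch (chart_image c) (chart_map c) N"
    by (simp add: translator_patch_def translator_patch_axioms_def)
  then show ?thesis by (rule that)
qed

lemma immersed_patch_chart: "c \<in> A \<Longrightarrow> immersed_patch (chart_image c) (chart_map c)"
  by (metis translator_patch_chart translator_patch.axioms(1))

lemma continuous_on_F: "continuous_on (manifold_carrier A) F"
  unfolding manifold_carrier_def
proof (rule continuous_on_open_UN)
  show "continuous_on (fst c) F" if c: "c \<in> A" for c
  proof -
    have "continuous_on (fst c) (\<lambda>p. chart_map c (snd c p))"
      by (rule continuous_on_compose2[OF C1_on_imp_continuous_on[OF immersed_patch.C1_X[OF immersed_patch_chart[OF c]]]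
            continuous_on_chart[OF c]]) (auto simp: chart_in_image)
    then show ?thesis
      by (rule continuous_on_eq) (simp add: chart_map_def chart_inv_left[OF c])
  qed
qed (rule open_chart_domain)

definition transition :: "('m, 'n) chart \<Rightarrow> ('m, 'n) chart \<Rightarrow> real ^ 'n \<Rightarrow> real ^ 'n" where
  "transition c d = snd d \<circ> chart_inv c"

definition overlap :: "('m, 'n) chart \<Rightarrow> ('m, 'n) chart \<Rightarrow> (real ^ 'n) set" where
  "overlap c d = snd c ` (fst c \<inter> fst d)"

lemma C1_transition: "c \<in> A \<Longrightarrow> d \<in> A \<Longrightarrow> C1_on (overlap c d) (transition c d)"
  using translator_F
  by (auto simp: translator_def smooth_atlas_def transition_def overlap_def intro: smooth_on_imp_C1_on)

lemma open_overlap: "c \<in> A \<Longrightarrow> d \<in> A \<Longrightarrow> open (overlap c d)"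
  unfolding overlap_def by (intro open_overlap_image open_chart_domain)

lemma overlap_iff: "c \<in> A \<Longrightarrow> u \<in> overlap c d \<longleftrightarrow> u \<in> chart_image c \<and> chart_inv c u \<in> fst d"
  by (auto simp: overlap_def chart_in_image chart_inv_left chart_inv_right chart_inv_in_domain
      intro!: image_eqI[of _ _ "chart_inv c u"])

lemma chart_inv_transition:
  "d \<in> A \<Longrightarrow> c \<in> A \<Longrightarrow> u \<in> overlap c d \<Longrightarrow> chart_inv d (transition c d u) = chart_inv c u"
  by (simp add: transition_def overlap_iff chart_inv_left)

lemma transition_in_image:
  "d \<in> A \<Longrightarrow> c \<in> A \<Longrightarrow> u \<in> overlap c d \<Longrightarrow> transition c d u \<in> chart_image d"
  by (simp add: transition_def overlap_iff chart_in_image)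

lemma frechet_derivative_transition:
  assumes cd: "c \<in> A" "d \<in> A" and u: "u \<in> overlap c d"
    and f: "C1_on (chart_image d) (\<lambda>u. f (chart_inv d u))"
  shows "frechet_derivative (\<lambda>u. f (chart_inv c u)) (at u) v
       = frechet_derivative (\<lambda>u. f (chart_inv d u)) (at (transition c d u))
           (frechet_derivative (transition c d) (at u) v)"
proof (rule frechet_derivative_eqI)
  have "((\<lambda>u. f (chart_inv d (transition c d u))) has_derivative
      (\<lambda>v. frechet_derivative (\<lambda>u. f (chart_inv d u)) (at (transition c d u))
           (frechet_derivative (transition c d) (at u) v))) (at u)"
    using has_derivative_compose[OF C1_on_has_derivative[OF C1_transition[OF cd] u]
        C1_on_has_derivative[OF f transition_in_image[OF cd(2,1) u]]] .
  then show "((\<lambda>u. f (chart_inv c u)) has_derivative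
      (\<lambda>v. frechet_derivative (\<lambda>u. f (chart_inv d u)) (at (transition c d u))
           (frechet_derivative (transition c d) (at u) v))) (at u)"
    by (rule has_derivative_transform_within_open[OF _ open_overlap[OF cd] u])
      (simp add: chart_inv_transition[OF cd(2,1)])
qed

lemma chart_map_transition:
  assumes cd: "c \<in> A" "d \<in> A" and u: "u \<in> overlap c d"
  shows "frechet_derivative (chart_map c) (at u) v
       = frechet_derivative (chart_map d) (at (transition c d u))
           (frechet_derivative (transition c d) (at u) v)"
  using frechet_derivative_transition[OF cd u, of F v]
    immersed_patch.C1_X[OF immersed_patch_chart[OF cd(2)]]
  by (simp add: chart_map_def o_def)

lemma linear_transition:
  "c \<in> A \<Longrightarrow> d \<in> A \<Longrightarrow> u \<in> overlap c d \<Longrightarrow> linear (frechet_derivative (transition c d) (at u))"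
  using C1_transition[of c d] by (simp add: C1_on_def linear_frechet_derivative)

text \<open>The transported vector satisfies the relation that characterises the gradient in the
  second chart. Testing against every vector there needs the transition derivative to be onto; it is
  injective because the differential of the immersion factors through it.\<close>

lemma height_gradient_transition:
  assumes cd: "c \<in> A" "d \<in> A" and u: "u \<in> overlap c d"
  shows "frechet_derivative (transition c d) (at u) (height_gradient (chart_map c) u)
       = height_gradient (chart_map d) (transition c d u)"
proof -
  interpret c: immersed_patch "chart_image c" "chart_map c" by (rule immersed_patch_chart[OF cd(1)])
  interpret d: immersed_patch "chart_image d" "chart_map d" by (rule immersed_patch_chart[OF cd(2)])
  let ?T = "frechet_derivative (transition c d) (at u)"
  have uc: "u \<in> chart_image c" using u cd by (simp add: overlap_iff)
  note td = transition_in_image[OF cd(2,1) u]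
  have "inj ?T"
  proof (rule injI)
    fix v w assume "?T v = ?T w"
    then have "frechet_derivative (chart_map c) (at u) v = frechet_derivative (chart_map c) (at u) w"
      by (simp add: chart_map_transition[OF cd u])
    then show "v = w" using c.inj_dX[OF uc] by (simp add: inj_eq)
  qed
  then have surj: "surj ?T"
    using linear_injective_imp_surjective[OF linear_transition[OF cd u]] by blast
  show ?thesis
  proof (rule d.height_gradient_unique[OF td])
    fix w
    obtain w' where w: "w = ?T w'" using surj by (metis surjD)
    show "frechet_derivative (chart_map d) (at (transition c d u)) (?T (height_gradient (chart_map c) u)) \<bullet>
          frechet_derivative (chart_map d) (at (transition c d u)) w
        = (0, 1) \<bullet> frechet_derivative (chart_map d) (at (transition c d u)) w"
      unfolding w chart_map_transition[OF cd u, symmetric]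
      by (rule c.dX_height_gradient_inner[OF uc])
  qed
qed

text \<open>The metrics are related by g_c = M^T g_d M with M the Jacobian matrix of the transition;
  taking determinants and square roots gives the factor |det M|.\<close>

lemma area_density_transition:
  assumes cd: "c \<in> A" "d \<in> A" and u: "u \<in> overlap c d"
  shows "area_density (chart_map c) u
       = \<bar>det (matrix (frechet_derivative (transition c d) (at u)))\<bar>
           * area_density (chart_map d) (transition c d u)"
proof -
  interpret c: immersed_patch "chart_image c" "chart_map c" by (rule immersed_patch_chart[OF cd(1)])
  interpret d: immersed_patch "chart_image d" "chart_map d" by (rule immersed_patch_chart[OF cd(2)])
  let ?T = "frechet_derivative (transition c d) (at u)"
  let ?M = "matrix ?T"
  have uc: "u \<in> chart_image c" using u cd by (simp add: overlap_iff)
  note td = transition_in_image[OF cd(2,1) u]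
  have M: "?M *v v = ?T v" for v
    using linear_transition[OF cd u] by simp
  have "v \<bullet> (first_fundamental_form (chart_map c) u *v w)
      = v \<bullet> ((transpose ?M ** first_fundamental_form (chart_map d) (transition c d u) ** ?M) *v w)" for v w
  proof -
    have "v \<bullet> ((transpose ?M ** first_fundamental_form (chart_map d) (transition c d u) ** ?M) *v w)
        = (?M *v v) \<bullet> (first_fundamental_form (chart_map d) (transition c d u) *v (?M *v w))"
      by (simp only: matrix_vector_mul_assoc[symmetric] dot_lmul_matrix[symmetric] vector_transpose_matrix)
    then show ?thesis
      by (simp add: c.inner_fff[OF uc] d.inner_fff[OF td] M chart_map_transition[OF cd u])
  qed
  then have "first_fundamental_form (chart_map c) u
      = transpose ?M ** first_fundamental_form (chart_map d) (transition c d u) ** ?M"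
    by (metis matrix_eq vector_eq_ldot)
  then have "det (first_fundamental_form (chart_map c) u)
      = (det ?M)\<^sup>2 * det (first_fundamental_form (chart_map d) (transition c d u))"
    by (simp add: det_mul power2_eq_square)
  then show ?thesis by (simp add: area_density_def real_sqrt_mult)
qed

section \<open>Integrals over single charts\<close>

definition chart_integral :: "('m, 'n) chart \<Rightarrow> ('m \<Rightarrow> real) \<Rightarrow> real" where
  "chart_integral c f = integral\<^sup>L lborel
     (\<lambda>u. if u \<in> chart_image c then area_density (chart_map c) u * f (chart_inv c u) else 0)"

text \<open>Vanishing outside S is required on the whole type, also off the carrier. Then the
  coordinate integrand extends continuously by zero, the chart integral is a genuine finite
  integral, and the support can be compared with other charts.\<close>

definition supported_in :: "('m, 'n) chart \<Rightarrow> ('m \<Rightarrow> real) \<Rightarrow> bool" where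
  "supported_in c f \<longleftrightarrow> continuous_on (fst c) f \<and> (\<exists>S. compact S \<and> S \<subseteq> fst c \<and> (\<forall>p. p \<notin> S \<longrightarrow> f p = 0))"

lemma supported_in_integrand:
  assumes c: "c \<in> A" and f: "supported_in c f"
  shows "continuous_on UNIV
      (\<lambda>u. if u \<in> chart_image c then area_density (chart_map c) u * f (chart_inv c u) else 0)" (is ?cont)
    and "integrable lborel
      (\<lambda>u. if u \<in> chart_image c then area_density (chart_map c) u * f (chart_inv c u) else 0)" (is ?int)
proof -
  obtain S where S: "compact S" "S \<subseteq> fst c" "\<And>p. p \<notin> S \<Longrightarrow> f p = 0"
    using f unfolding supported_in_def by blast
  have K: "compact (snd c ` S)"
    by (rule compact_continuous_image[OF continuous_on_subset[OF continuous_on_chart[OF c] S(2)] S(1)])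
  have KU: "snd c ` S \<subseteq> chart_image c" using S(2) by (auto simp: chart_image_def)
  have 0: "area_density (chart_map c) u * f (chart_inv c u) = 0"
    if "u \<in> chart_image c" "u \<notin> snd c ` S" for u
    using that S(3)[of "chart_inv c u"] chart_inv_right[OF c that(1)] by force
  show cont: ?cont
  proof (rule continuous_on_extension_by_zero[OF open_chart_image[OF c] K KU _ 0])
    show "continuous_on (chart_image c) (\<lambda>u. area_density (chart_map c) u * f (chart_inv c u))"
    proof (rule continuous_on_mult)
      show "continuous_on (chart_image c) (area_density (chart_map c))"
        by (rule C1_on_imp_continuous_on[OF immersed_patch.C1_area_density[OF immersed_patch_chart[OF c]]])
      show "continuous_on (chart_image c) (\<lambda>u. f (chart_inv c u))"
        using f by (intro continuous_on_compose2[OF _ continuous_on_chart_inv[OF c]])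
          (auto simp: supported_in_def chart_inv_in_domain[OF c])
    qed
  qed
  show ?int
    by (rule integrable_compact_support[OF K cont]) (use 0 in auto)
qed

lemma chart_integral_cong: "c \<in> A \<Longrightarrow> (\<And>p. p \<in> fst c \<Longrightarrow> f p = g p) \<Longrightarrow> chart_integral c f = chart_integral c g"
  unfolding chart_integral_def
  by (intro Bochner_Integration.integral_cong) (auto simp: chart_inv_in_domain)

lemma chart_integral_mono:
  assumes "c \<in> A" "supported_in c f" "supported_in c g" "\<And>p. p \<in> fst c \<Longrightarrow> f p \<le> g p"
  shows "chart_integral c f \<le> chart_integral c g"
  unfolding chart_integral_def
proof (rule integral_mono)
  fix u
  show "(if u \<in> chart_image c then area_density (chart_map c) u * f (chart_inv c u) else 0)
      \<le> (if u \<in> chart_image c then area_density (chart_map c) u * g (chart_inv c u) else 0)"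
    using assms(4)[of "chart_inv c u"] chart_inv_in_domain[OF assms(1), of u]
      immersed_patch.area_density_pos[OF immersed_patch_chart[OF assms(1)], of u]
    by (auto intro!: mult_left_mono less_imp_le)
qed (rule supported_in_integrand assms)+

lemma chart_integral_sum:
  assumes "c \<in> A" "\<And>i. i \<in> I \<Longrightarrow> supported_in c (f i)"
  shows "chart_integral c (\<lambda>p. \<Sum>i\<in>I. f i p) = (\<Sum>i\<in>I. chart_integral c (f i))"
  unfolding chart_integral_def
  by (subst Bochner_Integration.integral_sum[symmetric])
    (use assms in \<open>auto intro!: supported_in_integrand Bochner_Integration.integral_cong simp: sum_distrib_left\<close>)

lemma chart_integral_add:
  assumes "c \<in> A" "supported_in c f" "supported_in c g"
  shows "chart_integral c (\<lambda>p. f p + g p) = chart_integral c f + chart_integral c g"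
  unfolding chart_integral_def
  by (subst Bochner_Integration.integral_add[symmetric])
    (use assms in \<open>auto intro!: supported_in_integrand Bochner_Integration.integral_cong simp: distrib_left\<close>)

lemma chart_integral_cmult:
  "chart_integral c (\<lambda>p. a * f p) = a * chart_integral c f"
  unfolding chart_integral_def
  by (subst Bochner_Integration.integral_mult_right_zero[symmetric])
    (auto intro!: Bochner_Integration.integral_cong simp del: Bochner_Integration.integral_mult_right_zero)

text \<open>A function supported in both domains lives on their intersection, where the change of
  variables factor cancels the change of area density. This takes the place of a well-defined global
  integral.\<close>

lemma chart_integral_overlap:
  assumes cd: "c \<in> A" "d \<in> A" and f: "supported_in c f" "supported_in d f"
  shows "chart_integral c f = chart_integral d f"
proof -
  let ?G = "\<lambda>c u. if u \<in> chart_image c then area_density (chart_map c) u * f (chart_inv c u) else 0"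
  have f0: "f p = 0" if "p \<notin> fst c \<inter> fst d" for p
    using that f unfolding supported_in_def by blast
  show ?thesis
    unfolding chart_integral_def
  proof (rule lborel_change_of_variables[where U = "overlap c d" and g = "transition c d"
        and g' = "\<lambda>u. frechet_derivative (transition c d) (at u)"])
    show "open (overlap c d)" by (rule open_overlap[OF cd])
    show "inj_on (transition c d) (overlap c d)"
      by (rule inj_onI) (metis cd chart_inv_transition chart_inv_right overlap_iff)
    show "(transition c d has_derivative frechet_derivative (transition c d) (at u)) (at u)"
      if "u \<in> overlap c d" for u by (rule C1_on_has_derivative[OF C1_transition[OF cd] that])
    show "integrable lborel (?G d)" "integrable lborel (?G c)"
      by (rule supported_in_integrand cd f)+
    show "?G d y = 0" if "y \<notin> transition c d ` overlap c d" for y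
    proof (rule ccontr)
      assume "?G d y \<noteq> 0"
      then have y: "y \<in> chart_image d" and "f (chart_inv d y) \<noteq> 0" by (auto split: if_splits)
      then have p: "chart_inv d y \<in> fst c \<inter> fst d" using f0 by blast
      then have "snd c (chart_inv d y) \<in> overlap c d" by (auto simp: overlap_def)
      moreover have "transition c d (snd c (chart_inv d y)) = y"
        using p y by (simp add: transition_def chart_inv_left[OF cd(1)] chart_inv_right[OF cd(2)])
      ultimately show False using that by force
    qed
    show "?G c u = 0" if "u \<notin> overlap c d" for u
      using that f0[of "chart_inv c u"] by (auto simp: overlap_iff[OF cd(1)])
    show "?G c u = \<bar>det (matrix (frechet_derivative (transition c d) (at u)))\<bar> * ?G d (transition c d u)"
      if u: "u \<in> overlap c d" for u
    proof -
      have "u \<in> chart_image c" using u by (simp add: overlap_iff[OF cd(1)])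
      then show ?thesis
        using transition_in_image[OF cd(2,1) u]
        by (simp add: chart_inv_transition[OF cd(2,1) u] area_density_transition[OF cd u])
    qed
  qed
qed

section \<open>Differentiable functions and their pairing with the height gradient\<close>

definition C1_manifold :: "('m \<Rightarrow> real) \<Rightarrow> bool" where
  "C1_manifold \<psi> \<longleftrightarrow> (\<forall>c\<in>A. C1_on (chart_image c) (\<lambda>u. \<psi> (chart_inv c u)))"

text \<open>This is <grad psi, grad h> computed in the chart c, meaningful for points of its domain.
  The chart stays an argument because independence of it is a lemma.\<close>

definition height_derivative :: "('m, 'n) chart \<Rightarrow> ('m \<Rightarrow> real) \<Rightarrow> 'm \<Rightarrow> real" where
  "height_derivative c \<psi> p = frechet_derivative (\<lambda>u. \<psi> (chart_inv c u)) (at (snd c p))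
     (height_gradient (chart_map c) (snd c p))"

lemma C1_manifoldD: "C1_manifold \<psi> \<Longrightarrow> c \<in> A \<Longrightarrow> C1_on (chart_image c) (\<lambda>u. \<psi> (chart_inv c u))"
  by (simp add: C1_manifold_def)

lemma C1_manifold_continuous: 
  assumes "C1_manifold \<psi>"
  shows "continuous_on (manifold_carrier A) \<psi>"
  unfolding manifold_carrier_def
proof (rule continuous_on_open_UN)
  show "continuous_on (fst c) \<psi>" if c: "c \<in> A" for c
  proof -
    have "continuous_on (fst c) (\<lambda>p. \<psi> (chart_inv c (snd c p)))"
      by (rule continuous_on_compose2[OF C1_on_imp_continuous_on[OF C1_manifoldD[OF assms c]]
            continuous_on_chart[OF c]]) (auto simp: chart_in_image)
    then show ?thesis by (rule continuous_on_eq) (simp add: chart_inv_left[OF c])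
  qed
qed (rule open_chart_domain)

lemma height_derivative_has_derivative:
  "C1_manifold \<psi> \<Longrightarrow> c \<in> A \<Longrightarrow> p \<in> fst c \<Longrightarrow>
    ((\<lambda>u. \<psi> (chart_inv c u)) has_derivative frechet_derivative (\<lambda>u. \<psi> (chart_inv c u)) (at (snd c p))) (at (snd c p))"
  by (intro C1_on_has_derivative[OF C1_manifoldD] chart_in_image)

lemma height_derivative_mult:
  assumes "C1_manifold \<psi>" "C1_manifold \<phi>" "c \<in> A" "p \<in> fst c"
  shows "height_derivative c (\<lambda>p. \<psi> p * \<phi> p) p
       = \<psi> p * height_derivative c \<phi> p + height_derivative c \<psi> p * \<phi> p"
  unfolding height_derivative_def
  using has_derivative_mult[OF height_derivative_has_derivative[OF assms(1,3,4)]
      height_derivative_has_derivative[OF assms(2,3,4)], THEN frechet_derivative_eqI]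
  by (simp add: chart_inv_left[OF assms(3,4)])

lemma height_derivative_sum:
  assumes "\<And>i. i \<in> I \<Longrightarrow> C1_manifold (\<psi> i)" "c \<in> A" "p \<in> fst c"
  shows "height_derivative c (\<lambda>p. \<Sum>i\<in>I. \<psi> i p) p = (\<Sum>i\<in>I. height_derivative c (\<psi> i) p)"
  unfolding height_derivative_def
  by (rule frechet_derivative_eqI) (intro has_derivative_sum height_derivative_has_derivative assms)

text \<open>Serves twice: off the support of a partition function, and inside the ball where the
  partition functions add up to 1.\<close>

lemma height_derivative_local_const:
  assumes "c \<in> A" "p \<in> fst c" "open V" "p \<in> V" "\<And>q. q \<in> V \<Longrightarrow> q \<in> fst c \<Longrightarrow> \<psi> q = k"
  shows "height_derivative c \<psi> p = 0"
  unfolding height_derivative_def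
proof (rule frechet_derivative_eqI)
  have "((\<lambda>u. k) has_derivative (\<lambda>v. 0)) (at (snd c p))" by simp
  then show "((\<lambda>u. \<psi> (chart_inv c u)) has_derivative (\<lambda>v. 0)) (at (snd c p))"
    by (rule has_derivative_transform_within_open[OF _ open_overlap_image[OF assms(1,3)]])
      (use assms in \<open>auto simp: chart_inv_left\<close>)
qed

text \<open>Chain rule and transformation law of the gradient combined. It allows derivatives of
  different partition functions, each taken in its own chart, to be added at one point.\<close>

lemma height_derivative_chart_independent:
  assumes "C1_manifold \<psi>" "c \<in> A" "d \<in> A" "p \<in> fst c" "p \<in> fst d"
  shows "height_derivative c \<psi> p = height_derivative d \<psi> p"
proof -
  have u: "snd c p \<in> overlap c d" using assms by (auto simp: overlap_def)
  have "transition c d (snd c p) = snd d p"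
    using assms by (simp add: transition_def chart_inv_left)
  then show ?thesis
    unfolding height_derivative_def
      frechet_derivative_transition[OF assms(2,3) u C1_manifoldD[OF assms(1,3)]]
      height_gradient_transition[OF assms(2,3) u]
    by simp
qed

lemma continuous_on_height_derivative:
  assumes "C1_manifold \<psi>" "c \<in> A"
  shows "continuous_on (fst c) (height_derivative c \<psi>)"
proof -
  have "continuous_on (chart_image c) (height_gradient (chart_map c))"
    using continuous_on_vec_lambda[of "chart_image c" "\<lambda>k u. height_gradient (chart_map c) u $ k"]
      C1_on_imp_continuous_on[OF immersed_patch.C1_height_gradient[OF immersed_patch_chart[OF assms(2)]]]
    by simp
  then show ?thesis
    unfolding height_derivative_def[abs_def]
    by (intro C1_on_continuous_derivative_field[OF C1_manifoldD[OF assms]] continuous_on_chart assms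
        continuous_on_compose2[OF _ continuous_on_chart[OF assms(2)]])
      (auto simp: chart_in_image)
qed

lemma chart_integral_weighted_divergence:
  assumes \<psi>: "C1_manifold \<psi>" and c: "c \<in> A" and S: "compact S" "S \<subseteq> fst c" "\<And>p. p \<notin> S \<Longrightarrow> \<psi> p = 0"
  shows "chart_integral c (\<lambda>p. exp (snd (F p)) * (\<psi> p + height_derivative c \<psi> p)) = 0"
proof -
  obtain N where "translator_patch (chart_image c) (chart_map c) N"
    using translator_patch_chart[OF c] by blast
  then interpret translator_patch "chart_image c" "chart_map c" N .
  have K: "compact (snd c ` S)"
    by (rule compact_continuous_image[OF continuous_on_subset[OF continuous_on_chart[OF c] S(2)] S(1)])
  have KU: "snd c ` S \<subseteq> chart_image c" using S(2) by (auto simp: chart_image_def)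
  have 0: "\<psi> (chart_inv c u) = 0" if "u \<in> chart_image c" "u \<notin> snd c ` S" for u
    using that S(3)[of "chart_inv c u"] chart_inv_right[OF c that(1)] by force
  have snd: "y \<bullet> (0, 1) = snd y" for y :: "(real ^ 'n) \<times> real"
    by (simp add: inner_prod_def)
  show ?thesis
    using integral_weighted_divergence[OF C1_manifoldD[OF \<psi> c] K KU 0]
    unfolding chart_integral_def height_derivative_def snd
    by (simp add: chart_map_def chart_inv_right[OF c] mult.assoc cong: if_cong)
qed

end

section \<open>The test function and the cutoffs\<close>

text \<open>The squared positive part is the simplest cutoff profile that is continuously
  differentiable; its second derivative jumps at 0, but integration by parts here asks for one
  derivative.\<close>

definition square_pos :: "real \<Rightarrow> real" where
  "square_pos t = (max 0 t)\<^sup>2"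

lemma square_pos_nonneg: "square_pos t \<ge> 0"
  by (simp add: square_pos_def)

lemma square_pos_eq_0_iff: "square_pos t = 0 \<longleftrightarrow> t \<le> 0"
  by (auto simp: square_pos_def max_def)

lemma square_pos_pos: "t > 0 \<Longrightarrow> square_pos t > 0"
  by (simp add: square_pos_def)

lemma square_pos_mono: "s \<le> t \<Longrightarrow> square_pos s \<le> square_pos t"
  unfolding square_pos_def by (intro power_mono max.mono) auto

lemma DERIV_square_pos: "(square_pos has_real_derivative 2 * max 0 t) (at t)"
proof -
  consider "t > 0" | "t < 0" | "t = 0" by linarith
  then show ?thesis
  proof cases
    case 1
    have "((\<lambda>t. t\<^sup>2) has_real_derivative 2 * max 0 t) (at t)"
      using 1 by (auto intro!: derivative_eq_intros)
    then show ?thesis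
      by (rule has_field_derivative_transform_within_open[of _ _ _ "{0<..}"])
        (use 1 in \<open>auto simp: square_pos_def\<close>)
  next
    case 2
    have "((\<lambda>t. 0) has_real_derivative 2 * max 0 t) (at t)"
      using 2 by simp
    then show ?thesis
      by (rule has_field_derivative_transform_within_open[of _ _ _ "{..<0}"])
        (use 2 in \<open>auto simp: square_pos_def\<close>)
  next
    \<comment> \<open>At the corner the difference quotient with increment h is exactly the positive
      part of h.\<close>
    case 3
    have "((\<lambda>h. max 0 h) \<longlongrightarrow> max 0 (0 :: real)) (at 0)"
      by (intro tendsto_max tendsto_const tendsto_ident_at)
    moreover have "\<forall>\<^sub>F h in at 0. max 0 h = (square_pos (0 + h) - square_pos 0) / (h :: real)"
      by (auto simp: eventually_at_filter square_pos_def max_def power2_eq_square)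
    ultimately have "((\<lambda>h. (square_pos (0 + h) - square_pos 0) / h) \<longlongrightarrow> 0) (at 0)"
      by (simp add: Lim_transform_eventually)
    then show ?thesis using 3 by (simp add: DERIV_def)
  qed
qed

lemma C1_on_square_pos: "C1_on S f \<Longrightarrow> C1_on S (\<lambda>x. square_pos (f x))"
  by (rule C1_on_compose_real[where g' = "\<lambda>t. 2 * max 0 t"])
    (auto intro!: DERIV_square_pos continuous_on_mult continuous_on_max continuous_on_const continuous_on_id)

text \<open>The test function of the overview as a function of t = |F - x|^2. The squared distance
  is differentiable everywhere, and sqrt(1 + t) is rho.\<close>

definition radial_cutoff :: "real \<Rightarrow> real \<Rightarrow> real" where
  "radial_cutoff r t = exp (- sqrt (1 + t)) * square_pos (1 - t / r\<^sup>2)"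

definition radial_cutoff_deriv :: "real \<Rightarrow> real \<Rightarrow> real" where
  "radial_cutoff_deriv r t = - exp (- sqrt (1 + t)) *
     (square_pos (1 - t / r\<^sup>2) / (2 * sqrt (1 + t)) + 2 * max 0 (1 - t / r\<^sup>2) / r\<^sup>2)"

lemma DERIV_radial_cutoff:
  assumes "t \<ge> 0"
  shows "(radial_cutoff r has_real_derivative radial_cutoff_deriv r t) (at t)"
proof -
  have "((\<lambda>t. 1 - t / r\<^sup>2) has_real_derivative 0 - 1 / r\<^sup>2) (at t)"
    by (intro DERIV_diff DERIV_const DERIV_cdivide DERIV_ident)
  from DERIV_chain2[OF DERIV_square_pos this]
  have 1: "((\<lambda>t. square_pos (1 - t / r\<^sup>2)) has_real_derivative 2 * max 0 (1 - t / r\<^sup>2) * (0 - 1 / r\<^sup>2)) (at t)" .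
  have 2: "((\<lambda>t. exp (- sqrt (1 + t))) has_real_derivative
      exp (- sqrt (1 + t)) * - (inverse (sqrt (1 + t)) / 2)) (at t)"
    using assms by (auto intro!: derivative_eq_intros)
  show ?thesis
    unfolding radial_cutoff_def[abs_def] radial_cutoff_deriv_def
    by (rule DERIV_cong[OF DERIV_mult[OF 2 1]]) (simp add: field_simps)
qed

lemma continuous_on_square_pos: "continuous_on S f \<Longrightarrow> continuous_on S (\<lambda>x. square_pos (f x))"
  unfolding square_pos_def by (intro continuous_intros)

lemma continuous_on_radial_cutoff_deriv: "continuous_on {0..} (radial_cutoff_deriv r)"
  unfolding radial_cutoff_deriv_def[abs_def]
  by (cases "r = 0") (auto intro!: continuous_intros continuous_on_square_pos)

text \<open>Here t is |F - x|^2 and y its derivative along grad h. The exponential factor loses at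
  most the fraction sqrt t / sqrt(1 + t) of the test function. The cutoff loses at most 4/r times
  its square root, since it is a square.\<close>

lemma radial_cutoff_estimate:
  assumes t: "t \<ge> 0" and r: "r \<ge> 1" and y: "\<bar>y\<bar> \<le> 2 * sqrt t"
  shows "exp (- sqrt (1 + t)) * (square_pos (1 - t) * (1 - sqrt t / sqrt (1 + t)))
       - 4 / r * (exp (- sqrt (1 + t)) * max 0 (1 - t / r\<^sup>2))
       \<le> radial_cutoff r t + radial_cutoff_deriv r t * y"
proof -
  define m where "m = max 0 (1 - t / r\<^sup>2)"
  define a where "a = sqrt t"
  define b where "b = sqrt (1 + t)"
  define e where "e = exp (- sqrt (1 + t))"
  have pos: "m \<ge> 0" "a \<ge> 0" "b > 0" "a \<le> b" "e > 0" "r > 0"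
    using t r by (auto simp: m_def a_def b_def e_def)
  have m2: "square_pos (1 - t / r\<^sup>2) = m\<^sup>2" by (simp add: square_pos_def m_def)
  \<comment> \<open>The distance a is at most r where the cutoff is nonzero. This turns the 1/r^2
    from differentiating t/r^2 into the decisive 1/r.\<close>
  have am: "a * m \<le> r * m"
  proof (cases "t < r\<^sup>2")
    case True
    then have "a \<le> r" unfolding a_def using pos by (intro real_le_lsqrt) auto
    then show ?thesis using pos by (intro mult_right_mono) auto
  next
    case False
    then have "m = 0" using pos by (simp add: m_def field_simps)
    then show ?thesis by simp
  qed
  \<comment> \<open>The hypothesis r \<ge> 1 is used to replace the cutoff of radius r by the
    smaller one of radius 1 in the main term, which no longer depends on r.\<close>
  have "t / r\<^sup>2 \<le> t / 1" using t r by (intro divide_left_mono) auto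
  then have "square_pos (1 - t) \<le> m\<^sup>2" unfolding m2[symmetric] by (intro square_pos_mono) simp
  then have 1: "square_pos (1 - t) * (1 - a / b) \<le> m\<^sup>2 * (1 - a / b)"
    using pos by (intro mult_right_mono) auto
  \<comment> \<open>\<open>radial_cutoff_deriv r t\<close> is -e k with k nonnegative, so the upper
    bound 2a for y is the one that matters.\<close>
  define k where "k = m\<^sup>2 / (2 * b) + 2 * m / r\<^sup>2"
  have k: "k \<ge> 0" using pos by (simp add: k_def)
  have "k * y \<le> k * (2 * a)" using y k unfolding a_def by (intro mult_left_mono) auto
  also have "\<dots> = m\<^sup>2 * (a / b) + 4 / r\<^sup>2 * (a * m)"
    using pos by (simp add: k_def field_simps)
  also have "\<dots> \<le> m\<^sup>2 * (a / b) + 4 / r\<^sup>2 * (r * m)"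
    using am pos by (intro add_left_mono mult_left_mono) auto
  also have "4 / r\<^sup>2 * (r * m) = 4 / r * m" using pos by (simp add: power2_eq_square)
  finally have "square_pos (1 - t) * (1 - a / b) - 4 / r * m \<le> m\<^sup>2 - k * y"
    using 1 by (simp add: algebra_simps)
  then have "e * (square_pos (1 - t) * (1 - a / b) - 4 / r * m) \<le> e * (m\<^sup>2 - k * y)"
    using pos by (intro mult_left_mono) auto
  then show ?thesis
    unfolding radial_cutoff_def radial_cutoff_deriv_def m2 m_def[symmetric] a_def[symmetric]
      b_def[symmetric] e_def[unfolded b_def[symmetric], symmetric] k_def[symmetric]
    by (simp add: algebra_simps)
qed

context translator_manifold
begin

lemma C1_manifold_mult: "C1_manifold f \<Longrightarrow> C1_manifold g \<Longrightarrow> C1_manifold (\<lambda>p. f p * g p)"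
  and C1_manifold_add: "C1_manifold f \<Longrightarrow> C1_manifold g \<Longrightarrow> C1_manifold (\<lambda>p. f p + g p)"
  and C1_manifold_sum: "(\<And>i. i \<in> I \<Longrightarrow> C1_manifold (h i)) \<Longrightarrow> C1_manifold (\<lambda>p. \<Sum>i\<in>I. h i p)"
  and C1_manifold_square_pos: "C1_manifold f \<Longrightarrow> C1_manifold (\<lambda>p. square_pos (f p))"
  and C1_manifold_diff_const: "C1_manifold f \<Longrightarrow> C1_manifold (\<lambda>p. f p - k)"
  unfolding C1_manifold_def
  by (auto intro: C1_on_mult C1_on_add C1_on_sum C1_on_square_pos C1_on_diff C1_on_const)

lemma C1_manifold_divide:
  assumes "C1_manifold f" "C1_manifold g" "\<And>p. p \<in> manifold_carrier A \<Longrightarrow> g p \<noteq> 0"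
  shows "C1_manifold (\<lambda>p. f p / g p)"
  unfolding C1_manifold_def
proof
  fix c assume c: "c \<in> A"
  show "C1_on (chart_image c) (\<lambda>u. f (chart_inv c u) / g (chart_inv c u))"
  proof (rule C1_on_divide)
    show "g (chart_inv c u) \<noteq> 0" if "u \<in> chart_image c" for u
      using assms(3) domain_subset_carrier[OF c] chart_inv_in_domain[OF c that] by blast
  qed (use assms(1,2) c in \<open>auto simp: C1_manifold_def\<close>)
qed

text \<open>The squared positive part of d^2 - |u - u0|^2 in the coordinates of c, extended by zero.
  Regularity must be verified in every chart of the atlas, not only in c.\<close>

lemma ex_bump:
  assumes c: "c \<in> A" and p: "p \<in> fst c"
  obtains b S where "C1_manifold b" "compact S" "S \<subseteq> fst c" "\<And>q. q \<notin> S \<Longrightarrow> b q = 0"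
    "\<And>q. 0 \<le> b q" "\<And>q. b q \<le> 1" "b p > 0"
proof -
  define u0 where "u0 = snd c p"
  have "u0 \<in> chart_image c" using p by (simp add: u0_def chart_in_image)
  then obtain d0 where d0: "d0 > 0" "cball u0 d0 \<subseteq> chart_image c"
    using open_chart_image[OF c] open_contains_cball by blast
  \<comment> \<open>The cap at 1 makes the bump at most 1.\<close>
  define d where "d = min d0 1"
  have d: "d > 0" "d \<le> 1" "cball u0 d \<subseteq> chart_image c" using d0 by (auto simp: d_def)
  define \<beta> where "\<beta> u = square_pos (d\<^sup>2 - (u - u0) \<bullet> (u - u0))" for u
  define b where "b q = (if q \<in> fst c then \<beta> (snd c q) else 0)" for q
  define S where "S = chart_inv c ` cball u0 d"
  have compact: "compact S"
    unfolding S_def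
    by (rule compact_continuous_image[OF continuous_on_subset[OF continuous_on_chart_inv[OF c] d(3)]]) simp
  have S: "S \<subseteq> fst c" using d(3) chart_inv_in_domain[OF c] by (auto simp: S_def)
  have \<beta>0: "\<beta> u = 0" if "u \<notin> cball u0 d" for u
  proof -
    have "d \<le> norm (u - u0)" using that by (simp add: dist_norm norm_minus_commute)
    then have "d\<^sup>2 \<le> (norm (u - u0))\<^sup>2" using d by (intro power_mono) auto
    then show ?thesis by (simp add: \<beta>_def square_pos_eq_0_iff power2_norm_eq_inner)
  qed
  have b0: "b q = 0" if "q \<notin> S" for q
  proof (cases "q \<in> fst c")
    case True
    then have "snd c q \<notin> cball u0 d"
      using that chart_inv_left[OF c True] unfolding S_def by force
    then show ?thesis using \<beta>0 by (simp add: b_def)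
  qed (simp add: b_def)
  have "C1_manifold b"
    unfolding C1_manifold_def
  proof (intro ballI C1_on_local)
    fix e u assume e: "e \<in> A" and u: "u \<in> chart_image e"
    show "\<exists>T. open T \<and> u \<in> T \<and> C1_on T (\<lambda>u. b (chart_inv e u))"
    \<comment> \<open>Over the domain of c the bump is a polynomial profile composed with the
      transition map. Any other point has a neighbourhood off S, which is closed because the
      manifold is Hausdorff, and there the bump is 0.\<close>
    proof (cases "chart_inv e u \<in> fst c")
      case True
      have "C1_on (overlap e c) (\<lambda>u. b (chart_inv e u))"
      proof (rule C1_on_cong_open[OF open_overlap[OF e c]])
        show "b (chart_inv e v) = \<beta> (transition e c v)" if "v \<in> overlap e c" for v
          using that by (simp add: overlap_iff[OF e] b_def transition_def)
        show "C1_on (overlap e c) (\<lambda>v. \<beta> (transition e c v))"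
          unfolding \<beta>_def
          by (intro C1_on_square_pos C1_on_diff C1_on_const C1_on_inner C1_transition e c)
      qed
      moreover have "u \<in> overlap e c" using True u by (simp add: overlap_iff[OF e])
      ultimately show ?thesis using open_overlap[OF e c] by blast
    next
      case False
      let ?T = "snd e ` (fst e \<inter> - S)"
      have T: "open ?T"
        using compact_imp_closed[OF compact] by (intro open_overlap_image e) auto
      moreover have "C1_on ?T (\<lambda>u. b (chart_inv e u))"
        by (rule C1_on_cong_open[OF T _ C1_on_const[of _ 0]])
          (auto simp: chart_inv_left[OF e] b0)
      moreover have "u \<in> ?T"
        using False S u chart_inv_in_domain[OF e u] chart_inv_right[OF e u] by force
      ultimately show ?thesis by blast
    qed
  qed
  moreover have "b q \<le> 1" for q
  proof -
    have "d\<^sup>2 \<le> 1" using d by (simp add: power_le_one)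
    have "\<beta> u \<le> square_pos 1" for u
      unfolding \<beta>_def by (intro square_pos_mono) (use \<open>d\<^sup>2 \<le> 1\<close> inner_ge_zero[of "u - u0"] in linarith)
    then show ?thesis by (simp add: b_def square_pos_def)
  qed
  moreover have "b p > 0" using p d by (simp add: b_def \<beta>_def u0_def square_pos_pos)
  moreover have "0 \<le> b q" for q by (simp add: b_def \<beta>_def square_pos_nonneg)
  ultimately show ?thesis using that compact S b0 by blast
qed

section \<open>Squared distance to the centre and the radial test function\<close>

definition sqdist :: "(real ^ 'n) \<times> real \<Rightarrow> 'm \<Rightarrow> real" where
  "sqdist x p = (F p - x) \<bullet> (F p - x)"

lemma sqdist_nonneg: "sqdist x p \<ge> 0" by (simp add: sqdist_def)

lemma sqrt_sqdist: "sqrt (sqdist x p) = norm (F p - x)"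
  by (simp add: sqdist_def norm_eq_sqrt_inner)

lemma C1_manifold_sqdist: "C1_manifold (sqdist x)"
  unfolding C1_manifold_def sqdist_def
proof
  fix c assume "c \<in> A"
  from immersed_patch.C1_X[OF immersed_patch_chart[OF this]]
  have "C1_on (chart_image c) (\<lambda>u. F (chart_inv c u) - x)"
    unfolding chart_map_def o_def by (intro C1_on_diff C1_on_const)
  then show "C1_on (chart_image c) (\<lambda>u. (F (chart_inv c u) - x) \<bullet> (F (chart_inv c u) - x))"
    by (intro C1_on_inner)
qed

text \<open>The derivative is 2 <F - x, T> with T the tangential projection of the vertical unit
  vector, whose norm is at most 1.\<close>

lemma height_derivative_sqdist_le:
  assumes c: "c \<in> A" and p: "p \<in> fst c"
  shows "\<bar>height_derivative c (sqdist x) p\<bar> \<le> 2 * sqrt (sqdist x p)"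
proof -
  interpret immersed_patch "chart_image c" "chart_map c" by (rule immersed_patch_chart[OF c])
  let ?u = "snd c p"
  let ?v = "height_gradient (chart_map c) ?u"
  let ?T = "frechet_derivative (chart_map c) (at ?u) ?v"
  have u: "?u \<in> chart_image c" using p by (rule chart_in_image)
  have "((\<lambda>u. chart_map c u - x) has_derivative (\<lambda>h. frechet_derivative (chart_map c) (at ?u) h - 0)) (at ?u)"
    by (intro has_derivative_diff has_derivative_const C1_on_has_derivative[OF C1_X u])
  from has_derivative_inner[OF this this, THEN frechet_derivative_eqI, of ?v]
  have "height_derivative c (sqdist x) p = 2 * ((F p - x) \<bullet> ?T)"
    unfolding height_derivative_def sqdist_def
    by (simp add: chart_map_def chart_inv_left[OF c p] inner_commute)
  moreover have "\<bar>(F p - x) \<bullet> ?T\<bar> \<le> norm (F p - x) * norm ?T" by (rule Cauchy_Schwarz_ineq2)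
  moreover have "norm (F p - x) * norm ?T \<le> norm (F p - x) * 1"
    by (intro mult_left_mono norm_dX_height_gradient_le u) auto
  ultimately show ?thesis by (simp add: sqrt_sqdist abs_mult)
qed

lemma C1_manifold_radial_cutoff: "C1_manifold (\<lambda>p. radial_cutoff r (sqdist x p))"
  unfolding C1_manifold_def
proof
  fix c assume c: "c \<in> A"
  have sub: "(\<lambda>u. sqdist x (chart_inv c u)) ` chart_image c \<subseteq> {0..}" by (auto simp: sqdist_nonneg)
  show "C1_on (chart_image c) (\<lambda>u. radial_cutoff r (sqdist x (chart_inv c u)))"
    by (rule C1_on_compose_real[OF C1_manifoldD[OF C1_manifold_sqdist c] DERIV_radial_cutoff
          continuous_on_subset[OF continuous_on_radial_cutoff_deriv sub]])
      (use sub in auto)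
qed

lemma height_derivative_radial_cutoff:
  assumes c: "c \<in> A" and p: "p \<in> fst c"
  shows "height_derivative c (\<lambda>p. radial_cutoff r (sqdist x p)) p
       = radial_cutoff_deriv r (sqdist x p) * height_derivative c (sqdist x) p"
proof -
  have "(radial_cutoff r has_derivative (\<lambda>h. radial_cutoff_deriv r (sqdist x p) * h))
      (at (sqdist x (chart_inv c (snd c p))))"
    using DERIV_radial_cutoff[OF sqdist_nonneg] by (simp add: has_field_derivative_def chart_inv_left[OF c p])
  from has_derivative_compose[OF height_derivative_has_derivative[OF C1_manifold_sqdist c p] this]
  show ?thesis unfolding height_derivative_def by (rule frechet_derivative_eqI)
qed

lemma sets_volume_measure: "sets (volume_measure A F) = sets borel" if "A \<noteq> {}"
  unfolding volume_measure_def by (rule sets_SUP[OF _ that]) (simp add: chart_volume_def)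

lemma chart_volume_le: "c \<in> A \<Longrightarrow> chart_volume F c \<le> volume_measure A F"
  unfolding volume_measure_def by (rule SUP_upper)

lemma supported_in_measurable:
  assumes c: "c \<in> A" and f: "supported_in c f"
  shows "f \<in> borel_measurable borel"
proof -
  have "(\<lambda>p. indicator (fst c) p *\<^sub>R f p) \<in> borel_measurable borel"
    using f by (intro borel_measurable_continuous_on_indicator borel_open open_chart_domain c)
      (simp add: supported_in_def)
  moreover have "(\<lambda>p. indicator (fst c) p *\<^sub>R f p) = f"
    using f by (fastforce simp: supported_in_def indicator_def)
  ultimately show ?thesis by simp
qed

text \<open>In coordinates the chart integral is the integral against \<open>chart_volume\<close>,
  and a supremum of measures dominates each member. This inequality is the link between chart
  integrals and the volume measure.\<close>

lemma chart_integral_le_nn_integral: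
  assumes c: "c \<in> A" and f: "supported_in c f" "\<And>p. f p \<ge> 0"
  shows "ennreal (chart_integral c f) \<le> (\<integral>\<^sup>+p. ennreal (f p) \<partial>volume_measure A F)"
proof -
  let ?U = "chart_image c" and ?\<sigma> = "area_density (chart_map c)"
  let ?G = "\<lambda>u. if u \<in> ?U then ?\<sigma> u * f (chart_inv c u) else 0"
  have [measurable]: "f \<in> borel_measurable borel" by (rule supported_in_measurable[OF c f(1)])
  have U[measurable]: "?U \<in> sets borel" using open_chart_image[OF c] by simp
  have sets: "sets (restrict_space lborel ?U) = sets (restrict_space borel ?U)"
    by (intro sets_restrict_space_cong) simp
  have [measurable]: "chart_inv c \<in> borel_measurable (restrict_space lborel ?U)"
    using borel_measurable_continuous_on_restrict[OF continuous_on_chart_inv[OF c]]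
    unfolding measurable_cong_sets[OF sets refl] .
  have "?\<sigma> \<in> borel_measurable (restrict_space borel ?U)"
    by (intro borel_measurable_continuous_on_restrict C1_on_imp_continuous_on
        immersed_patch.C1_area_density[OF immersed_patch_chart[OF c]])
  then have [measurable]: "?\<sigma> \<in> borel_measurable (restrict_space lborel ?U)"
    unfolding measurable_cong_sets[OF sets refl] .
  have pos: "?\<sigma> u \<ge> 0" if "u \<in> ?U" for u
    using immersed_patch.area_density_pos[OF immersed_patch_chart[OF c] that] by simp
  have vol: "chart_volume F c
      = distr (density (restrict_space lborel ?U) (\<lambda>u. ennreal (?\<sigma> u))) borel (chart_inv c)"
    unfolding chart_volume_def area_density_def chart_map_def ..
  have "ennreal (chart_integral c f) = (\<integral>\<^sup>+u. ennreal (?G u) \<partial>lborel)"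
    unfolding chart_integral_def
    by (rule nn_integral_eq_integral[symmetric])
      (use supported_in_integrand(2)[OF c f(1)] f(2) pos in auto)
  also have "\<dots> = (\<integral>\<^sup>+u. (ennreal (?\<sigma> u) * ennreal (f (chart_inv c u))) * indicator ?U u \<partial>lborel)"
    by (intro nn_integral_cong) (auto simp: indicator_def ennreal_mult pos f(2))
  also have "\<dots> = (\<integral>\<^sup>+u. ennreal (?\<sigma> u) * ennreal (f (chart_inv c u)) \<partial>restrict_space lborel ?U)"
    by (subst nn_integral_restrict_space) auto
  also have "\<dots> = (\<integral>\<^sup>+u. ennreal (f (chart_inv c u)) \<partial>density (restrict_space lborel ?U) (\<lambda>u. ennreal (?\<sigma> u)))"
    by (subst nn_integral_density) auto
  also have "\<dots> = (\<integral>\<^sup>+p. ennreal (f p) \<partial>chart_volume F c)"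
    unfolding vol by (subst nn_integral_distr) auto
  also have "\<dots> \<le> (\<integral>\<^sup>+p. ennreal (f p) \<partial>volume_measure A F)"
    using c sets_volume_measure
    by (intro nn_integral_mono_measure chart_volume_le c) (auto simp: chart_volume_def)
  finally show ?thesis .
qed

lemma chart_integral_pos:
  assumes c: "c \<in> A" and f: "supported_in c f" "\<And>p. f p \<ge> 0" and p: "p \<in> fst c" "f p > 0"
  shows "chart_integral c f > 0"
proof -
  let ?G = "\<lambda>u. if u \<in> chart_image c then area_density (chart_map c) u * f (chart_inv c u) else 0"
  note G = supported_in_integrand[OF c f(1)]
  have area: "area_density (chart_map c) u > 0" if "u \<in> chart_image c" for u
    using immersed_patch.area_density_pos[OF immersed_patch_chart[OF c] that] .
  have nonneg: "?G u \<ge> 0" for u using area f(2) by (auto intro: mult_nonneg_nonneg less_imp_le)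
  have "?G (snd c p) > 0"
    using area chart_in_image[OF p(1)] p by (simp add: chart_inv_left[OF c])
  then obtain d where d: "d > 0" "\<And>u. dist u (snd c p) < d \<Longrightarrow> dist (?G u) (?G (snd c p)) < ?G (snd c p) / 2"
    using G(1) unfolding continuous_on_eq_continuous_at[OF open_UNIV] continuous_at_eps_delta
    by (metis UNIV_I half_gt_zero)
  let ?e = "?G (snd c p) / 2"
  have "0 < ?e * measure lborel (ball (snd c p) d)"
    using \<open>?G (snd c p) > 0\<close> content_ball_pos[OF d(1)] by (intro mult_pos_pos) auto
  also have "\<dots> = integral\<^sup>L lborel (\<lambda>u. ?e * indicator (ball (snd c p) d) u)"
    by simp
  also have "\<dots> \<le> integral\<^sup>L lborel ?G"
  proof (rule integral_mono[OF _ G(2)])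
    show "integrable lborel (\<lambda>u. ?e * indicator (ball (snd c p) d) u)"
      by (intro integrable_mult_right integrable_real_indicator)
        (auto simp: emeasure_lborel_ball_finite[unfolded infinity_ennreal_def])
    show "?e * indicator (ball (snd c p) d) u \<le> ?G u" for u
    proof (cases "u \<in> ball (snd c p) d")
      case True
      then have "\<bar>?G u - ?G (snd c p)\<bar> < ?e" using d(2)[of u] by (simp only: dist_real_def mem_ball dist_commute)
      then have "?e * 1 \<le> ?G u" by linarith
      then show ?thesis using True by (simp only: indicator_simps)
    qed (use nonneg in simp)
  qed
  finally show ?thesis unfolding chart_integral_def .
qed

end

section \<open>The volume estimate\<close>

context translator_manifold
begin

lemma supported_in_mult:
  assumes "c \<in> A" "continuous_on (manifold_carrier A) g" "continuous_on (fst c) f"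
    and "compact S" "S \<subseteq> fst c" "\<And>p. p \<notin> S \<Longrightarrow> g p = 0"
  shows "supported_in c (\<lambda>p. g p * f p)"
  unfolding supported_in_def
  using assms continuous_on_subset[OF assms(2) domain_subset_carrier[OF assms(1)]]
  by (auto intro!: continuous_on_mult)

lemma chart_integral_nonneg:
  assumes "c \<in> A" "\<And>p. p \<in> fst c \<Longrightarrow> f p \<ge> 0"
  shows "chart_integral c f \<ge> 0"
  unfolding chart_integral_def
proof (rule Bochner_Integration.integral_nonneg)
  fix u
  show "0 \<le> (if u \<in> chart_image c then area_density (chart_map c) u * f (chart_inv c u) else 0)"
    using assms(2)[of "chart_inv c u"] chart_inv_in_domain[OF assms(1), of u]
      immersed_patch.area_density_pos[OF immersed_patch_chart[OF assms(1)], of u]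
    by (simp add: less_imp_le)
qed

text \<open>The weight e^h times the main term of \<open>radial_cutoff_estimate\<close>. It is
  independent of r, vanishes outside the unit ball around x and is positive where F takes the value
  x.\<close>

definition core_density :: "(real ^ 'n) \<times> real \<Rightarrow> 'm \<Rightarrow> real" where
  "core_density x p = exp (snd (F p)) * (exp (- sqrt (1 + sqdist x p)) *
     (square_pos (1 - sqdist x p) * (1 - sqrt (sqdist x p) / sqrt (1 + sqdist x p))))"

lemma one_plus_sqdist_pos: "1 + sqdist x p > 0"
  using sqdist_nonneg[of x p] by linarith

lemma core_density_nonneg: "core_density x p \<ge> 0"
  unfolding core_density_def
  using one_plus_sqdist_pos[of x p] by (intro mult_nonneg_nonneg square_pos_nonneg) (auto simp: sqdist_nonneg)

lemma continuous_on_weight: "continuous_on (manifold_carrier A) (\<lambda>p. exp (snd (F p)))"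
  by (intro continuous_intros continuous_on_F)

lemma continuous_on_sqdist: "continuous_on (manifold_carrier A) (sqdist x)"
  by (rule C1_manifold_continuous[OF C1_manifold_sqdist])

lemma continuous_on_core_density: "continuous_on (manifold_carrier A) (core_density x)"
proof -
  have "sqrt (1 + sqdist x p) \<noteq> 0" for p using one_plus_sqdist_pos[of x p] by simp
  then show ?thesis
    unfolding core_density_def[abs_def]
    by (intro continuous_on_mult continuous_on_weight continuous_on_square_pos continuous_on_diff
        continuous_on_divide continuous_on_exp continuous_on_minus continuous_on_real_sqrt
        continuous_on_add continuous_on_const continuous_on_sqdist) auto
qed

lemma open_ball_preimage: "open {p \<in> manifold_carrier A. F p \<in> ball x r}"
proof -
  have "open (manifold_carrier A \<inter> F -` ball x r)"
    by (rule continuous_open_preimage[OF continuous_on_F open_carrier open_ball])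
  moreover have "manifold_carrier A \<inter> F -` ball x r = {p \<in> manifold_carrier A. F p \<in> ball x r}"
    by auto
  ultimately show ?thesis by simp
qed

text \<open>The height changes by at most the distance |F - x|, which is below rho.\<close>

lemma weight_le:
  "exp (snd (F p)) * exp (- sqrt (1 + sqdist x p)) \<le> exp (snd x)"
proof -
  have "snd (F p) - snd x \<le> norm (F p - x)"
    by (metis abs_ge_self norm_snd_le order_trans prod.collapse real_norm_def snd_diff)
  also have "\<dots> \<le> sqrt (1 + sqdist x p)" unfolding sqrt_sqdist[symmetric] by simp
  finally show ?thesis by (simp flip: exp_add)
qed

text \<open>The function b0 confines the core density to the single chart c0, so the constant on the
  left is one chart integral that stays the same for all r, while the partition of unity in the
  proof is built anew for each r.\<close>

proposition volume_lower_bound: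
  assumes r: "r \<ge> 1" and K: "compact {p \<in> manifold_carrier A. F p \<in> cball x r}"
    and c0: "c0 \<in> A" and b0: "continuous_on (manifold_carrier A) b0"
    and S0: "compact S0" "S0 \<subseteq> fst c0" "\<And>p. p \<notin> S0 \<Longrightarrow> b0 p = 0"
    and b01: "\<And>p. 0 \<le> b0 p" "\<And>p. b0 p \<le> 1"
  shows "ennreal (chart_integral c0 (\<lambda>p. b0 p * core_density x p) * r / (4 * exp (snd x)))
       \<le> emeasure (volume_measure A F) {p \<in> manifold_carrier A. F p \<in> ball x r}"
proof -
  let ?M = "manifold_carrier A" and ?K = "{p \<in> manifold_carrier A. F p \<in> cball x r}"
  let ?B = "{p \<in> manifold_carrier A. F p \<in> ball x r}"
  let ?E = "\<lambda>p. exp (snd (F p))" and ?q = "sqdist x" and ?core = "core_density x"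
  have q_le: "?q p \<le> r\<^sup>2 \<longleftrightarrow> F p \<in> cball x r" and q_less: "?q p < r\<^sup>2 \<longleftrightarrow> F p \<in> ball x r" for p
    using r by (auto simp: sqrt_sqdist[symmetric] dist_norm norm_minus_commute[of x]
        real_sqrt_le_iff[symmetric, of _ "r\<^sup>2"] real_sqrt_less_iff[symmetric, of _ "r\<^sup>2"]
        simp del: real_sqrt_le_iff real_sqrt_less_iff)
  \<comment> \<open>Bundles chart, function and support so that all three can be chosen at once for
    every point over the closed ball.\<close>
  define bump where "bump p c b S \<longleftrightarrow> c \<in> A \<and> C1_manifold b \<and> compact S \<and> S \<subseteq> fst c \<and>
      (\<forall>q. q \<notin> S \<longrightarrow> b q = 0) \<and> (\<forall>q. 0 \<le> b q) \<and> 0 < b p"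
    for p :: 'm and c :: "('m, 'n) chart" and b :: "'m \<Rightarrow> real" and S :: "'m set"
  have "\<exists>c b S. bump p c b S" if p: "p \<in> ?K" for p
  proof -
    obtain c where c: "c \<in> A" "p \<in> fst c" using p unfolding manifold_carrier_def by blast
    from ex_bump[OF this] obtain b S where "bump p c b S"
      unfolding bump_def using c(1) by metis
    then show ?thesis by blast
  qed
  then obtain ch b S where "\<forall>p\<in>?K. bump p (ch p) (b p) (S p)" by metis
  then have bump: "ch p \<in> A" "C1_manifold (b p)" "compact (S p)" "S p \<subseteq> fst (ch p)"
      "\<And>q. q \<notin> S p \<Longrightarrow> b p q = 0" "\<And>q. 0 \<le> b p q" "0 < b p p" if "p \<in> ?K" for p
    using that unfolding bump_def by blast+
  have "\<exists>I\<subseteq>?K. finite I \<and> ?K \<subseteq> (\<Union>i\<in>I. ?M \<inter> b i -` {0<..})"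
  proof (rule compactE_image[OF K, of ?K "\<lambda>i. ?M \<inter> b i -` {0<..}"])
    show "open (?M \<inter> b i -` {0<..})" if "i \<in> ?K" for i
      by (rule continuous_open_preimage[OF C1_manifold_continuous[OF bump(2)[OF that]] open_carrier]) simp
    show "?K \<subseteq> (\<Union>i\<in>?K. ?M \<inter> b i -` {0<..})" using bump(7) by auto
  qed blast
  then obtain I where I: "I \<subseteq> ?K" "finite I" "?K \<subseteq> (\<Union>i\<in>I. ?M \<inter> b i -` {0<..})" by blast
  note bump = bump[OF subsetD[OF I(1)]]
  (* The second summand vanishes on the closed ball and makes \<Theta> positive on the whole carrier. *)
  define \<Theta> where "\<Theta> p = (\<Sum>i\<in>I. b i p) + square_pos (?q p - r\<^sup>2)" for p
  define \<zeta> where "\<zeta> i p = b i p / \<Theta> p" for i p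
  have sum_b: "0 \<le> (\<Sum>i\<in>I. b i p)" for p using bump(6) by (intro sum_nonneg) auto
  have sum_b_pos: "0 < (\<Sum>i\<in>I. b i p)" if "p \<in> ?M" "?q p \<le> r\<^sup>2" for p
  proof -
    have "p \<in> ?K" using that q_le by simp
    then obtain i where "i \<in> I" "0 < b i p" using I(3) by auto
    then show ?thesis using bump(6) I(2) by (intro sum_pos2[of I i]) auto
  qed
  have \<Theta>_nonneg: "0 \<le> \<Theta> p" for p unfolding \<Theta>_def using sum_b square_pos_nonneg by (intro add_nonneg_nonneg)
  have \<Theta>_pos: "0 < \<Theta> p" if "p \<in> ?M" for p
  proof (cases "?q p \<le> r\<^sup>2")
    case True
    then show ?thesis unfolding \<Theta>_def using sum_b_pos[OF that] square_pos_nonneg by (intro add_pos_nonneg) auto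
  next
    case False
    then show ?thesis unfolding \<Theta>_def using sum_b square_pos_pos by (intro add_nonneg_pos) auto
  qed
  have C1_\<Theta>: "C1_manifold \<Theta>"
    unfolding \<Theta>_def[abs_def]
    by (intro C1_manifold_add C1_manifold_sum C1_manifold_square_pos C1_manifold_diff_const
        C1_manifold_sqdist bump(2))
  have C1_\<zeta>: "C1_manifold (\<zeta> i)" if "i \<in> I" for i
    unfolding \<zeta>_def[abs_def]
    by (intro C1_manifold_divide C1_\<Theta> bump(2) that) (use \<Theta>_pos in force)
  have \<zeta>0: "\<zeta> i p = 0" if "i \<in> I" "p \<notin> S i" for i p
    using bump(5)[OF that] by (simp add: \<zeta>_def)
  have \<zeta>_nonneg: "0 \<le> \<zeta> i p" if "i \<in> I" for i p
    unfolding \<zeta>_def using bump(6)[OF that] \<Theta>_nonneg by (intro divide_nonneg_nonneg)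
  have \<zeta>_sum: "(\<Sum>i\<in>I. \<zeta> i p) = (\<Sum>i\<in>I. b i p) / \<Theta> p" for p
    by (simp add: \<zeta>_def sum_divide_distrib)
  have \<zeta>_sum_le: "(\<Sum>i\<in>I. \<zeta> i p) \<le> 1" for p
  proof -
    have "(\<Sum>i\<in>I. b i p) \<le> \<Theta> p" using square_pos_nonneg by (simp add: \<Theta>_def)
    then show ?thesis unfolding \<zeta>_sum using \<Theta>_nonneg[of p] by (auto simp: divide_le_eq_1)
  qed
  have \<zeta>_sum_eq: "(\<Sum>i\<in>I. \<zeta> i p) = 1" if "p \<in> ?M" "?q p \<le> r\<^sup>2" for p
  proof -
    have "square_pos (?q p - r\<^sup>2) = 0" using that(2) by (simp add: square_pos_eq_0_iff)
    then have "\<Theta> p = (\<Sum>i\<in>I. b i p)" by (simp add: \<Theta>_def)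
    then show ?thesis unfolding \<zeta>_sum using sum_b_pos[OF that] by simp
  qed
  note \<zeta>_cont = C1_manifold_continuous[OF C1_\<zeta>]
  have chart_sub: "fst (ch i) \<subseteq> ?M" if "i \<in> I" for i
    by (rule domain_subset_carrier[OF bump(1)[OF that]])
  have supp: "supported_in (ch i) (\<lambda>p. \<zeta> i p * f p)" if "i \<in> I" "continuous_on (fst (ch i)) f" for i f
    by (rule supported_in_mult[OF bump(1) \<zeta>_cont _ bump(3,4) \<zeta>0]) (use that in auto)
  define \<phi> where "\<phi> p = radial_cutoff r (?q p)" for p
  have C1_\<phi>: "C1_manifold \<phi>" unfolding \<phi>_def[abs_def] by (rule C1_manifold_radial_cutoff)
  have \<phi>0: "\<phi> p = 0" if "\<not> ?q p < r\<^sup>2" for p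
    using that r by (simp add: \<phi>_def radial_cutoff_def square_pos_eq_0_iff)
  let ?D = "\<lambda>i. height_derivative (ch i)"
  \<comment> \<open>The term of the product rule in which the derivative falls on the partition
    function. A single one need not integrate to 0; only their sum does.\<close>
  define f where "f i p = (if p \<in> fst (ch i) then ?E p * \<phi> p * ?D i (\<zeta> i) p else 0)" for i p
  have D\<zeta>0: "height_derivative c (\<zeta> i) p = 0" if "i \<in> I" "c \<in> A" "p \<in> fst c" "p \<notin> S i" for i c p
    by (rule height_derivative_local_const[of _ _ "- S i" _ 0])
      (use that \<zeta>0 compact_imp_closed[OF bump(3)] in auto)
  have f0: "f i p = 0" if "i \<in> I" "p \<notin> S i" for i p
    unfolding f_def using D\<zeta>0[OF that(1) bump(1)[OF that(1)] _ that(2)] by simp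
  have f_cont: "continuous_on UNIV (f i)" if i: "i \<in> I" for i
    unfolding f_def
  proof (rule continuous_on_extension_by_zero[OF open_chart_domain bump(3,4)])
    show "continuous_on (fst (ch i)) (\<lambda>p. ?E p * \<phi> p * ?D i (\<zeta> i) p)"
      by (intro continuous_on_mult continuous_on_height_derivative C1_\<zeta> i bump(1)
          continuous_on_subset[OF continuous_on_weight chart_sub]
          continuous_on_subset[OF C1_manifold_continuous[OF C1_\<phi>] chart_sub])
    show "?E p * \<phi> p * ?D i (\<zeta> i) p = 0" if "p \<in> fst (ch i)" "p \<notin> S i" for p
      using D\<zeta>0[OF i bump(1)[OF i] that] by simp
  qed (use i bump(1) in auto)
  \<comment> \<open>The product is supported in the chart of i through \<open>f i\<close> and in the
    chart of k through \<open>\<zeta> k\<close>. Both facts are needed to move its integral from one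
    chart to the other.\<close>
  have supp_f: "supported_in (ch i) (\<lambda>p. \<zeta> k p * f i p)" if "i \<in> I" "k \<in> I" for i k
    unfolding mult.commute[of "\<zeta> k _"]
    by (rule supported_in_mult[OF bump(1) _ _ bump(3,4) f0])
      (use that continuous_on_subset[OF f_cont] continuous_on_subset[OF \<zeta>_cont chart_sub] in auto)
  have supp_f': "supported_in (ch k) (\<lambda>p. \<zeta> k p * f i p)" if "i \<in> I" "k \<in> I" for i k
    by (rule supp) (use that continuous_on_subset[OF f_cont] in auto)

  \<comment> \<open>Outside the open ball phi vanishes. Inside, all derivatives are rewritten in the
    chart of k and add up to the derivative of the locally constant sum 1.\<close>
  have sum_f: "(\<Sum>i\<in>I. f i p) = 0" if k: "k \<in> I" and p: "p \<in> fst (ch k)" for k p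
  proof (cases "?q p < r\<^sup>2")
    case False
    then show ?thesis by (intro sum.neutral) (simp add: f_def \<phi>0)
  next
    case True
    have "f i p = ?E p * \<phi> p * ?D k (\<zeta> i) p" if i: "i \<in> I" for i
    proof (cases "p \<in> fst (ch i)")
      case True
      then show ?thesis
        using height_derivative_chart_independent[OF C1_\<zeta>[OF i] bump(1)[OF i] bump(1)[OF k] True p]
        by (simp add: f_def)
    next
      case False
      then have "p \<notin> S i" using bump(4)[OF i] by blast
      then show ?thesis using D\<zeta>0[OF i bump(1)[OF k] p] False by (simp add: f_def)
    qed
    then have "(\<Sum>i\<in>I. f i p) = ?E p * \<phi> p * (\<Sum>i\<in>I. ?D k (\<zeta> i) p)"
      by (simp add: sum_distrib_left)
    also have "(\<Sum>i\<in>I. ?D k (\<zeta> i) p) = ?D k (\<lambda>p. \<Sum>i\<in>I. \<zeta> i p) p"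
      by (rule height_derivative_sum[OF C1_\<zeta> bump(1)[OF k] p, symmetric])
    also have "\<dots> = 0"
    proof (rule height_derivative_local_const[OF bump(1)[OF k] p open_ball_preimage])
      show "p \<in> ?B" using True q_less p chart_sub[OF k] by blast
      show "(\<Sum>i\<in>I. \<zeta> i q) = 1" if "q \<in> ?B" for q
        using that q_less[of q] by (intro \<zeta>_sum_eq) auto
    qed
    finally show ?thesis by simp
  qed

  (* Inserting 1 = (\<Sum>k. \<zeta> k) moves the integrals to the charts ch k, where the integrands add up to 0. *)
  have "(\<Sum>i\<in>I. chart_integral (ch i) (f i)) = (\<Sum>i\<in>I. \<Sum>k\<in>I. chart_integral (ch k) (\<lambda>p. \<zeta> k p * f i p))"
  proof (rule sum.cong[OF refl])
    fix i assume i: "i \<in> I"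
    have "chart_integral (ch i) (f i) = chart_integral (ch i) (\<lambda>p. \<Sum>k\<in>I. \<zeta> k p * f i p)"
    proof (rule chart_integral_cong[OF bump(1)[OF i]])
      fix p assume p: "p \<in> fst (ch i)"
      show "f i p = (\<Sum>k\<in>I. \<zeta> k p * f i p)"
      proof (cases "?q p < r\<^sup>2")
        case True
        then have "(\<Sum>k\<in>I. \<zeta> k p) = 1" using p chart_sub[OF i] by (intro \<zeta>_sum_eq) auto
        then show ?thesis by (simp flip: sum_distrib_right)
      qed (simp add: f_def \<phi>0)
    qed
    also have "\<dots> = (\<Sum>k\<in>I. chart_integral (ch i) (\<lambda>p. \<zeta> k p * f i p))"
      by (rule chart_integral_sum[OF bump(1)[OF i]]) (rule supp_f[OF i])
    also have "\<dots> = (\<Sum>k\<in>I. chart_integral (ch k) (\<lambda>p. \<zeta> k p * f i p))"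
      by (intro sum.cong refl chart_integral_overlap bump(1) supp_f supp_f' i)
    finally show "chart_integral (ch i) (f i) = (\<Sum>k\<in>I. chart_integral (ch k) (\<lambda>p. \<zeta> k p * f i p))" .
  qed
  also have "\<dots> = (\<Sum>k\<in>I. \<Sum>i\<in>I. chart_integral (ch k) (\<lambda>p. \<zeta> k p * f i p))" by (rule sum.swap)
  also have "\<dots> = (\<Sum>k\<in>I. chart_integral (ch k) (\<lambda>p. \<Sum>i\<in>I. \<zeta> k p * f i p))"
    by (intro sum.cong refl chart_integral_sum[symmetric] bump(1) supp_f')
  also have "\<dots> = 0"
  proof (rule sum.neutral, rule ballI)
    fix k assume k: "k \<in> I"
    have "chart_integral (ch k) (\<lambda>p. \<Sum>i\<in>I. \<zeta> k p * f i p) = chart_integral (ch k) (\<lambda>p. 0 * 0)"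
      by (rule chart_integral_cong[OF bump(1)[OF k]]) (simp add: sum_f[OF k] flip: sum_distrib_left)
    then show "chart_integral (ch k) (\<lambda>p. \<Sum>i\<in>I. \<zeta> k p * f i p) = 0"
      by (simp add: chart_integral_cmult[of _ 0 "\<lambda>p. 0", simplified])
  qed
  finally have gradient_terms: "(\<Sum>i\<in>I. chart_integral (ch i) (f i)) = 0" .

  \<comment> \<open>The integrand of the identity for phi itself, free of derivatives of the
    partition.\<close>
  define g where "g i p = ?E p * (\<phi> p + ?D i \<phi> p)" for i p
  have g_cont: "continuous_on (fst (ch i)) (g i)" if "i \<in> I" for i
    unfolding g_def
    by (intro continuous_on_mult continuous_on_add continuous_on_height_derivative C1_\<phi> that bump(1)
          continuous_on_subset[OF continuous_on_weight chart_sub]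
          continuous_on_subset[OF C1_manifold_continuous[OF C1_\<phi>] chart_sub])
  have "chart_integral (ch i) (\<lambda>p. \<zeta> i p * g i p) + chart_integral (ch i) (f i) = 0" if i: "i \<in> I" for i
  proof -
    have "supported_in (ch i) (f i)"
      unfolding supported_in_def using continuous_on_subset[OF f_cont[OF i]] bump(3,4)[OF i] f0[OF i] by blast
    then have "chart_integral (ch i) (\<lambda>p. \<zeta> i p * g i p) + chart_integral (ch i) (f i)
        = chart_integral (ch i) (\<lambda>p. \<zeta> i p * g i p + f i p)"
      by (intro chart_integral_add[symmetric] bump(1) supp g_cont i)
    \<comment> \<open>The product rule for \<open>\<zeta> i\<close> and phi merges both integrands
      into one to which the weighted divergence identity applies, because \<open>\<zeta> i\<close>
      has compact support in the chart.\<close>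
    also have "\<dots> = chart_integral (ch i) (\<lambda>p. ?E p * (\<zeta> i p * \<phi> p + ?D i (\<lambda>p. \<zeta> i p * \<phi> p) p))"
      by (rule chart_integral_cong[OF bump(1)[OF i]],
          subst height_derivative_mult[OF C1_\<zeta>[OF i] C1_\<phi> bump(1)[OF i]])
        (simp_all add: g_def f_def algebra_simps)
    also have "\<dots> = 0"
      by (rule chart_integral_weighted_divergence[OF C1_manifold_mult[OF C1_\<zeta>[OF i] C1_\<phi>] bump(1,3,4)[OF i]])
        (simp add: \<zeta>0[OF i])
    finally show ?thesis .
  qed
  then have "(\<Sum>i\<in>I. chart_integral (ch i) (\<lambda>p. \<zeta> i p * g i p) + chart_integral (ch i) (f i)) = 0"
    by (rule sum.neutral[OF ballI])
  then have identity: "(\<Sum>i\<in>I. chart_integral (ch i) (\<lambda>p. \<zeta> i p * g i p)) = 0"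
    unfolding sum.distrib gradient_terms by simp

  \<comment> \<open>The error density e^(h - rho) (1 - |F - x|^2/r^2)_+ left by differentiating the
    cutoff.\<close>
  define \<beta> where "\<beta> p = ?E p * (exp (- sqrt (1 + ?q p)) * max 0 (1 - ?q p / r\<^sup>2))" for p
  have \<beta>_nonneg: "0 \<le> \<beta> p" for p by (simp add: \<beta>_def)
  have \<beta>_cont: "continuous_on ?M \<beta>"
    unfolding \<beta>_def[abs_def] using r
    by (intro continuous_on_mult continuous_on_weight continuous_on_max continuous_on_diff
        continuous_on_divide continuous_on_exp continuous_on_minus continuous_on_real_sqrt
        continuous_on_add continuous_on_const continuous_on_sqdist) auto
  \<comment> \<open>Since b0 \<le> 1, this is a lower bound for the core density that can be
    integrated in the chart c0 alone.\<close>
  define a where "a p = b0 p * ?core p" for p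
  have a_cont: "continuous_on ?M a"
    unfolding a_def[abs_def] by (intro continuous_on_mult b0 continuous_on_core_density)
  let ?J = "\<lambda>i f. chart_integral (ch i) (\<lambda>p. \<zeta> i p * f p)"
  have "?J i a + - (4 / r) * ?J i \<beta> \<le> ?J i (g i)" if i: "i \<in> I" for i
  proof -
    note sa = supp[OF i continuous_on_subset[OF a_cont chart_sub[OF i]]]
    note s\<beta> = supp[OF i continuous_on_subset[OF continuous_on_mult[OF continuous_on_const \<beta>_cont] chart_sub[OF i]],
        of "- (4 / r)"]
    have "?J i a + - (4 / r) * ?J i \<beta> = chart_integral (ch i) (\<lambda>p. \<zeta> i p * a p + \<zeta> i p * (- (4 / r) * \<beta> p))"
      unfolding chart_integral_add[OF bump(1)[OF i] sa s\<beta>] chart_integral_cmult[symmetric]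
      by (simp add: mult.left_commute)
    also have "\<dots> = chart_integral (ch i) (\<lambda>p. \<zeta> i p * (a p + - (4 / r) * \<beta> p))"
      by (simp only: distrib_left)
    also have "\<dots> \<le> ?J i (g i)"
    proof (rule chart_integral_mono[OF bump(1)[OF i]])
      show "supported_in (ch i) (\<lambda>p. \<zeta> i p * (a p + - (4 / r) * \<beta> p))"
        by (intro supp i continuous_on_subset[OF _ chart_sub] continuous_on_add continuous_on_mult
            continuous_on_const a_cont \<beta>_cont)
      show "supported_in (ch i) (\<lambda>p. \<zeta> i p * g i p)" by (intro supp i g_cont)
      fix p assume p: "p \<in> fst (ch i)"
      have "a p \<le> ?core p"
        unfolding a_def using mult_right_mono[OF b01(2) core_density_nonneg] by simp
      moreover have "?core p - 4 / r * \<beta> p \<le> g i p"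
      proof -
        have "?core p - 4 / r * \<beta> p = ?E p * (exp (- sqrt (1 + ?q p)) * (square_pos (1 - ?q p) *
            (1 - sqrt (?q p) / sqrt (1 + ?q p))) - 4 / r * (exp (- sqrt (1 + ?q p)) * max 0 (1 - ?q p / r\<^sup>2)))"
          by (simp add: core_density_def \<beta>_def algebra_simps)
        also have "\<dots> \<le> g i p"
          unfolding g_def \<phi>_def height_derivative_radial_cutoff[OF bump(1)[OF i] p]
          by (intro mult_left_mono radial_cutoff_estimate sqdist_nonneg r
              height_derivative_sqdist_le bump(1)[OF i] p) simp
        finally show ?thesis .
      qed
      ultimately have "a p + - (4 / r) * \<beta> p \<le> g i p" by simp
      then show "\<zeta> i p * (a p + - (4 / r) * \<beta> p) \<le> \<zeta> i p * g i p"
        using \<zeta>_nonneg[OF i] by (rule mult_left_mono)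
    qed
    finally show ?thesis .
  qed
  then have "(\<Sum>i\<in>I. ?J i a + - (4 / r) * ?J i \<beta>) \<le> (\<Sum>i\<in>I. ?J i (g i))" by (rule sum_mono)
  \<comment> \<open>The identity makes the right side 0, so the main term is controlled by the error
    term with its factor 4/r.\<close>
  then have upper: "(\<Sum>i\<in>I. ?J i a) \<le> 4 / r * (\<Sum>i\<in>I. ?J i \<beta>)"
    unfolding identity sum.distrib sum_distrib_left[symmetric] by simp

  \<comment> \<open>The function a vanishes outside the unit ball, where r \<ge> 1 ensures that the
    partition functions add up to 1. Each piece is supported in c0 through b0 and in its own chart
    through \<open>\<zeta> i\<close>, so the overlap lemma moves it.\<close>
  have lower: "chart_integral c0 a = (\<Sum>i\<in>I. ?J i a)"
  proof -
    have sup0: "supported_in c0 (\<lambda>p. \<zeta> i p * a p)" if "i \<in> I" for i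
    proof -
      have "supported_in c0 (\<lambda>p. b0 p * (\<zeta> i p * ?core p))"
        by (intro supported_in_mult[OF c0 b0 _ S0] continuous_on_subset[OF _ domain_subset_carrier[OF c0]]
            continuous_on_mult \<zeta>_cont that continuous_on_core_density)
      then show ?thesis by (simp add: a_def mult.left_commute)
    qed
    have "chart_integral c0 a = chart_integral c0 (\<lambda>p. \<Sum>i\<in>I. \<zeta> i p * a p)"
    proof (rule chart_integral_cong[OF c0])
      fix p assume p: "p \<in> fst c0"
      show "a p = (\<Sum>i\<in>I. \<zeta> i p * a p)"
      proof (cases "?q p \<le> 1")
        case True
        moreover have "1 \<le> r\<^sup>2" using r by simp
        ultimately have "(\<Sum>i\<in>I. \<zeta> i p) = 1"
          using p domain_subset_carrier[OF c0] by (intro \<zeta>_sum_eq) auto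
        then show ?thesis by (simp flip: sum_distrib_right)
      next
        case False
        then have "square_pos (1 - ?q p) = 0" by (simp add: square_pos_eq_0_iff)
        then show ?thesis by (simp add: a_def core_density_def)
      qed
    qed
    also have "\<dots> = (\<Sum>i\<in>I. chart_integral c0 (\<lambda>p. \<zeta> i p * a p))"
      by (rule chart_integral_sum[OF c0 sup0])
    also have "\<dots> = (\<Sum>i\<in>I. ?J i a)"
      by (intro sum.cong refl chart_integral_overlap[OF c0 bump(1) sup0] supp
          continuous_on_subset[OF a_cont chart_sub])
    finally show ?thesis .
  qed

  \<comment> \<open>An empty atlas would yield the bottom measure, whose sigma-algebra is
    trivial.\<close>
  have "A \<noteq> {}" using c0 by auto
  note sets = sets_volume_measure[OF this]
  have B: "?B \<in> sets (volume_measure A F)" unfolding sets by (intro borel_open open_ball_preimage)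
  have supp\<beta>: "supported_in (ch i) (\<lambda>p. \<zeta> i p * \<beta> p)" if "i \<in> I" for i
    by (intro supp that continuous_on_subset[OF \<beta>_cont chart_sub])
  have "ennreal (\<Sum>i\<in>I. ?J i \<beta>) = (\<Sum>i\<in>I. ennreal (?J i \<beta>))"
    by (rule sum_ennreal[symmetric])
      (use bump(1) \<zeta>_nonneg \<beta>_nonneg in \<open>auto intro!: chart_integral_nonneg\<close>)
  also have "\<dots> \<le> (\<Sum>i\<in>I. \<integral>\<^sup>+p. ennreal (\<zeta> i p * \<beta> p) \<partial>volume_measure A F)"
    by (intro sum_mono chart_integral_le_nn_integral bump(1) supp\<beta> mult_nonneg_nonneg \<zeta>_nonneg \<beta>_nonneg)
  also have "\<dots> = (\<integral>\<^sup>+p. (\<Sum>i\<in>I. ennreal (\<zeta> i p * \<beta> p)) \<partial>volume_measure A F)"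
  proof (rule nn_integral_sum[symmetric])
    fix i assume i: "i \<in> I"
    have [measurable]: "(\<lambda>p. \<zeta> i p * \<beta> p) \<in> borel_measurable (volume_measure A F)"
      unfolding measurable_cong_sets[OF sets refl]
      by (rule supported_in_measurable[OF bump(1)[OF i] supp\<beta>[OF i]])
    show "(\<lambda>p. ennreal (\<zeta> i p * \<beta> p)) \<in> borel_measurable (volume_measure A F)" by measurable
  qed
  also have "\<dots> \<le> (\<integral>\<^sup>+p. ennreal (exp (snd x)) * indicator ?B p \<partial>volume_measure A F)"
  proof (rule nn_integral_mono)
    fix p
    have "(\<Sum>i\<in>I. ennreal (\<zeta> i p * \<beta> p)) = ennreal ((\<Sum>i\<in>I. \<zeta> i p) * \<beta> p)"
      unfolding sum_distrib_right by (rule sum_ennreal) (intro mult_nonneg_nonneg \<zeta>_nonneg \<beta>_nonneg)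
    also have "\<dots> \<le> ennreal (exp (snd x)) * indicator ?B p"
    proof (cases "p \<in> ?B")
      case True
      have "(\<Sum>i\<in>I. \<zeta> i p) * \<beta> p \<le> 1 * \<beta> p" by (rule mult_right_mono[OF \<zeta>_sum_le \<beta>_nonneg])
      also have "1 * \<beta> p \<le> ?E p * exp (- sqrt (1 + ?q p)) * 1"
        unfolding \<beta>_def using sqdist_nonneg[of x p] by (auto simp: mult.assoc intro!: mult_left_mono)
      also have "\<dots> \<le> exp (snd x)" using weight_le by simp
      finally show ?thesis using True by (simp add: ennreal_leI)
    next
      \<comment> \<open>Two reasons for the integrand to vanish off the preimage of the ball: on the
        carrier the cutoff in \<open>\<beta>\<close> is 0, and off the carrier every partition
        function is 0.\<close>
      case False
      have "(\<Sum>i\<in>I. \<zeta> i p) * \<beta> p = 0"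
      proof (cases "p \<in> ?M")
        case True
        then have "r\<^sup>2 \<le> ?q p" using False q_less[of p] by force
        then have "1 \<le> ?q p / r\<^sup>2" using r by simp
        then show ?thesis by (simp add: \<beta>_def)
      next
        case False
        then have "\<zeta> i p = 0" if "i \<in> I" for i
          using \<zeta>0[OF that] bump(4)[OF that] chart_sub[OF that] by blast
        then show ?thesis by simp
      qed
      then show ?thesis by (simp only: ennreal_0 zero_le)
    qed
    finally show "(\<Sum>i\<in>I. ennreal (\<zeta> i p * \<beta> p)) \<le> ennreal (exp (snd x)) * indicator ?B p" .
  qed
  also have "\<dots> = ennreal (exp (snd x)) * emeasure (volume_measure A F) ?B"
    by (rule nn_integral_cmult_indicator[OF B])
  finally have volume: "ennreal (\<Sum>i\<in>I. ?J i \<beta>) \<le> ennreal (exp (snd x)) * emeasure (volume_measure A F) ?B" .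

  \<comment> \<open>The constant collects the factor 4 from the derivative of the cutoff and
    e^(h(x)) from the bound on the weight.\<close>
  have "chart_integral c0 a * r / (4 * exp (snd x)) \<le> (4 / r * (\<Sum>i\<in>I. ?J i \<beta>)) * r / (4 * exp (snd x))"
    using upper r unfolding lower by (intro divide_right_mono mult_right_mono) auto
  also have "\<dots> = 1 / exp (snd x) * (\<Sum>i\<in>I. ?J i \<beta>)" using r by simp
  finally have "ennreal (chart_integral c0 a * r / (4 * exp (snd x)))
      \<le> ennreal (1 / exp (snd x) * (\<Sum>i\<in>I. ?J i \<beta>))"
    by (rule ennreal_leI)
  also have "\<dots> = ennreal (1 / exp (snd x)) * ennreal (\<Sum>i\<in>I. ?J i \<beta>)" by (rule ennreal_mult') simp
  also have "\<dots> \<le> ennreal (1 / exp (snd x)) * (ennreal (exp (snd x)) * emeasure (volume_measure A F) ?B)"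
    by (rule mult_left_mono[OF volume]) simp
  also have "\<dots> = emeasure (volume_measure A F) ?B"
    by (simp add: mult.assoc[symmetric] ennreal_mult[symmetric])
  finally show ?thesis unfolding a_def .
qed

end

theorem theorem1p1:
  fixes A :: "('m::{t2_space, second_countable_topology}, 'n::finite) chart set"
    and F :: "'m \<Rightarrow> (real ^ 'n) \<times> real"
    and x :: "(real ^ 'n) \<times> real"
  assumes "translator A F"
    and "complete_induced A F"
    and "properly_immersed A F"
    and "x \<in> F ` manifold_carrier A"
  shows "\<exists>C::real. C > 0 \<and>
    (\<forall>r::real. r \<ge> 1 \<longrightarrow>
       ennreal (C * r) \<le> emeasure (volume_measure A F) {p \<in> manifold_carrier A. F p \<in> ball x r})"
proof -
  interpret translator_manifold A F by unfold_locales (rule assms(1))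
  obtain p c where c: "c \<in> A" "p \<in> fst c" and x: "F p = x"
    using assms(4) by (auto simp: manifold_carrier_def)
  obtain b S where b: "C1_manifold b" and S: "compact S" "S \<subseteq> fst c" "\<And>q. q \<notin> S \<Longrightarrow> b q = 0"
    and b01: "\<And>q. 0 \<le> b q" "\<And>q. b q \<le> 1" and bp: "b p > 0"
    using ex_bump[OF c] by metis
  note b_cont = C1_manifold_continuous[OF b]
  \<comment> \<open>The bump around a preimage p of x is fixed before r is. At p the core density
    equals e^(h(x) - 1), which makes the integral positive.\<close>
  define \<kappa> where "\<kappa> = chart_integral c (\<lambda>p. b p * core_density x p)"
  have "\<kappa> > 0"
    unfolding \<kappa>_def
  proof (rule chart_integral_pos[OF c(1) _ _ c(2)])
    show "supported_in c (\<lambda>p. b p * core_density x p)"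
      by (intro supported_in_mult[OF c(1) b_cont _ S] continuous_on_subset[OF continuous_on_core_density]
          domain_subset_carrier c(1))
    show "0 \<le> b p * core_density x p" for p by (intro mult_nonneg_nonneg b01 core_density_nonneg)
    have "sqdist x p = 0" by (simp add: sqdist_def x)
    then have "core_density x p > 0" by (simp add: core_density_def square_pos_pos)
    then show "0 < b p * core_density x p" using bp by simp
  qed
  show ?thesis
  proof (intro exI conjI allI impI)
    show "\<kappa> / (4 * exp (snd x)) > 0" using \<open>\<kappa> > 0\<close> by simp
    fix r :: real assume r: "r \<ge> 1"
    \<comment> \<open>Properness enters here: it provides the compact set over which the finite
      partition of unity is built.\<close>
    have "compact {p \<in> manifold_carrier A. F p \<in> cball x r}"
      using assms(3) compact_cball unfolding properly_immersed_def by blast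
    from volume_lower_bound[OF r this c(1) b_cont S b01]
    show "ennreal (\<kappa> / (4 * exp (snd x)) * r)
        \<le> emeasure (volume_measure A F) {p \<in> manifold_carrier A. F p \<in> ball x r}"
      by (simp add: \<kappa>_def mult.commute)
  qed
qed

end
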